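(* Let $G$ be a finite group and let $R$ be a commutative ring. Coinduction induces an adjoint equivalence between the category of $R$-modules and the category of $C_e^G R$-modules, where $C_e^G R$-modules are Mackey functor modules over the underlying Green functor of the $G$-Tambara functor $C_e^G R$.
   Context: $C_e^G R$ is the coinduction of $R$ to a $G$-Tambara functor, i.e. the image of $R$ under the right adjoint of $T\mapsto T(G/e)$ from $G$-Tambara functors to commutative rings. Explicitly, $C_e^G R(G/H)=\mathrm{Fun}(G,R)^H$, where $\mathrm{Fun}(G,R)$ is the ring of functions $G\to R$ with $G$-action $(g\cdot\varphi)(h)=\varphi(hg)$; restrictions are inclusions of fixed points, conjugations are given by the action, transfers are $\mathrm{tr}_H^K x=\sum_{kH\in K/H}kx$ and norms are $\mathrm{nm}_H^K x=\prod_{kH\in K/H}kx$. Its underlying Green functor (forget the norms) is a commutative monoid for the box product of $G$-Mackey functors. A module over a Green functor $k$ is a Mackey functor with an action of the monoid $k$ for the box product; equivalently, a Mackey functor $M$ with $k(G/H)$-module structures on all $M(G/H)$ compatible with restrictions and conjugations and satisfying Frobenius reciprocity $\mathrm{tr}(x)\cdot m=\mathrm{tr}(x\cdot\mathrm{res}(m))$ and $\mathrm{tr}(\mathrm{res}(a)\cdot m)=a\cdot\mathrm{tr}(m)$. The coinduction of an $R$-module $X$ is the Mackey functor $C_e^G X$ with $C_e^G X(G/H)=\mathrm{Fun}(G,X)^H$, with the same formulas for restriction, conjugation and transfer, made into a $C_e^G R$-module by pointwise multiplication. *)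

theory Defs
  imports "HOL-Algebra.AbelCoset" "HOL-Algebra.Module"
begin

section \<open>Categories and adjoint equivalences\<close>

text \<open>Composition takes its three objects as arguments: \<open>Comp C X Y Z g f\<close> is the composite of
  \<open>f : X \<rightarrow> Y\<close> and \<open>g : Y \<rightarrow> Z\<close>.\<close>

record ('o, 'a) category =
  Ob :: "'o set"
  Mor :: "'o \<Rightarrow> 'o \<Rightarrow> 'a set"
  Ident :: "'o \<Rightarrow> 'a"
  Comp :: "'o \<Rightarrow> 'o \<Rightarrow> 'o \<Rightarrow> 'a \<Rightarrow> 'a \<Rightarrow> 'a"

locale category =
  fixes C :: "('o, 'a) category"
  assumes ident_mor: "X \<in> Ob C \<Longrightarrow> Ident C X \<in> Mor C X X"
    and comp_mor: "\<lbrakk>X \<in> Ob C; Y \<in> Ob C; Z \<in> Ob C; f \<in> Mor C X Y; g \<in> Mor C Y Z\<rbrakk>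
      \<Longrightarrow> Comp C X Y Z g f \<in> Mor C X Z"
    and comp_ident_right: "\<lbrakk>X \<in> Ob C; Y \<in> Ob C; f \<in> Mor C X Y\<rbrakk>
      \<Longrightarrow> Comp C X X Y f (Ident C X) = f"
    and comp_ident_left: "\<lbrakk>X \<in> Ob C; Y \<in> Ob C; f \<in> Mor C X Y\<rbrakk>
      \<Longrightarrow> Comp C X Y Y (Ident C Y) f = f"
    and comp_assoc: "\<lbrakk>W \<in> Ob C; X \<in> Ob C; Y \<in> Ob C; Z \<in> Ob C;
        f \<in> Mor C W X; g \<in> Mor C X Y; h \<in> Mor C Y Z\<rbrakk>
      \<Longrightarrow> Comp C W Y Z h (Comp C W X Y g f) = Comp C W X Z (Comp C X Y Z h g) f"

record ('o, 'a, 'p, 'b) functor_data =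
  FOb :: "'o \<Rightarrow> 'p"
  FMor :: "'o \<Rightarrow> 'o \<Rightarrow> 'a \<Rightarrow> 'b"

locale category_functor = source: category C + target: category D
  for C :: "('o, 'a) category" and D :: "('p, 'b) category" +
  fixes F :: "('o, 'a, 'p, 'b) functor_data"
  assumes fob: "X \<in> Ob C \<Longrightarrow> FOb F X \<in> Ob D"
    and fmor: "\<lbrakk>X \<in> Ob C; Y \<in> Ob C; f \<in> Mor C X Y\<rbrakk>
      \<Longrightarrow> FMor F X Y f \<in> Mor D (FOb F X) (FOb F Y)"
    and fmor_ident: "X \<in> Ob C \<Longrightarrow> FMor F X X (Ident C X) = Ident D (FOb F X)"
    and fmor_comp: "\<lbrakk>X \<in> Ob C; Y \<in> Ob C; Z \<in> Ob C; f \<in> Mor C X Y; g \<in> Mor C Y Z\<rbrakk>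
      \<Longrightarrow> FMor F X Z (Comp C X Y Z g f)
        = Comp D (FOb F X) (FOb F Y) (FOb F Z) (FMor F Y Z g) (FMor F X Y f)"

definition id_functor :: "('o, 'a, 'o, 'a) functor_data" where
  "id_functor = \<lparr>FOb = (\<lambda>X. X), FMor = (\<lambda>X Y f. f)\<rparr>"

definition comp_functor ::
  "('p, 'b, 'q, 'c) functor_data \<Rightarrow> ('o, 'a, 'p, 'b) functor_data \<Rightarrow> ('o, 'a, 'q, 'c) functor_data"
  where "comp_functor G F =
    \<lparr>FOb = (\<lambda>X. FOb G (FOb F X)), FMor = (\<lambda>X Y f. FMor G (FOb F X) (FOb F Y) (FMor F X Y f))\<rparr>"

definition is_iso :: "('o, 'a) category \<Rightarrow> 'o \<Rightarrow> 'o \<Rightarrow> 'a \<Rightarrow> bool" where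
  "is_iso C X Y f \<longleftrightarrow> f \<in> Mor C X Y \<and>
    (\<exists>g \<in> Mor C Y X. Comp C X Y X g f = Ident C X \<and> Comp C Y X Y f g = Ident C Y)"

locale natural_iso = F: category_functor C D F + F': category_functor C D F'
  for C :: "('o, 'a) category" and D :: "('p, 'b) category" and F F' +
  fixes \<eta> :: "'o \<Rightarrow> 'b"
  assumes component_iso: "X \<in> Ob C \<Longrightarrow> is_iso D (FOb F X) (FOb F' X) (\<eta> X)"
    and naturality: "\<lbrakk>X \<in> Ob C; Y \<in> Ob C; f \<in> Mor C X Y\<rbrakk>
      \<Longrightarrow> Comp D (FOb F X) (FOb F Y) (FOb F' Y) (\<eta> Y) (FMor F X Y f)
        = Comp D (FOb F X) (FOb F' X) (FOb F' Y) (FMor F' X Y f) (\<eta> X)"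

text \<open>\<open>F\<close> is left adjoint to \<open>G\<close>, with invertible unit \<open>\<eta>\<close> and counit \<open>\<epsilon>\<close>.\<close>

locale adjoint_equivalence =
    left: category_functor C D F + right: category_functor D C G
  + unit: natural_iso C C id_functor "comp_functor G F" \<eta>
  + counit: natural_iso D D "comp_functor F G" id_functor \<epsilon>
  for C :: "('o, 'a) category" and D :: "('p, 'b) category" and F G \<eta> \<epsilon> +
  assumes triangle_left: "X \<in> Ob C \<Longrightarrow>
      Comp D (FOb F X) (FOb F (FOb G (FOb F X))) (FOb F X)
        (\<epsilon> (FOb F X)) (FMor F X (FOb G (FOb F X)) (\<eta> X))
      = Ident D (FOb F X)"
    and triangle_right: "Y \<in> Ob D \<Longrightarrow>
      Comp C (FOb G Y) (FOb G (FOb F (FOb G Y))) (FOb G Y)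
        (FMor G (FOb F (FOb G Y)) Y (\<epsilon> Y)) (\<eta> (FOb G Y))
      = Ident C (FOb G Y)"


section \<open>The category of modules over a commutative ring\<close>

definition module_hom ::
  "('r, 'z) ring_scheme \<Rightarrow> ('r, 'x, 'y) module_scheme \<Rightarrow> ('r, 'w, 'v) module_scheme \<Rightarrow> ('x \<Rightarrow> 'w) set"
  where "module_hom R X Y = {f \<in> carrier X \<rightarrow>\<^sub>E carrier Y.
    (\<forall>x\<in>carrier X. \<forall>y\<in>carrier X. f (x \<oplus>\<^bsub>X\<^esub> y) = f x \<oplus>\<^bsub>Y\<^esub> f y) \<and>
    (\<forall>r\<in>carrier R. \<forall>x\<in>carrier X. f (r \<odot>\<^bsub>X\<^esub> x) = r \<odot>\<^bsub>Y\<^esub> f x)}"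

text \<open>The set \<open>U\<close> is the universe in which the underlying sets of modules live.  Morphisms are
  extensional functions, so that they are determined by their values on the carrier.  (The
  \<open>mult\<close> and \<open>one\<close> components of a \<^type>\<open>module\<close> record carry no meaning for a module; modules
  differing only there are isomorphic via the identity.)\<close>

definition module_category ::
  "('r, 'z) ring_scheme \<Rightarrow> 'x set \<Rightarrow> (('r, 'x) module, 'x \<Rightarrow> 'x) category" where
  "module_category R U = \<lparr>
    Ob = {X. module R X \<and> carrier X \<subseteq> U},
    Mor = module_hom R,
    Ident = (\<lambda>X. \<lambda>x\<in>carrier X. x),
    Comp = (\<lambda>X Y Z g f. compose (carrier X) g f)\<rparr>"


section \<open>Mackey functors, Green functors and their modules\<close>

text \<open>\<open>level M H\<close> is the value at the orbit \<open>G/H\<close>, for a subgroup \<open>H\<close> (the values at other sets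
  are irrelevant).  Restriction and transfer take source, then target:
  \<open>restr M K H\<close> maps \<open>M(G/K)\<close> to \<open>M(G/H)\<close> and \<open>transf M H K\<close> maps \<open>M(G/H)\<close> to \<open>M(G/K)\<close>, for
  \<open>H \<subseteq> K\<close>;  \<open>conjg M g H\<close> maps \<open>M(G/H)\<close> to the value at \<open>gHg\<^sup>-\<^sup>1\<close>.\<close>

record ('g, 'm, 'l) mackey =
  level :: "'g set \<Rightarrow> 'l"
  restr :: "'g set \<Rightarrow> 'g set \<Rightarrow> 'm \<Rightarrow> 'm"
  transf :: "'g set \<Rightarrow> 'g set \<Rightarrow> 'm \<Rightarrow> 'm"
  conjg :: "'g \<Rightarrow> 'g set \<Rightarrow> 'm \<Rightarrow> 'm"

text \<open>The operations of a Tambara functor: those of its underlying Green functor, and norms.\<close>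

record ('g, 'm, 'l) tambara = "('g, 'm, 'l) mackey" +
  nrm :: "'g set \<Rightarrow> 'g set \<Rightarrow> 'm \<Rightarrow> 'm"

definition underlying_green :: "('g, 'm, 'l) tambara \<Rightarrow> ('g, 'm, 'l) mackey" where
  "underlying_green T = mackey.truncate T"

type_synonym ('g, 'k) green_data = "('g, 'k, 'k ring) mackey"
type_synonym ('g, 'k, 'm) green_module_data = "('g, 'm, ('k, 'm) module) mackey"

definition conj_subgroup :: "('g, 'z) monoid_scheme \<Rightarrow> 'g \<Rightarrow> 'g set \<Rightarrow> 'g set" where
  "conj_subgroup G g H = (\<lambda>h. g \<otimes>\<^bsub>G\<^esub> h \<otimes>\<^bsub>G\<^esub> inv\<^bsub>G\<^esub> g) ` H"

definition double_cosets :: "('g, 'z) monoid_scheme \<Rightarrow> 'g set \<Rightarrow> 'g set \<Rightarrow> 'g set \<Rightarrow> 'g set set" where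
  "double_cosets G J H K = (\<lambda>g. J <#>\<^bsub>G\<^esub> (g <#\<^bsub>G\<^esub> K)) ` H"

text \<open>In the double coset formula, the summand indexed by a double coset \<open>JgK\<close> does not depend on
  the representative \<open>g\<close>, by the other axioms.\<close>

locale mackey_functor = group G for G :: "('g, 'z) monoid_scheme" (structure) +
  fixes M :: "('g, 'm, ('m, 'y) ring_scheme) mackey"
  assumes finite_group: "finite (carrier G)"
    and restr_hom: "\<lbrakk>subgroup H G; subgroup K G; H \<subseteq> K\<rbrakk>
      \<Longrightarrow> abelian_group_hom (level M K) (level M H) (restr M K H)"
    and transf_hom: "\<lbrakk>subgroup H G; subgroup K G; H \<subseteq> K\<rbrakk>
      \<Longrightarrow> abelian_group_hom (level M H) (level M K) (transf M H K)"
    and conjg_hom: "\<lbrakk>subgroup H G; g \<in> carrier G\<rbrakk>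
      \<Longrightarrow> abelian_group_hom (level M H) (level M (conj_subgroup G g H)) (conjg M g H)"
    and restr_self: "\<lbrakk>subgroup H G; x \<in> carrier (level M H)\<rbrakk> \<Longrightarrow> restr M H H x = x"
    and transf_self: "\<lbrakk>subgroup H G; x \<in> carrier (level M H)\<rbrakk> \<Longrightarrow> transf M H H x = x"
    and conjg_self: "\<lbrakk>subgroup H G; h \<in> H; x \<in> carrier (level M H)\<rbrakk> \<Longrightarrow> conjg M h H x = x"
    and restr_restr: "\<lbrakk>subgroup J G; subgroup H G; subgroup K G; J \<subseteq> H; H \<subseteq> K;
        x \<in> carrier (level M K)\<rbrakk>
      \<Longrightarrow> restr M H J (restr M K H x) = restr M K J x"
    and transf_transf: "\<lbrakk>subgroup J G; subgroup H G; subgroup K G; J \<subseteq> H; H \<subseteq> K;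
        x \<in> carrier (level M J)\<rbrakk>
      \<Longrightarrow> transf M H K (transf M J H x) = transf M J K x"
    and conjg_conjg: "\<lbrakk>subgroup H G; g \<in> carrier G; g' \<in> carrier G; x \<in> carrier (level M H)\<rbrakk>
      \<Longrightarrow> conjg M g (conj_subgroup G g' H) (conjg M g' H x) = conjg M (g \<otimes> g') H x"
    and conjg_restr: "\<lbrakk>subgroup H G; subgroup K G; H \<subseteq> K; g \<in> carrier G;
        x \<in> carrier (level M K)\<rbrakk>
      \<Longrightarrow> conjg M g H (restr M K H x)
        = restr M (conj_subgroup G g K) (conj_subgroup G g H) (conjg M g K x)"
    and conjg_transf: "\<lbrakk>subgroup H G; subgroup K G; H \<subseteq> K; g \<in> carrier G;
        x \<in> carrier (level M H)\<rbrakk>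
      \<Longrightarrow> conjg M g K (transf M H K x)
        = transf M (conj_subgroup G g H) (conj_subgroup G g K) (conjg M g H x)"
    and double_coset_formula: "\<lbrakk>subgroup J G; subgroup K G; subgroup H G; J \<subseteq> H; K \<subseteq> H;
        x \<in> carrier (level M K)\<rbrakk>
      \<Longrightarrow> restr M H J (transf M K H x) =
        (\<Oplus>\<^bsub>level M J\<^esub> D \<in> double_cosets G J H K.
          let g = (SOME g. g \<in> D); L = K \<inter> conj_subgroup G (inv g) J
          in transf M (J \<inter> conj_subgroup G g K) J (conjg M g L (restr M K L x)))"

text \<open>A commutative Green functor, i.e. a commutative monoid for the box product.\<close>

locale green_functor = mackey_functor G k
  for G :: "('g, 'z) monoid_scheme" (structure) and k :: "('g, 'k) green_data" +
  assumes level_cring: "subgroup H G \<Longrightarrow> cring (level k H)"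
    and restr_ring_hom: "\<lbrakk>subgroup H G; subgroup K G; H \<subseteq> K\<rbrakk>
      \<Longrightarrow> restr k K H \<in> ring_hom (level k K) (level k H)"
    and conjg_ring_hom: "\<lbrakk>subgroup H G; g \<in> carrier G\<rbrakk>
      \<Longrightarrow> conjg k g H \<in> ring_hom (level k H) (level k (conj_subgroup G g H))"
    and ring_frobenius: "\<lbrakk>subgroup H G; subgroup K G; H \<subseteq> K;
        x \<in> carrier (level k H); a \<in> carrier (level k K)\<rbrakk>
      \<Longrightarrow> transf k H K x \<otimes>\<^bsub>level k K\<^esub> a = transf k H K (x \<otimes>\<^bsub>level k H\<^esub> restr k K H a)"

locale green_module = ring: green_functor G k + mackey_functor G M
  for G :: "('g, 'z) monoid_scheme" (structure)
    and k :: "('g, 'k) green_data" and M :: "('g, 'k, 'm) green_module_data" +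
  assumes level_module: "subgroup H G \<Longrightarrow> module (level k H) (level M H)"
    and restr_smult: "\<lbrakk>subgroup H G; subgroup K G; H \<subseteq> K;
        a \<in> carrier (level k K); m \<in> carrier (level M K)\<rbrakk>
      \<Longrightarrow> restr M K H (a \<odot>\<^bsub>level M K\<^esub> m) = restr k K H a \<odot>\<^bsub>level M H\<^esub> restr M K H m"
    and conjg_smult: "\<lbrakk>subgroup H G; g \<in> carrier G;
        a \<in> carrier (level k H); m \<in> carrier (level M H)\<rbrakk>
      \<Longrightarrow> conjg M g H (a \<odot>\<^bsub>level M H\<^esub> m)
        = conjg k g H a \<odot>\<^bsub>level M (conj_subgroup G g H)\<^esub> conjg M g H m"
    and frobenius_transf_ring: "\<lbrakk>subgroup H G; subgroup K G; H \<subseteq> K;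
        x \<in> carrier (level k H); m \<in> carrier (level M K)\<rbrakk>
      \<Longrightarrow> transf k H K x \<odot>\<^bsub>level M K\<^esub> m = transf M H K (x \<odot>\<^bsub>level M H\<^esub> restr M K H m)"
    and frobenius_transf_module: "\<lbrakk>subgroup H G; subgroup K G; H \<subseteq> K;
        a \<in> carrier (level k K); m \<in> carrier (level M H)\<rbrakk>
      \<Longrightarrow> transf M H K (restr k K H a \<odot>\<^bsub>level M H\<^esub> m) = a \<odot>\<^bsub>level M K\<^esub> transf M H K m"

text \<open>A morphism is a family of linear maps indexed by the subgroups of \<open>G\<close> (and is
  \<^const>\<open>undefined\<close> at other sets) that commutes with restrictions, transfers and conjugations.\<close>

definition green_module_hom ::
  "('g, 'z) monoid_scheme \<Rightarrow> ('g, 'k) green_data \<Rightarrow> ('g, 'k, 'm) green_module_data \<Rightarrow>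
    ('g, 'k, 'n) green_module_data \<Rightarrow> ('g set \<Rightarrow> 'm \<Rightarrow> 'n) set" where
  "green_module_hom G k M N =
    {f \<in> \<Pi>\<^sub>E H\<in>{H. subgroup H G}. module_hom (level k H) (level M H) (level N H).
      (\<forall>H K. subgroup H G \<longrightarrow> subgroup K G \<longrightarrow> H \<subseteq> K \<longrightarrow>
        (\<forall>m\<in>carrier (level M K). f H (restr M K H m) = restr N K H (f K m)) \<and>
        (\<forall>m\<in>carrier (level M H). f K (transf M H K m) = transf N H K (f H m))) \<and>
      (\<forall>H g. subgroup H G \<longrightarrow> g \<in> carrier G \<longrightarrow>
        (\<forall>m\<in>carrier (level M H). f (conj_subgroup G g H) (conjg M g H m) = conjg N g H (f H m)))}"

text \<open>As in \<^const>\<open>module_category\<close>, \<open>V\<close> is the universe in which the underlying sets of the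
  levels live.\<close>

definition green_module_category ::
  "('g, 'z) monoid_scheme \<Rightarrow> ('g, 'k) green_data \<Rightarrow> 'm set \<Rightarrow>
    (('g, 'k, 'm) green_module_data, 'g set \<Rightarrow> 'm \<Rightarrow> 'm) category" where
  "green_module_category G k V = \<lparr>
    Ob = {M. green_module G k M \<and> (\<forall>H. subgroup H G \<longrightarrow> carrier (level M H) \<subseteq> V)},
    Mor = green_module_hom G k,
    Ident = (\<lambda>M. \<lambda>H\<in>{H. subgroup H G}. \<lambda>m\<in>carrier (level M H). m),
    Comp = (\<lambda>M N P g f. \<lambda>H\<in>{H. subgroup H G}. compose (carrier (level M H)) (g H) (f H))\<rparr>"


section \<open>Coinduction\<close>

text \<open>\<open>Fun(G, X)\<close> with pointwise operations.  Functions are extensional on \<open>carrier G\<close>.\<close>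

definition fun_ring :: "('g, 'z) monoid_scheme \<Rightarrow> ('x, 'y) ring_scheme \<Rightarrow> ('g \<Rightarrow> 'x) ring" where
  "fun_ring G X = \<lparr>
    carrier = carrier G \<rightarrow>\<^sub>E carrier X,
    mult = (\<lambda>\<phi> \<psi>. \<lambda>g\<in>carrier G. \<phi> g \<otimes>\<^bsub>X\<^esub> \<psi> g),
    one = (\<lambda>g\<in>carrier G. \<one>\<^bsub>X\<^esub>),
    zero = (\<lambda>g\<in>carrier G. \<zero>\<^bsub>X\<^esub>),
    add = (\<lambda>\<phi> \<psi>. \<lambda>g\<in>carrier G. \<phi> g \<oplus>\<^bsub>X\<^esub> \<psi> g)\<rparr>"

definition fun_act :: "('g, 'z) monoid_scheme \<Rightarrow> 'g \<Rightarrow> ('g \<Rightarrow> 'x) \<Rightarrow> 'g \<Rightarrow> 'x" where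
  "fun_act G g \<phi> = (\<lambda>h\<in>carrier G. \<phi> (h \<otimes>\<^bsub>G\<^esub> g))"

definition fun_fixed ::
  "('g, 'z) monoid_scheme \<Rightarrow> ('x, 'y) ring_scheme \<Rightarrow> 'g set \<Rightarrow> ('g \<Rightarrow> 'x) set" where
  "fun_fixed G X H = {\<phi> \<in> carrier G \<rightarrow>\<^sub>E carrier X. \<forall>h\<in>H. fun_act G h \<phi> = \<phi>}"

definition left_cosets_in :: "('g, 'z) monoid_scheme \<Rightarrow> 'g set \<Rightarrow> 'g set \<Rightarrow> 'g set set" where
  "left_cosets_in G K H = (\<lambda>k. k <#\<^bsub>G\<^esub> H) ` K"

definition fun_transf ::
  "('g, 'z) monoid_scheme \<Rightarrow> ('x, 'y) ring_scheme \<Rightarrow> 'g set \<Rightarrow> 'g set \<Rightarrow> ('g \<Rightarrow> 'x) \<Rightarrow> 'g \<Rightarrow> 'x" where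
  "fun_transf G X H K \<phi> =
    (\<Oplus>\<^bsub>fun_ring G X\<^esub> C \<in> left_cosets_in G K H. fun_act G (SOME k. k \<in> C) \<phi>)"

definition fun_norm ::
  "('g, 'z) monoid_scheme \<Rightarrow> ('x, 'y) ring_scheme \<Rightarrow> 'g set \<Rightarrow> 'g set \<Rightarrow> ('g \<Rightarrow> 'x) \<Rightarrow> 'g \<Rightarrow> 'x" where
  "fun_norm G X H K \<phi> =
    (\<Otimes>\<^bsub>fun_ring G X\<^esub> C \<in> left_cosets_in G K H. fun_act G (SOME k. k \<in> C) \<phi>)"

definition coind_tambara ::
  "('g, 'z) monoid_scheme \<Rightarrow> ('r, 'y) ring_scheme \<Rightarrow> ('g, 'g \<Rightarrow> 'r, ('g \<Rightarrow> 'r) ring) tambara" where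
  "coind_tambara G R = \<lparr>
    level = (\<lambda>H. (fun_ring G R)\<lparr>carrier := fun_fixed G R H\<rparr>),
    restr = (\<lambda>K H \<phi>. \<phi>),
    transf = fun_transf G R,
    conjg = (\<lambda>g H. fun_act G g),
    nrm = fun_norm G R\<rparr>"

definition coind_module_level ::
  "('g, 'z) monoid_scheme \<Rightarrow> ('r, 'x) module \<Rightarrow> 'g set \<Rightarrow> ('g \<Rightarrow> 'r, 'g \<Rightarrow> 'x) module" where
  "coind_module_level G X H = \<lparr>
    carrier = fun_fixed G X H,
    mult = mult (fun_ring G X),
    one = one (fun_ring G X),
    zero = zero (fun_ring G X),
    add = add (fun_ring G X),
    smult = (\<lambda>a \<phi>. \<lambda>g\<in>carrier G. a g \<odot>\<^bsub>X\<^esub> \<phi> g)\<rparr>"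

definition coind_module ::
  "('g, 'z) monoid_scheme \<Rightarrow> ('r, 'x) module \<Rightarrow> ('g, 'g \<Rightarrow> 'r, 'g \<Rightarrow> 'x) green_module_data" where
  "coind_module G X = \<lparr>
    level = coind_module_level G X,
    restr = (\<lambda>K H \<phi>. \<phi>),
    transf = fun_transf G X,
    conjg = (\<lambda>g H. fun_act G g)\<rparr>"

definition coind_hom ::
  "('g, 'z) monoid_scheme \<Rightarrow> ('r, 'x) module \<Rightarrow> ('x \<Rightarrow> 'w) \<Rightarrow> 'g set \<Rightarrow> ('g \<Rightarrow> 'x) \<Rightarrow> 'g \<Rightarrow> 'w" where
  "coind_hom G X f =
    (\<lambda>H\<in>{H. subgroup H G}. \<lambda>\<phi>\<in>fun_fixed G X H. compose (carrier G) f \<phi>)"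

definition coind_functor ::
  "('g, 'z) monoid_scheme \<Rightarrow>
    (('r, 'x) module, 'x \<Rightarrow> 'x,
     ('g, 'g \<Rightarrow> 'r, 'g \<Rightarrow> 'x) green_module_data, 'g set \<Rightarrow> ('g \<Rightarrow> 'x) \<Rightarrow> 'g \<Rightarrow> 'x) functor_data"
  where "coind_functor G = \<lparr>FOb = coind_module G, FMor = (\<lambda>X Y. coind_hom G X)\<rparr>"

end

theory Submission
  imports Defs
begin

text \<open>Coinduction is fully faithful: a morphism \<open>F\<close> between coinduced modules commutes with
  conjugations, so it is determined by \<open>\<phi> \<mapsto> F \<phi> 1\<close> at the trivial subgroup, and linearity over
  the idempotent \<open>\<delta>\<close> concentrated at \<open>1\<close> shows that \<open>F \<phi> 1\<close> depends only on \<open>\<phi> 1\<close>.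

  It is essentially surjective: for a module \<open>M\<close> put \<open>X = \<delta> M(G/e)\<close> and send \<open>m \<in> M(G/H)\<close> to
  \<open>g \<mapsto> \<delta> \<cdot> c\<^sub>g (res m)\<close>.  At \<open>H = e\<close> this is bijective because the translates of \<open>\<delta>\<close> are
  orthogonal idempotents with sum \<open>1\<close>.  In general the unit of \<open>k(G/H)\<close> is the transfer of the
  indicator function \<open>x\<close> of a transversal of \<open>G/H\<close>, so \<open>m = tr (x \<cdot> res m)\<close>, and an \<open>H\<close>-invariant
  \<open>y \<in> M(G/e)\<close> is the restriction of \<open>tr (x \<cdot> y)\<close>.  As \<open>U\<close> is infinite and \<open>G\<close> is finite, \<open>X\<close>
  can be transported into \<open>U\<close>.\<close>

section \<open>Adjoint equivalences from fully faithful functors\<close>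

text \<open>Coinduction is the right adjoint here. Its left adjoint is not given by a formula: an
  isomorphism from each Green module to a coinduced one is chosen, and full faithfulness then fixes
  the left adjoint on morphisms and supplies the counit. The idempotent exists because
  \<open>Fun(G, R)\<close> is a product of copies of \<open>R\<close> indexed by \<open>G\<close>.
  The group acts semilinearly on M(G/e) and permutes the factors simply transitively, so a single
  factor with its \<open>R\<close>-action carries everything at the trivial subgroup. Unless
  \<open>R\<close> is zero, \<open>delta\<close> is not fixed by any nontrivial subgroup, hence does
  not belong to k(G/H) for larger \<open>H\<close>. This is why arguments about M(G/H) pass through
  restriction to the trivial subgroup and come back by transfer. The laborious part is that
  coinduction satisfies the Mackey axioms at all: transfers and the double coset formula use
  \<open>SOME\<close> representatives, which are not preserved by conjugation or by passing between
  subgroups. All these identities are therefore reduced to reindexing or regrouping sums of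
  invariant functions over cosets.\<close>

lemma category_functor_id:
  assumes "category C"
  shows "category_functor C C id_functor"
proof -
  interpret category C by fact
  show ?thesis by unfold_locales (simp_all add: id_functor_def)
qed

lemma category_functor_comp:
  assumes "category_functor C D F" "category_functor D E F'"
  shows "category_functor C E (comp_functor F' F)"
proof -
  interpret F: category_functor C D F by fact
  interpret F': category_functor D E F' by fact
  show ?thesis
    by unfold_locales
      (simp_all add: comp_functor_def F.fob F.fmor F.fmor_ident F.fmor_comp
        F'.fob F'.fmor F'.fmor_ident F'.fmor_comp)
qed

text \<open>Full faithfulness lets every arrow between images of \<open>P\<close> be lifted and
  every equation in \<open>D\<close> be checked after applying \<open>P\<close>, so the work happens
  in \<open>C\<close>. There \<open>L\<close> acts by conjugation with the chosen isomorphisms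
  \<open>e\<close>, and these cancel against their inverses in each required identity.\<close>

theorem fully_faithful_ess_surj_adjoint_equivalence:
  assumes P: "category_functor D C P"
    and full_faithful: "\<And>X Y. \<lbrakk>X \<in> Ob D; Y \<in> Ob D\<rbrakk>
      \<Longrightarrow> bij_betw (FMor P X Y) (Mor D X Y) (Mor C (FOb P X) (FOb P Y))"
    and ess_surj: "\<And>Y. Y \<in> Ob C \<Longrightarrow> \<exists>X \<in> Ob D. \<exists>f. is_iso C Y (FOb P X) f"
  shows "\<exists>L \<eta> \<epsilon>. adjoint_equivalence C D L P \<eta> \<epsilon>"
proof -
  interpret P: category_functor D C P by fact
  have "\<forall>Y \<in> Ob C. \<exists>X f g. X \<in> Ob D \<and> f \<in> Mor C Y (FOb P X) \<and> g \<in> Mor C (FOb P X) Y \<and>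
      Comp C Y (FOb P X) Y g f = Ident C Y \<and>
      Comp C (FOb P X) Y (FOb P X) f g = Ident C (FOb P X)"
    using ess_surj unfolding is_iso_def by blast
  then obtain L0 e e' where L0: "\<And>Y. Y \<in> Ob C \<Longrightarrow> L0 Y \<in> Ob D"
    and e: "\<And>Y. Y \<in> Ob C \<Longrightarrow> e Y \<in> Mor C Y (FOb P (L0 Y))"
    and e': "\<And>Y. Y \<in> Ob C \<Longrightarrow> e' Y \<in> Mor C (FOb P (L0 Y)) Y"
    and e'e: "\<And>Y. Y \<in> Ob C \<Longrightarrow> Comp C Y (FOb P (L0 Y)) Y (e' Y) (e Y) = Ident C Y"
    and ee': "\<And>Y. Y \<in> Ob C \<Longrightarrow> Comp C (FOb P (L0 Y)) Y (FOb P (L0 Y)) (e Y) (e' Y)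
      = Ident C (FOb P (L0 Y))"
    by metis
  define lift where "lift = (\<lambda>X Y. inv_into (Mor D X Y) (FMor P X Y))"
  have lift: "lift X Y u \<in> Mor D X Y" and P_lift: "FMor P X Y (lift X Y u) = u"
    if "X \<in> Ob D" "Y \<in> Ob D" "u \<in> Mor C (FOb P X) (FOb P Y)" for X Y u
    using bij_betw_imp_surj_on[OF full_faithful[OF that(1,2)]] that(3)
    unfolding lift_def by (auto intro: inv_into_into f_inv_into_f)
  have faithful: "f = g" if "FMor P X Y f = FMor P X Y g"
    "X \<in> Ob D" "Y \<in> Ob D" "f \<in> Mor D X Y" "g \<in> Mor D X Y" for X Y f g
    using bij_betw_imp_inj_on[OF full_faithful[OF that(2,3)]] that by (auto dest: inj_onD)
  have assoc: "Comp C W X Z (Comp C X Y Z h g) f = Comp C W Y Z h (Comp C W X Y g f)"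
    if "W \<in> Ob C" "X \<in> Ob C" "Y \<in> Ob C" "Z \<in> Ob C"
      "f \<in> Mor C W X" "g \<in> Mor C X Y" "h \<in> Mor C Y Z" for W X Y Z f g h
    using P.target.comp_assoc that by simp
  \<comment> \<open>Since \<open>assoc\<close> nests composites to the right, \<open>e'e\<close>
    alone does not match inside a longer composite. The two forms with a trailing \<open>f\<close>
    let the simplifier cancel there as well.\<close>
  have e'e_cancel: "Comp C W (FOb P (L0 Y)) Y (e' Y) (Comp C W Y (FOb P (L0 Y)) (e Y) f) = f"
    if "W \<in> Ob C" "Y \<in> Ob C" "f \<in> Mor C W Y" for W Y f
    using that by (simp add: assoc[symmetric] P.fob L0 e e' e'e P.target.comp_ident_left)
  have ee'_cancel: "Comp C W Y (FOb P (L0 Y)) (e Y) (Comp C W (FOb P (L0 Y)) Y (e' Y) f) = f"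
    if "W \<in> Ob C" "Y \<in> Ob C" "f \<in> Mor C W (FOb P (L0 Y))" for W Y f
    using that by (simp add: assoc[symmetric] P.fob L0 e e' ee' P.target.comp_ident_left)
  note facts = P.fob P.fmor L0 e e' e'e ee' e'e_cancel ee'_cancel
    P.target.comp_mor P.target.ident_mor P.target.comp_ident_left P.target.comp_ident_right assoc lift P_lift
    P.source.comp_mor P.source.ident_mor P.fmor_ident P.fmor_comp
  define L where "L = \<lparr>FOb = L0, FMor = (\<lambda>Y Z f. lift (L0 Y) (L0 Z)
    (Comp C (FOb P (L0 Y)) Y (FOb P (L0 Z)) (Comp C Y Z (FOb P (L0 Z)) (e Z) f) (e' Y)))\<rparr>"
  have L: "category_functor C D L"
  proof unfold_locales
    fix X Y f assume "X \<in> Ob C" "Y \<in> Ob C" "f \<in> Mor C X Y"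
    then show "FMor L X Y f \<in> Mor D (FOb L X) (FOb L Y)" by (simp add: L_def facts)
  next
    fix X assume "X \<in> Ob C"
    then show "FMor L X X (Ident C X) = Ident D (FOb L X)"
      by (intro faithful[of "L0 X" "L0 X"]) (simp_all add: L_def facts)
  next
    fix X Y Z f g assume "X \<in> Ob C" "Y \<in> Ob C" "Z \<in> Ob C" "f \<in> Mor C X Y" "g \<in> Mor C Y Z"
    then show "FMor L X Z (Comp C X Y Z g f)
        = Comp D (FOb L X) (FOb L Y) (FOb L Z) (FMor L Y Z g) (FMor L X Y f)"
      by (intro faithful[of "L0 X" "L0 Z"]) (simp_all add: L_def facts)
  qed (simp add: L_def facts)
  then interpret L: category_functor C D L .
  \<comment> \<open>\<open>P\<close> sends this arrow to the inverse \<open>e'\<close> at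
    \<open>P X\<close>, which is what the second triangle identity demands.\<close>
  define \<epsilon> where "\<epsilon> = (\<lambda>X. lift (L0 (FOb P X)) X (e' (FOb P X)))"
  interpret PL: category_functor C C "comp_functor P L" by (rule category_functor_comp[OF L P])
  interpret LP: category_functor D D "comp_functor L P" by (rule category_functor_comp[OF P L])
  interpret IC: category_functor C C id_functor by (rule category_functor_id) unfold_locales
  interpret ID: category_functor D D id_functor by (rule category_functor_id) unfold_locales
  interpret unit: natural_iso C C id_functor "comp_functor P L" e
  proof unfold_locales
    fix X assume "X \<in> Ob C"
    then show "is_iso C (FOb id_functor X) (FOb (comp_functor P L) X) (e X)"
      unfolding is_iso_def
      by (auto simp: id_functor_def comp_functor_def L_def facts intro!: bexI[of _ "e' X"])
  next
    fix X Y f assume "X \<in> Ob C" "Y \<in> Ob C" "f \<in> Mor C X Y"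
    then show "Comp C (FOb id_functor X) (FOb id_functor Y) (FOb (comp_functor P L) Y) (e Y)
          (FMor id_functor X Y f)
        = Comp C (FOb id_functor X) (FOb (comp_functor P L) X) (FOb (comp_functor P L) Y)
          (FMor (comp_functor P L) X Y f) (e X)"
      by (simp add: id_functor_def comp_functor_def L_def facts)
  qed
  interpret counit: natural_iso D D "comp_functor L P" id_functor \<epsilon>
  proof unfold_locales
    fix X assume X: "X \<in> Ob D"
    let ?g = "lift X (L0 (FOb P X)) (e (FOb P X))"
    have "Comp D (L0 (FOb P X)) X (L0 (FOb P X)) ?g (\<epsilon> X) = Ident D (L0 (FOb P X))"
      by (rule faithful[of "L0 (FOb P X)" "L0 (FOb P X)"]) (use X in \<open>simp_all add: \<epsilon>_def facts\<close>)
    moreover have "Comp D X (L0 (FOb P X)) X (\<epsilon> X) ?g = Ident D X"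
      by (rule faithful[of X X]) (use X in \<open>simp_all add: \<epsilon>_def facts\<close>)
    moreover have "?g \<in> Mor D X (L0 (FOb P X))" "\<epsilon> X \<in> Mor D (L0 (FOb P X)) X"
      using X by (simp_all add: \<epsilon>_def facts)
    ultimately show "is_iso D (FOb (comp_functor L P) X) (FOb id_functor X) (\<epsilon> X)"
      unfolding is_iso_def by (auto simp: id_functor_def comp_functor_def L_def)
  next
    fix X Y f assume XY: "X \<in> Ob D" "Y \<in> Ob D" "f \<in> Mor D X Y"
    show "Comp D (FOb (comp_functor L P) X) (FOb (comp_functor L P) Y) (FOb id_functor Y) (\<epsilon> Y)
          (FMor (comp_functor L P) X Y f)
        = Comp D (FOb (comp_functor L P) X) (FOb id_functor X) (FOb id_functor Y)
          (FMor id_functor X Y f) (\<epsilon> X)"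
      by (rule faithful[of "L0 (FOb P X)" Y])
        (simp_all add: id_functor_def comp_functor_def L_def \<epsilon>_def XY facts)
  qed
  have "adjoint_equivalence C D L P e \<epsilon>"
  proof unfold_locales
    fix X assume "X \<in> Ob C"
    then show "Comp D (FOb L X) (FOb L (FOb P (FOb L X))) (FOb L X) (\<epsilon> (FOb L X))
        (FMor L X (FOb P (FOb L X)) (e X)) = Ident D (FOb L X)"
      by (intro faithful[of "L0 X" "L0 X"]) (simp_all add: L_def \<epsilon>_def facts)
  next
    fix Y assume "Y \<in> Ob D"
    then show "Comp C (FOb P Y) (FOb P (FOb L (FOb P Y))) (FOb P Y)
        (FMor P (FOb L (FOb P Y)) Y (\<epsilon> Y)) (e (FOb P Y)) = Ident C (FOb P Y)"
      by (simp add: L_def \<epsilon>_def facts)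
  qed
  then show ?thesis by blast
qed

section \<open>Sums over cosets\<close>

lemma (in group) inv_mult_cancel_left:
  "\<lbrakk>g \<in> carrier G; y \<in> carrier G\<rbrakk> \<Longrightarrow> inv g \<otimes> (g \<otimes> y) = y"
  by (simp add: m_assoc[symmetric])

lemma (in group) mult_inv_cancel_left:
  "\<lbrakk>g \<in> carrier G; y \<in> carrier G\<rbrakk> \<Longrightarrow> g \<otimes> (inv g \<otimes> y) = y"
  by (simp add: m_assoc[symmetric])

lemma (in group) subgroup_conj_subgroup:
  assumes "subgroup H G" "g \<in> carrier G"
  shows "subgroup (conj_subgroup G g H) G"
proof -
  interpret H: subgroup H G by fact
  show ?thesis
  proof (rule subgroupI)
    show "conj_subgroup G g H \<subseteq> carrier G" "conj_subgroup G g H \<noteq> {}"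
      using assms subgroup_nonempty by (auto simp: conj_subgroup_def)
  next
    fix a assume "a \<in> conj_subgroup G g H"
    then obtain h where "h \<in> H" "a = g \<otimes> h \<otimes> inv g" by (auto simp: conj_subgroup_def)
    moreover from this have "inv a = g \<otimes> inv h \<otimes> inv g"
      using assms by (simp add: inv_mult_group m_assoc)
    ultimately show "inv a \<in> conj_subgroup G g H" by (auto simp: conj_subgroup_def)
  next
    fix a b assume "a \<in> conj_subgroup G g H" "b \<in> conj_subgroup G g H"
    then obtain h k where hk: "h \<in> H" "a = g \<otimes> h \<otimes> inv g" "k \<in> H" "b = g \<otimes> k \<otimes> inv g"
      by (auto simp: conj_subgroup_def)
    then have "a \<otimes> b = g \<otimes> (h \<otimes> k) \<otimes> inv g"
      using assms by (simp add: m_assoc inv_mult_cancel_left)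
    with hk show "a \<otimes> b \<in> conj_subgroup G g H" by (auto simp: conj_subgroup_def)
  qed
qed

lemma (in group) mem_conj_subgroup_iff:
  assumes "H \<subseteq> carrier G" "g \<in> carrier G" "x \<in> carrier G"
  shows "x \<in> conj_subgroup G g H \<longleftrightarrow> inv g \<otimes> x \<otimes> g \<in> H"
proof
  assume "x \<in> conj_subgroup G g H"
  then obtain h where "h \<in> H" "x = g \<otimes> h \<otimes> inv g" by (auto simp: conj_subgroup_def)
  moreover from this have "inv g \<otimes> x \<otimes> g = h"
    using assms by (simp add: m_assoc subsetD inv_solve_left')
  ultimately show "inv g \<otimes> x \<otimes> g \<in> H" by simp
next
  assume "inv g \<otimes> x \<otimes> g \<in> H"
  moreover have "x = g \<otimes> (inv g \<otimes> x \<otimes> g) \<otimes> inv g"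
    using assms by (simp add: m_assoc mult_inv_cancel_left)
  ultimately show "x \<in> conj_subgroup G g H" unfolding conj_subgroup_def by blast
qed

lemma (in group) conj_subgroup_trivial: "g \<in> carrier G \<Longrightarrow> conj_subgroup G g {\<one>} = {\<one>}"
  by (simp add: conj_subgroup_def)

lemma (in group) mem_l_coset_self:
  "\<lbrakk>subgroup H G; g \<in> carrier G\<rbrakk> \<Longrightarrow> g \<in> g <# H"
  by (auto simp: l_coset_def intro!: bexI[of _ \<one>] subgroup.one_closed)

lemma (in group) l_coset_eq_iff:
  assumes "subgroup H G" "x \<in> carrier G" "y \<in> carrier G"
  shows "x <# H = y <# H \<longleftrightarrow> inv x \<otimes> y \<in> H"
proof
  assume "x <# H = y <# H"
  then have "y \<in> x <# H" using mem_l_coset_self assms by auto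
  then obtain h where h: "h \<in> H" "y = x \<otimes> h" by (auto simp: l_coset_def)
  then have "inv x \<otimes> y = h"
    using assms subgroup.mem_carrier by (metis inv_solve_left')
  with h show "inv x \<otimes> y \<in> H" by simp
next
  assume "inv x \<otimes> y \<in> H"
  moreover have "y = x \<otimes> (inv x \<otimes> y)" using assms by (simp add: m_assoc[symmetric])
  ultimately have "y \<in> x <# H" unfolding l_coset_def by blast
  with assms show "x <# H = y <# H" by (metis l_repr_independence)
qed

text \<open>Only the addition of \<open>X\<close> enters, so both the ring \<open>R\<close> and an
  arbitrary \<open>R\<close>-module can be substituted for it.\<close>

locale coset_sums = group G + X: abelian_group X
  for G :: "('g, 'a) monoid_scheme" (structure) and X :: "('x, 'b) ring_scheme" +
  assumes finite_carrier: "finite (carrier G)"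
begin

definition invariant :: "'g set \<Rightarrow> ('g \<Rightarrow> 'x) \<Rightarrow> bool" where
  "invariant H \<psi> \<longleftrightarrow> \<psi> \<in> carrier G \<rightarrow> carrier X \<and>
    (\<forall>g\<in>carrier G. \<forall>h\<in>H. \<psi> (g \<otimes> h) = \<psi> g)"

text \<open>The choice of representatives is harmless only for \<open>H\<close>-invariant \<open>\<psi>\<close>.\<close>

definition coset_sum :: "('g \<Rightarrow> 'x) \<Rightarrow> 'g set \<Rightarrow> 'g set \<Rightarrow> 'x" where
  "coset_sum \<psi> S H = (\<Oplus>\<^bsub>X\<^esub> C \<in> left_cosets_in G S H. \<psi> (SOME g. g \<in> C))"

lemma some_l_coset:
  assumes "subgroup H G" "g \<in> carrier G"
  obtains h where "h \<in> H" "(SOME x. x \<in> g <# H) = g \<otimes> h"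
  using someI[of "\<lambda>x. x \<in> g <# H", OF mem_l_coset_self[OF assms]] by (auto simp: l_coset_def)

lemma some_l_coset_carrier:
  assumes "subgroup H G" "g \<in> carrier G"
  shows "(SOME x. x \<in> g <# H) \<in> carrier G"
  using some_l_coset[OF assms] by (metis assms m_closed subgroup.mem_carrier)

lemma some_l_coset_l_coset:
  assumes "subgroup H G" "g \<in> carrier G"
  shows "(SOME x. x \<in> g <# H) <# H = g <# H"
proof -
  have "(SOME x. x \<in> g <# H) \<in> g <# H" by (rule someI) (rule mem_l_coset_self[OF assms])
  then show ?thesis using l_repr_independence assms by blast
qed

lemma invariant_some:
  "\<lbrakk>subgroup H G; invariant H \<psi>; g \<in> carrier G\<rbrakk> \<Longrightarrow> \<psi> (SOME x. x \<in> g <# H) = \<psi> g"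
  by (rule some_l_coset[of H g]) (auto simp: invariant_def)

lemma invariant_closed: "\<lbrakk>invariant H \<psi>; g \<in> carrier G\<rbrakk> \<Longrightarrow> \<psi> g \<in> carrier X"
  by (auto simp: invariant_def)

lemma finite_left_cosets: "S \<subseteq> carrier G \<Longrightarrow> finite (left_cosets_in G S H)"
  using finite_carrier by (auto simp: left_cosets_in_def intro: finite_subset)

lemma coset_summand_closed:
  assumes "subgroup H G" "invariant H \<psi>" "S \<subseteq> carrier G"
  shows "(\<lambda>C. \<psi> (SOME g. g \<in> C)) \<in> left_cosets_in G S H \<rightarrow> carrier X"
  using assms by (auto simp: left_cosets_in_def invariant_some invariant_closed)

lemma coset_sum_closed:
  assumes "subgroup H G" "invariant H \<psi>" "S \<subseteq> carrier G"
  shows "coset_sum \<psi> S H \<in> carrier X"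
  unfolding coset_sum_def by (rule X.finsum_closed) (rule coset_summand_closed[OF assms])

lemma coset_sum_cong:
  assumes "subgroup H G" "invariant H \<psi>" "invariant H \<psi>'" "S \<subseteq> carrier G"
    and "\<And>g. g \<in> S \<Longrightarrow> \<psi> g = \<psi>' g"
  shows "coset_sum \<psi> S H = coset_sum \<psi>' S H"
  unfolding coset_sum_def
  by (rule X.finsum_cong'[OF refl coset_summand_closed])
    (use assms in \<open>auto simp: left_cosets_in_def invariant_some subset_iff\<close>)

text \<open>\<open>p_iff\<close> makes the map induced by \<open>p\<close> on cosets well defined
  and injective, and \<open>p_surj\<close> makes it onto. Translation by an element, conjugation of
  subgroups and the orbit map onto a double coset are all instances.\<close>

lemma coset_sum_reindex:
  assumes H: "subgroup H G" "invariant H \<psi>" "S \<subseteq> carrier G"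
    and H': "subgroup H' G" "invariant H' \<psi>'" "S' \<subseteq> carrier G"
    and p_in: "\<And>x. x \<in> S \<Longrightarrow> p x \<in> S'"
    and p_iff: "\<And>x y. \<lbrakk>x \<in> S; y \<in> S\<rbrakk> \<Longrightarrow> inv x \<otimes> y \<in> H \<longleftrightarrow> inv (p x) \<otimes> p y \<in> H'"
    and p_surj: "\<And>y. y \<in> S' \<Longrightarrow> \<exists>x\<in>S. inv (p x) \<otimes> y \<in> H'"
    and p_eq: "\<And>x. x \<in> S \<Longrightarrow> \<psi>' (p x) = \<psi> x"
  shows "coset_sum \<psi> S H = coset_sum \<psi>' S' H'"
proof -
  \<comment> \<open>\<open>p\<close> is controlled only on \<open>S\<close>, and \<open>S\<close>
    need not be a union of cosets of \<open>H\<close>. Hence the representative is chosen inside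
    \<open>S\<close> and not by the \<open>SOME\<close> of \<open>coset_sum\<close>.\<close>
  define f where "f = (\<lambda>C. p (SOME x. x \<in> S \<and> x <# H = C) <# H')"
  have cosets: "x <# H = y <# H \<longleftrightarrow> p x <# H' = p y <# H'" if "x \<in> S" "y \<in> S" for x y
    using that H H' p_in p_iff by (simp add: l_coset_eq_iff subset_iff)
  have f: "f (x <# H) = p x <# H'" if "x \<in> S" for x
  proof -
    let ?y = "SOME y. y \<in> S \<and> y <# H = x <# H"
    have "?y \<in> S \<and> ?y <# H = x <# H" using that by (rule_tac someI_ex) blast
    then show ?thesis using cosets[of ?y x] that unfolding f_def by simp
  qed
  have inj: "inj_on f (left_cosets_in G S H)"
    using f cosets by (auto simp: left_cosets_in_def inj_on_def)
  have img: "f ` left_cosets_in G S H = left_cosets_in G S' H'"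
  proof
    show "f ` left_cosets_in G S H \<subseteq> left_cosets_in G S' H'"
      using f p_in by (auto simp: left_cosets_in_def)
    show "left_cosets_in G S' H' \<subseteq> f ` left_cosets_in G S H"
    proof
      fix C assume "C \<in> left_cosets_in G S' H'"
      then obtain y where y: "y \<in> S'" "C = y <# H'" by (auto simp: left_cosets_in_def)
      then obtain x where "x \<in> S" "inv (p x) \<otimes> y \<in> H'" using p_surj by blast
      then have "C = f (x <# H)" "x \<in> S"
        using y f l_coset_eq_iff[OF H'(1), of "p x" y] H' p_in by auto
      then show "C \<in> f ` left_cosets_in G S H" by (auto simp: left_cosets_in_def)
    qed
  qed
  have "coset_sum \<psi>' S' H' =
      (\<Oplus>\<^bsub>X\<^esub> C \<in> f ` left_cosets_in G S H. \<psi>' (SOME g. g \<in> C))"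
    by (simp add: coset_sum_def img)
  also have "\<dots> = (\<Oplus>\<^bsub>X\<^esub> C \<in> left_cosets_in G S H. \<psi>' (SOME g. g \<in> f C))"
    by (rule X.finsum_reindex) (use img inj coset_summand_closed[OF H'] in auto)
  also have "\<dots> = coset_sum \<psi> S H"
    unfolding coset_sum_def
    by (rule X.finsum_cong'[OF refl coset_summand_closed[OF H]])
      (use H H' f p_in p_eq in \<open>auto simp: left_cosets_in_def invariant_some subset_iff\<close>)
  finally show ?thesis by simp
qed

lemma invariant_translate:
  "\<lbrakk>H \<subseteq> carrier G; invariant H \<psi>; h \<in> carrier G\<rbrakk> \<Longrightarrow> invariant H (\<lambda>g. \<psi> (h \<otimes> g))"
  by (auto simp: invariant_def m_assoc[symmetric] subset_iff)

text \<open>Moving the shift from the summand to the index set displays the value of a transfer at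
  \<open>h\<close> as a sum over the cosets of \<open>H\<close> lying in \<open>hK\<close>.\<close>

lemma coset_sum_translate:
  assumes H: "subgroup H G" "invariant H \<psi>" and "S \<subseteq> carrier G" "h \<in> carrier G"
  shows "coset_sum (\<lambda>g. \<psi> (h \<otimes> g)) S H = coset_sum \<psi> (h <# S) H"
proof (rule coset_sum_reindex[where p = "\<lambda>g. h \<otimes> g"])
  show "invariant H (\<lambda>g. \<psi> (h \<otimes> g))"
    using assms by (simp add: invariant_translate subgroup.subset)
  have cancel: "inv (h \<otimes> x) \<otimes> (h \<otimes> y) = inv x \<otimes> y" if "x \<in> carrier G" "y \<in> carrier G" for x y
    using that assms by (simp add: inv_mult_group m_assoc inv_mult_cancel_left)
  show "inv x \<otimes> y \<in> H \<longleftrightarrow> inv (h \<otimes> x) \<otimes> (h \<otimes> y) \<in> H" if "x \<in> S" "y \<in> S" for x y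
    using that assms(3) by (simp add: cancel subset_iff)
  show "\<exists>x\<in>S. inv (h \<otimes> x) \<otimes> y \<in> H" if "y \<in> h <# S" for y
  proof -
    from that obtain x where "x \<in> S" "y = h \<otimes> x" by (auto simp: l_coset_def)
    with assms cancel show ?thesis by (auto intro!: bexI[of _ x] simp: subgroup.one_closed subset_iff)
  qed
qed (use assms in \<open>auto simp: l_coset_def\<close>)

text \<open>\<open>stable\<close> forces a coset of \<open>H\<close> that meets a block to lie
  inside it, so disjoint blocks have disjoint sets of cosets. The blocks will be left cosets for the
  transitivity of transfers and double cosets for the double coset formula.\<close>

lemma coset_sum_partition:
  assumes H: "subgroup H G" "invariant H \<psi>" and fin: "finite \<D>"
    and sub: "\<And>D. D \<in> \<D> \<Longrightarrow> D \<subseteq> carrier G"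
    and disj: "\<And>D D'. \<lbrakk>D \<in> \<D>; D' \<in> \<D>; D \<inter> D' \<noteq> {}\<rbrakk> \<Longrightarrow> D = D'"
    and stable: "\<And>D d h. \<lbrakk>D \<in> \<D>; d \<in> D; h \<in> H\<rbrakk> \<Longrightarrow> d \<otimes> h \<in> D"
  shows "coset_sum \<psi> (\<Union>\<D>) H = (\<Oplus>\<^bsub>X\<^esub> D \<in> \<D>. coset_sum \<psi> D H)"
proof -
  have "left_cosets_in G (\<Union>\<D>) H = (\<Union>D\<in>\<D>. left_cosets_in G D H)"
    by (auto simp: left_cosets_in_def)
  moreover have "(\<Oplus>\<^bsub>X\<^esub> C \<in> (\<Union>D\<in>\<D>. left_cosets_in G D H). \<psi> (SOME g. g \<in> C)) =
      (\<Oplus>\<^bsub>X\<^esub> D \<in> \<D>. \<Oplus>\<^bsub>X\<^esub> C \<in> left_cosets_in G D H. \<psi> (SOME g. g \<in> C))"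
  proof (rule X.add.finprod_UN_disjoint[OF fin])
    show "finite (left_cosets_in G D H)" if "D \<in> \<D>" for D
      using that sub by (simp add: finite_left_cosets)
    show "\<psi> (SOME g. g \<in> C) \<in> carrier X" if "D \<in> \<D>" "C \<in> left_cosets_in G D H" for D C
      using coset_summand_closed[OF H sub[OF that(1)]] that by auto
    have in_D: "C \<subseteq> D \<and> C \<noteq> {}" if "D \<in> \<D>" "C \<in> left_cosets_in G D H" for D C
      using that stable H mem_l_coset_self sub
      by (fastforce simp: left_cosets_in_def l_coset_def dest: subgroup.one_closed)
    show "pairwise (\<lambda>D D'. disjnt (left_cosets_in G D H) (left_cosets_in G D' H)) \<D>"
      unfolding pairwise_def disjnt_iff using in_D disj by blast
  qed
  ultimately show ?thesis by (simp add: coset_sum_def)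
qed

end

section \<open>Coinduction is a Mackey functor\<close>

lemma (in group) mem_double_coset_self:
  assumes "subgroup J G" "subgroup K G" "g \<in> carrier G"
  shows "g \<in> J <#> (g <# K)"
proof -
  have "\<one> \<otimes> g \<in> J <#> (g <# K)"
    using mem_l_coset_self[OF assms(2,3)] subgroup.one_closed[OF assms(1)]
    unfolding set_mult_def by blast
  then show ?thesis using assms by simp
qed

lemma (in group) double_coset_eq:
  assumes J: "subgroup J G" and K: "subgroup K G" and g: "g \<in> carrier G"
    and x: "x \<in> J <#> (g <# K)"
  shows "J <#> (x <# K) = J <#> (g <# K)"
proof -
  interpret J: subgroup J G by fact
  interpret K: subgroup K G by fact
  obtain j k where jk: "j \<in> J" "k \<in> K" "x = j \<otimes> (g \<otimes> k)"
    using x by (auto simp: set_mult_def l_coset_def)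
  show ?thesis
  proof
    show "J <#> (x <# K) \<subseteq> J <#> (g <# K)"
    proof
      fix y assume "y \<in> J <#> (x <# K)"
      then obtain j' k' where "j' \<in> J" "k' \<in> K" "y = j' \<otimes> (x \<otimes> k')"
        by (auto simp: set_mult_def l_coset_def)
      then have "y = (j' \<otimes> j) \<otimes> (g \<otimes> (k \<otimes> k'))" "j' \<otimes> j \<in> J" "k \<otimes> k' \<in> K"
        using jk g by (auto simp: m_assoc)
      then show "y \<in> J <#> (g <# K)" unfolding set_mult_def l_coset_def by blast
    qed
    show "J <#> (g <# K) \<subseteq> J <#> (x <# K)"
    proof
      fix y assume "y \<in> J <#> (g <# K)"
      then obtain j' k' where j'k': "j' \<in> J" "k' \<in> K" "y = j' \<otimes> (g \<otimes> k')"
        by (auto simp: set_mult_def l_coset_def)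
      have "(j' \<otimes> inv j) \<otimes> (x \<otimes> (inv k \<otimes> k')) = j' \<otimes> ((inv j \<otimes> j) \<otimes> (g \<otimes> ((k \<otimes> inv k) \<otimes> k')))"
        using jk j'k' g by (simp only: m_assoc m_closed J.mem_carrier K.mem_carrier inv_closed)
      also have "\<dots> = y" using jk j'k' g by simp
      finally have "y = (j' \<otimes> inv j) \<otimes> (x \<otimes> (inv k \<otimes> k'))" by simp
      moreover have "j' \<otimes> inv j \<in> J" "inv k \<otimes> k' \<in> K" using jk j'k' by simp_all
      ultimately show "y \<in> J <#> (x <# K)" unfolding set_mult_def l_coset_def by blast
    qed
  qed
qed

lemma (in group) fun_act_act:
  "\<lbrakk>g \<in> carrier G; g' \<in> carrier G\<rbrakk> \<Longrightarrow> fun_act G g (fun_act G g' \<phi>) = fun_act G (g \<otimes> g') \<phi>"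
  by (auto simp: fun_act_def m_assoc)

section \<open>Fixed functions with pointwise operations\<close>

context coset_sums
begin

text \<open>An element \<open>h\<close> acts by right translation of the argument, so being fixed by
  \<open>H\<close> means being constant on the left cosets \<open>gH\<close>.\<close>

lemma fun_fixed_iff:
  assumes "H \<subseteq> carrier G"
  shows "\<phi> \<in> fun_fixed G X H \<longleftrightarrow> \<phi> \<in> extensional (carrier G) \<and> invariant H \<phi>"
proof
  assume "\<phi> \<in> fun_fixed G X H"
  then have \<phi>: "\<phi> \<in> carrier G \<rightarrow>\<^sub>E carrier X" and "\<And>h. h \<in> H \<Longrightarrow> fun_act G h \<phi> = \<phi>"
    by (auto simp: fun_fixed_def)
  then have "\<phi> (g \<otimes> h) = \<phi> g" if "g \<in> carrier G" "h \<in> H" for g h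
    using that by (metis fun_act_def restrict_apply')
  with \<phi> show "\<phi> \<in> extensional (carrier G) \<and> invariant H \<phi>"
    by (auto simp: invariant_def PiE_def)
next
  assume "\<phi> \<in> extensional (carrier G) \<and> invariant H \<phi>"
  then show "\<phi> \<in> fun_fixed G X H"
    by (auto simp: fun_fixed_def invariant_def PiE_def fun_act_def extensional_def)
qed

lemma fun_fixed_invariant:
  "\<lbrakk>subgroup H G; \<phi> \<in> fun_fixed G X H\<rbrakk> \<Longrightarrow> invariant H \<phi>"
  by (simp add: fun_fixed_iff subgroup.subset)

lemma fun_fixed_closed:
  "\<lbrakk>\<phi> \<in> fun_fixed G X H; g \<in> carrier G\<rbrakk> \<Longrightarrow> \<phi> g \<in> carrier X"
  by (auto simp: fun_fixed_def)

lemma fun_fixed_restrictI: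
  "\<lbrakk>H \<subseteq> carrier G; invariant H \<phi>\<rbrakk> \<Longrightarrow> restrict \<phi> (carrier G) \<in> fun_fixed G X H"
  by (auto simp: fun_fixed_iff invariant_def subset_iff)

lemma fun_fixed_eqI:
  assumes "\<phi> \<in> fun_fixed G X H" "\<psi> \<in> fun_fixed G X H'"
    and "\<And>g. g \<in> carrier G \<Longrightarrow> \<phi> g = \<psi> g"
  shows "\<phi> = \<psi>"
  using assms by (intro PiE_ext[of _ "carrier G" "\<lambda>_. carrier X"]) (auto simp: fun_fixed_def)

lemma fun_fixed_mono: "H \<subseteq> K \<Longrightarrow> fun_fixed G X K \<subseteq> fun_fixed G X H"
  by (auto simp: fun_fixed_def)

lemma fun_act_closed:
  assumes "subgroup H G" "g \<in> carrier G" "\<phi> \<in> fun_fixed G X H"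
  shows "fun_act G g \<phi> \<in> fun_fixed G X (conj_subgroup G g H)"
  unfolding fun_act_def
proof (rule fun_fixed_restrictI)
  show "conj_subgroup G g H \<subseteq> carrier G"
    using subgroup_conj_subgroup[OF assms(1,2)] by (rule subgroup.subset)
  have sub: "H \<subseteq> carrier G" using assms by (simp add: subgroup.subset)
  have inv: "invariant H \<phi>" using assms by (simp add: fun_fixed_invariant)
  have "\<phi> (x \<otimes> (g \<otimes> h \<otimes> inv g) \<otimes> g) = \<phi> (x \<otimes> g)" if "x \<in> carrier G" "h \<in> H" for x h
  proof -
    have "x \<otimes> (g \<otimes> h \<otimes> inv g) \<otimes> g = (x \<otimes> g) \<otimes> h"
      using that assms sub by (auto simp: m_assoc)
    then show ?thesis using inv that assms by (auto simp: invariant_def)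
  qed
  then show "invariant (conj_subgroup G g H) (\<lambda>x. \<phi> (x \<otimes> g))"
    using assms by (auto simp: invariant_def conj_subgroup_def fun_fixed_closed)
qed

text \<open>The levels of the coinduced ring and of a coinduced module are records of different types;
  their additive structure is treated uniformly through the following predicate.\<close>

definition pointwise :: "'g set \<Rightarrow> ('g \<Rightarrow> 'x, 'c) ring_scheme \<Rightarrow> bool" where
  "pointwise H L \<longleftrightarrow> carrier L = fun_fixed G X H \<and>
    zero L = zero (fun_ring G X) \<and> add L = add (fun_ring G X)"

lemma pointwise_add:
  "\<lbrakk>pointwise H L; g \<in> carrier G\<rbrakk> \<Longrightarrow> (\<phi> \<oplus>\<^bsub>L\<^esub> \<psi>) g = \<phi> g \<oplus>\<^bsub>X\<^esub> \<psi> g"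
  by (simp add: pointwise_def fun_ring_def)

lemma pointwise_zero: "\<lbrakk>pointwise H L; g \<in> carrier G\<rbrakk> \<Longrightarrow> \<zero>\<^bsub>L\<^esub> g = \<zero>\<^bsub>X\<^esub>"
  by (simp add: pointwise_def fun_ring_def)

lemma pointwise_carrier: "pointwise H L \<Longrightarrow> carrier L = fun_fixed G X H"
  by (simp add: pointwise_def)

lemma pointwise_abelian_group:
  assumes H: "H \<subseteq> carrier G" and L: "pointwise H L"
  shows "abelian_group L"
proof (rule abelian_groupI)
  have closed: "(\<lambda>g\<in>carrier G. \<alpha> g) \<in> carrier L"
    if "\<And>g. g \<in> carrier G \<Longrightarrow> \<alpha> g \<in> carrier X"
      "\<And>g h. \<lbrakk>g \<in> carrier G; h \<in> H\<rbrakk> \<Longrightarrow> \<alpha> (g \<otimes> h) = \<alpha> g" for \<alpha>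
    using L H that by (auto simp: pointwise_def invariant_def intro!: fun_fixed_restrictI)
  have inv: "\<phi> (g \<otimes> h) = \<phi> g" if "\<phi> \<in> carrier L" "g \<in> carrier G" "h \<in> H" for \<phi> g h
    using that L H by (simp add: pointwise_def fun_fixed_iff invariant_def)
  have val: "\<phi> g \<in> carrier X" if "\<phi> \<in> carrier L" "g \<in> carrier G" for \<phi> g
    using that L by (simp add: pointwise_def fun_fixed_closed)
  have eqI: "\<phi> = \<psi>" if "\<phi> \<in> carrier L" "\<psi> \<in> carrier L" "\<And>g. g \<in> carrier G \<Longrightarrow> \<phi> g = \<psi> g" for \<phi> \<psi>
    using that L by (auto simp: pointwise_def intro: fun_fixed_eqI)
  show zero: "\<zero>\<^bsub>L\<^esub> \<in> carrier L"
    using closed[of "\<lambda>_. \<zero>\<^bsub>X\<^esub>"] L by (simp add: pointwise_def fun_ring_def)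
  show add: "\<phi> \<oplus>\<^bsub>L\<^esub> \<psi> \<in> carrier L" if "\<phi> \<in> carrier L" "\<psi> \<in> carrier L" for \<phi> \<psi>
  proof -
    have "(\<lambda>g\<in>carrier G. \<phi> g \<oplus>\<^bsub>X\<^esub> \<psi> g) \<in> carrier L"
      by (rule closed) (simp_all add: that val inv)
    then show ?thesis using L by (simp add: pointwise_def fun_ring_def)
  qed
  note pw = pointwise_add[OF L] pointwise_zero[OF L]
  show "\<phi> \<oplus>\<^bsub>L\<^esub> \<psi> \<oplus>\<^bsub>L\<^esub> \<chi> = \<phi> \<oplus>\<^bsub>L\<^esub> (\<psi> \<oplus>\<^bsub>L\<^esub> \<chi>)"
    if "\<phi> \<in> carrier L" "\<psi> \<in> carrier L" "\<chi> \<in> carrier L" for \<phi> \<psi> \<chi>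
    by (rule eqI) (use that val in \<open>auto simp: pw add X.a_assoc\<close>)
  show "\<phi> \<oplus>\<^bsub>L\<^esub> \<psi> = \<psi> \<oplus>\<^bsub>L\<^esub> \<phi>" if "\<phi> \<in> carrier L" "\<psi> \<in> carrier L" for \<phi> \<psi>
    by (rule eqI) (use that val in \<open>auto simp: pw add X.a_comm\<close>)
  show "\<zero>\<^bsub>L\<^esub> \<oplus>\<^bsub>L\<^esub> \<phi> = \<phi>" if "\<phi> \<in> carrier L" for \<phi>
    by (rule eqI) (use that val in \<open>auto simp: pw add zero\<close>)
  show "\<exists>\<psi>\<in>carrier L. \<psi> \<oplus>\<^bsub>L\<^esub> \<phi> = \<zero>\<^bsub>L\<^esub>" if "\<phi> \<in> carrier L" for \<phi>
  proof
    show "(\<lambda>g\<in>carrier G. \<ominus>\<^bsub>X\<^esub> \<phi> g) \<in> carrier L" 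
      by (rule closed) (simp_all add: val[OF that] inv[OF that])
    then show "(\<lambda>g\<in>carrier G. \<ominus>\<^bsub>X\<^esub> \<phi> g) \<oplus>\<^bsub>L\<^esub> \<phi> = \<zero>\<^bsub>L\<^esub>"
      by (intro eqI) (use that val in \<open>auto simp: pw add zero X.l_neg\<close>)
  qed
qed

lemma pointwise_finsum:
  assumes "H \<subseteq> carrier G" "pointwise H L" "finite A" "f \<in> A \<rightarrow> carrier L" "g \<in> carrier G"
  shows "(\<Oplus>\<^bsub>L\<^esub> a \<in> A. f a) g = (\<Oplus>\<^bsub>X\<^esub> a \<in> A. f a g)"
proof -
  interpret L: abelian_group L by (rule pointwise_abelian_group[OF assms(1,2)])
  have val: "\<phi> g \<in> carrier X" if "\<phi> \<in> carrier L" for \<phi>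
    using that assms by (simp add: pointwise_def fun_fixed_closed)
  show ?thesis using assms(3,4)
  proof (induction A)
    case empty
    then show ?case using assms by (simp add: pointwise_zero)
  next
    case (insert a A)
    then have "(\<Oplus>\<^bsub>L\<^esub> a \<in> insert a A. f a) = f a \<oplus>\<^bsub>L\<^esub> (\<Oplus>\<^bsub>L\<^esub> a \<in> A. f a)" by (simp add: Pi_iff)
    then show ?case using insert assms val by (simp add: pointwise_add Pi_iff)
  qed
qed

text \<open>The empty set imposes no condition, so all of \<open>Fun(G, X)\<close> is covered by the
  pointwise lemmas. This is needed because the summands of a transfer are in general fixed neither
  by \<open>H\<close> nor by \<open>K\<close>, so that \<open>fun_transf\<close> is a sum in
  \<open>fun_ring\<close>. It is also why \<open>pointwise_abelian_group\<close> asks only for a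
  subset of \<open>G\<close>.\<close>

lemma pointwise_fun_ring: "pointwise {} (fun_ring G X)"
  by (simp add: pointwise_def fun_ring_def fun_fixed_def)

section \<open>Transfers as sums over cosets\<close>

lemma
  assumes "subgroup H G" "K \<subseteq> carrier G" "\<phi> \<in> fun_fixed G X H"
  shows fun_transf_in_PiE: "fun_transf G X H K \<phi> \<in> carrier G \<rightarrow>\<^sub>E carrier X"
    and fun_transf_apply: "h \<in> carrier G \<Longrightarrow> fun_transf G X H K \<phi> h = coset_sum (\<lambda>g. \<phi> (h \<otimes> g)) K H"
proof -
  interpret F: abelian_group "fun_ring G X"
    by (rule pointwise_abelian_group[OF _ pointwise_fun_ring]) simp
  have carrier: "carrier (fun_ring G X) = carrier G \<rightarrow>\<^sub>E carrier X" by (simp add: fun_ring_def)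
  have f: "(\<lambda>C. fun_act G (SOME k. k \<in> C) \<phi>) \<in> left_cosets_in G K H \<rightarrow> carrier (fun_ring G X)"
    unfolding carrier using assms
    by (auto simp: fun_act_def fun_fixed_closed some_l_coset_carrier left_cosets_in_def subset_iff)
  show "fun_transf G X H K \<phi> \<in> carrier G \<rightarrow>\<^sub>E carrier X"
    using F.finsum_closed[OF f] by (simp add: fun_transf_def carrier)
  assume h: "h \<in> carrier G"
  show "fun_transf G X H K \<phi> h = coset_sum (\<lambda>g. \<phi> (h \<otimes> g)) K H"
    unfolding fun_transf_def coset_sum_def using assms h f
    by (simp add: pointwise_finsum[OF _ pointwise_fun_ring] finite_left_cosets)
      (simp add: fun_act_def)
qed

lemma fun_transf_apply_l_coset:
  assumes "subgroup H G" "K \<subseteq> carrier G" "\<phi> \<in> fun_fixed G X H" "h \<in> carrier G"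
  shows "fun_transf G X H K \<phi> h = coset_sum \<phi> (h <# K) H"
  using assms by (simp add: fun_transf_apply coset_sum_translate fun_fixed_invariant)

text \<open>The value at \<open>h\<close> is the sum of \<open>\<phi>\<close> over the cosets of
  \<open>H\<close> in \<open>hK\<close>, and \<open>hK\<close> does not change when \<open>h\<close>
  is replaced by \<open>hk\<close> with \<open>k\<close> in \<open>K\<close>.\<close>

lemma fun_transf_closed:
  assumes "subgroup H G" "subgroup K G" "\<phi> \<in> fun_fixed G X H"
  shows "fun_transf G X H K \<phi> \<in> fun_fixed G X K"
proof -
  have K: "K \<subseteq> carrier G" using assms by (simp add: subgroup.subset)
  have "g \<otimes> k <# K = g <# K" if "g \<in> carrier G" "k \<in> K" for g k
    using that assms K by (simp add: lcos_m_assoc[symmetric] coset_join3 subset_iff)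
  then show ?thesis
    unfolding fun_fixed_iff[OF K] invariant_def
    using fun_transf_in_PiE[OF assms(1) K assms(3)] assms K
    by (auto simp: fun_transf_apply_l_coset PiE_def K[THEN subsetD])
qed

text \<open>\<open>K\<close> is the disjoint union of the cosets \<open>zH\<close>, so the cosets of
  \<open>J\<close> in \<open>K\<close> can be summed block by block.\<close>

lemma fun_transf_transf:
  assumes "subgroup J G" "subgroup H G" "subgroup K G" "J \<subseteq> H" "H \<subseteq> K"
    and x: "x \<in> fun_fixed G X J"
  shows "fun_transf G X H K (fun_transf G X J H x) = fun_transf G X J K x"
proof (rule fun_fixed_eqI)
  have sub: "J \<subseteq> carrier G" "H \<subseteq> carrier G" "K \<subseteq> carrier G"
    using assms by (simp_all add: subgroup.subset)
  have JH: "fun_transf G X J H x \<in> fun_fixed G X H" using assms by (simp add: fun_transf_closed)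
  then show "fun_transf G X H K (fun_transf G X J H x) \<in> fun_fixed G X K"
    using assms by (simp add: fun_transf_closed)
  show "fun_transf G X J K x \<in> fun_fixed G X K" using assms by (simp add: fun_transf_closed)
  fix h assume h: "h \<in> carrier G"
  define \<psi> where "\<psi> = (\<lambda>y. x (h \<otimes> y))"
  have \<psi>: "invariant J \<psi>"
    unfolding \<psi>_def using assms sub h by (simp add: invariant_translate fun_fixed_invariant)
  have in_T: "(\<lambda>C. coset_sum \<psi> C J) \<in> left_cosets_in G K H \<rightarrow> carrier X"
    using coset_sum_closed[OF assms(1) \<psi> l_coset_subset_G[OF sub(2)]] sub
    by (auto simp: left_cosets_in_def)
  \<comment> \<open>The inner transfer evaluated at \<open>h z\<close> is the contribution of the
    block \<open>zH\<close>.\<close>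
  have "fun_transf G X J H x (h \<otimes> z) = coset_sum \<psi> (z <# H) J" if "z \<in> carrier G" for z
  proof -
    have "fun_transf G X J H x (h \<otimes> z) = coset_sum (\<lambda>y. \<psi> (z \<otimes> y)) H J"
      unfolding fun_transf_apply[OF assms(1) sub(2) x m_closed[OF h that]]
    proof (rule coset_sum_cong)
      show "invariant J (\<lambda>g. x (h \<otimes> z \<otimes> g))" "invariant J (\<lambda>y. \<psi> (z \<otimes> y))"
        using assms sub h that \<psi> by (simp_all add: invariant_translate fun_fixed_invariant)
    qed (use assms sub h that in \<open>auto simp: \<psi>_def m_assoc\<close>)
    also have "\<dots> = coset_sum \<psi> (z <# H) J"
      using assms \<psi> sub that by (simp add: coset_sum_translate)
    finally show ?thesis .
  qed
  then have "fun_transf G X J H x (h \<otimes> (SOME z. z \<in> C)) = coset_sum \<psi> C J"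
    if "C \<in> left_cosets_in G K H" for C
    using that assms sub
    by (auto simp: left_cosets_in_def some_l_coset_carrier some_l_coset_l_coset subset_iff)
  then have "fun_transf G X H K (fun_transf G X J H x) h =
      (\<Oplus>\<^bsub>X\<^esub> C \<in> left_cosets_in G K H. coset_sum \<psi> C J)"
    using fun_transf_apply[OF assms(2) sub(3) JH h] in_T
    by (simp add: coset_sum_def[of _ K H] cong: X.finsum_cong')
  also have "\<dots> = coset_sum \<psi> (\<Union> (left_cosets_in G K H)) J"
  proof (rule coset_sum_partition[symmetric, OF assms(1) \<psi> finite_left_cosets[OF sub(3)]])
    fix D assume "D \<in> left_cosets_in G K H"
    then obtain k where k: "k \<in> K" "D = k <# H" by (auto simp: left_cosets_in_def)
    then show "D \<subseteq> carrier G" using sub l_coset_subset_G[OF sub(2), of k] by blast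
    show "d \<otimes> j \<in> D" if "d \<in> D" "j \<in> J" for d j
    proof -
      from that k obtain i where "i \<in> H" "d = k \<otimes> i" by (auto simp: l_coset_def)
      moreover from this have "d \<otimes> j = k \<otimes> (i \<otimes> j)" "i \<otimes> j \<in> H"
        using that k sub assms by (auto simp: m_assoc subset_iff subgroup.m_closed)
      ultimately show ?thesis using k by (auto simp: l_coset_def)
    qed
    fix D' assume "D' \<in> left_cosets_in G K H" and ne: "D \<inter> D' \<noteq> {}"
    then obtain k' where k': "k' \<in> K" "D' = k' <# H" by (auto simp: left_cosets_in_def)
    from ne obtain y where "y \<in> D" "y \<in> D'" by blast
    with k k' show "D = D'"
      using l_repr_independence[of y k H] l_repr_independence[of y k' H] assms sub by blast
  qed
  also have "\<Union> (left_cosets_in G K H) = K"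
  proof
    show "\<Union> (left_cosets_in G K H) \<subseteq> K"
      using assms by (auto simp: left_cosets_in_def l_coset_def subgroup.m_closed subset_iff)
    show "K \<subseteq> \<Union> (left_cosets_in G K H)"
      using mem_l_coset_self[OF assms(2)] sub unfolding left_cosets_in_def by blast
  qed
  also have "coset_sum \<psi> K J = fun_transf G X J K x h"
    using assms sub h by (simp add: fun_transf_apply \<psi>_def)
  finally show "fun_transf G X H K (fun_transf G X J H x) h = fun_transf G X J K x h" .
qed

text \<open>Conjugation by \<open>g\<close> induces a bijection from the cosets of \<open>H\<close>
  in \<open>K\<close> to the cosets of the conjugate of \<open>H\<close> in the conjugate of
  \<open>K\<close>. It matches the summands, because the value of \<open>fun_act G g x\<close> at
  \<open>h g y inv g\<close> is that of \<open>x\<close> at \<open>h g y\<close>.\<close>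

lemma fun_act_transf:
  assumes H: "subgroup H G" and K: "subgroup K G" and HK: "H \<subseteq> K" and g: "g \<in> carrier G"
    and x: "x \<in> fun_fixed G X H"
  shows "fun_act G g (fun_transf G X H K x) =
    fun_transf G X (conj_subgroup G g H) (conj_subgroup G g K) (fun_act G g x)"
proof (rule fun_fixed_eqI)
  note conj = subgroup_conj_subgroup[OF _ g]
  have sub: "H \<subseteq> carrier G" "K \<subseteq> carrier G" "conj_subgroup G g K \<subseteq> carrier G"
    "conj_subgroup G g H \<subseteq> carrier G"
    using H K conj by (simp_all add: subgroup.subset)
  show "fun_act G g (fun_transf G X H K x) \<in> fun_fixed G X (conj_subgroup G g K)"
    using assms by (simp add: fun_act_closed fun_transf_closed)
  have gx: "fun_act G g x \<in> fun_fixed G X (conj_subgroup G g H)"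
    using assms by (simp add: fun_act_closed)
  then show "fun_transf G X (conj_subgroup G g H) (conj_subgroup G g K) (fun_act G g x)
      \<in> fun_fixed G X (conj_subgroup G g K)"
    using assms conj by (simp add: fun_transf_closed)
  fix h assume h: "h \<in> carrier G"
  have "fun_act G g (fun_transf G X H K x) h = coset_sum (\<lambda>y. x (h \<otimes> g \<otimes> y)) K H"
    using assms h sub by (simp add: fun_act_def fun_transf_apply)
  also have "\<dots> = coset_sum (\<lambda>y. fun_act G g x (h \<otimes> y)) (conj_subgroup G g K) (conj_subgroup G g H)"
  proof (rule coset_sum_reindex[where p = "\<lambda>y. g \<otimes> y \<otimes> inv g"])
    show "invariant H (\<lambda>y. x (h \<otimes> g \<otimes> y))"
      "invariant (conj_subgroup G g H) (\<lambda>y. fun_act G g x (h \<otimes> y))"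
      using assms h g gx sub conj by (simp_all add: invariant_translate fun_fixed_invariant)
    have conj_mult: "inv (g \<otimes> y \<otimes> inv g) \<otimes> (g \<otimes> z \<otimes> inv g) = g \<otimes> (inv y \<otimes> z) \<otimes> inv g"
      if "y \<in> carrier G" "z \<in> carrier G" for y z
      using g that by (simp add: inv_mult_group m_assoc inv_mult_cancel_left)
    have conj_iff: "g \<otimes> y \<otimes> inv g \<in> conj_subgroup G g H \<longleftrightarrow> y \<in> H" if "y \<in> carrier G" for y
      using g that sub by (simp add: mem_conj_subgroup_iff m_assoc inv_mult_cancel_left)
    show "inv y \<otimes> z \<in> H \<longleftrightarrow> inv (g \<otimes> y \<otimes> inv g) \<otimes> (g \<otimes> z \<otimes> inv g) \<in> conj_subgroup G g H"
      if "y \<in> K" "z \<in> K" for y z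
      using that sub by (simp add: conj_mult conj_iff subset_iff)
    show "\<exists>z\<in>K. inv (g \<otimes> z \<otimes> inv g) \<otimes> y \<in> conj_subgroup G g H"
      if "y \<in> conj_subgroup G g K" for y
    proof -
      from that obtain z where "z \<in> K" "y = g \<otimes> z \<otimes> inv g" by (auto simp: conj_subgroup_def)
      with g sub conj[OF H] show ?thesis
        by (auto intro!: bexI[of _ z] simp: subgroup.one_closed subset_iff)
    qed
    show "fun_act G g x (h \<otimes> (g \<otimes> y \<otimes> inv g)) = x (h \<otimes> g \<otimes> y)" if "y \<in> K" for y
      using that g h sub by (simp add: fun_act_def m_assoc subset_iff)
  qed (use assms conj sub in \<open>auto simp: conj_subgroup_def\<close>)
  also have "\<dots> = fun_transf G X (conj_subgroup G g H) (conj_subgroup G g K) (fun_act G g x) h"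
    using gx h sub conj[OF H] by (simp add: fun_transf_apply)
  finally show "fun_act G g (fun_transf G X H K x) h =
    fun_transf G X (conj_subgroup G g H) (conj_subgroup G g K) (fun_act G g x) h" .
qed

lemma fun_transf_self:
  assumes H: "subgroup H G" and x: "x \<in> fun_fixed G X H"
  shows "fun_transf G X H H x = x"
proof (rule fun_fixed_eqI)
  show "fun_transf G X H H x \<in> fun_fixed G X H" using assms by (simp add: fun_transf_closed)
  show "x \<in> fun_fixed G X H" by fact
  fix h assume h: "h \<in> carrier G"
  have "k <# H = \<one> <# H" if "k \<in> H" for k
    using that H by (simp add: coset_join3 subgroup.mem_carrier subgroup.one_closed)
  then have "left_cosets_in G H H = {\<one> <# H}"
    using H by (auto simp: left_cosets_in_def image_iff intro!: bexI[of _ \<one>] subgroup.one_closed)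
  moreover have "invariant H (\<lambda>y. x (h \<otimes> y))"
    using assms h by (simp add: invariant_translate fun_fixed_invariant subgroup.subset)
  ultimately show "fun_transf G X H H x h = x h"
    using assms h invariant_some[OF H, of "\<lambda>y. x (h \<otimes> y)" \<one>]
    by (simp add: fun_transf_apply subgroup.subset coset_sum_def fun_fixed_closed)
qed

text \<open>An orbit-stabilizer argument: \<open>J\<close> acts transitively on the cosets of
  \<open>K\<close> in \<open>JgK\<close>, and the stabilizer of \<open>gK\<close> is the
  intersection of \<open>J\<close> with the conjugate of \<open>K\<close> by
  \<open>g\<close>.\<close>

lemma double_coset_summand:
  assumes J: "subgroup J G" and K: "subgroup K G" and g: "g \<in> carrier G"
    and x: "x \<in> fun_fixed G X K" and h: "h \<in> carrier G"
  shows "fun_transf G X (J \<inter> conj_subgroup G g K) J (fun_act G g x) h =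
    coset_sum (\<lambda>y. x (h \<otimes> y)) (J <#> (g <# K)) K"
proof -
  have sub: "J \<subseteq> carrier G" "K \<subseteq> carrier G" using J K by (simp_all add: subgroup.subset)
  have I: "subgroup (J \<inter> conj_subgroup G g K) G"
    using J K g by (simp add: subgroups_Inter_pair subgroup_conj_subgroup)
  have gx: "fun_act G g x \<in> fun_fixed G X (J \<inter> conj_subgroup G g K)"
    using fun_act_closed[OF K g x] fun_fixed_mono[OF Int_lower2] by blast
  have "coset_sum (\<lambda>y. fun_act G g x (h \<otimes> y)) J (J \<inter> conj_subgroup G g K) =
      coset_sum (\<lambda>y. x (h \<otimes> y)) (J <#> (g <# K)) K"
  proof (rule coset_sum_reindex[where p = "\<lambda>y. y \<otimes> g"])
    show "invariant (J \<inter> conj_subgroup G g K) (\<lambda>y. fun_act G g x (h \<otimes> y))"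
      by (rule invariant_translate) (use I gx h in \<open>auto simp: fun_fixed_invariant subgroup.subset\<close>)
    show "invariant K (\<lambda>y. x (h \<otimes> y))"
      using assms sub by (simp add: invariant_translate fun_fixed_invariant)
    show "J <#> (g <# K) \<subseteq> carrier G" using sub g by (auto simp: set_mult_def l_coset_def)
    show "y \<otimes> g \<in> J <#> (g <# K)" if "y \<in> J" for y
      using that mem_l_coset_self[OF K g] by (auto simp: set_mult_def)
    show "inv y \<otimes> z \<in> J \<inter> conj_subgroup G g K \<longleftrightarrow> inv (y \<otimes> g) \<otimes> (z \<otimes> g) \<in> K"
      if "y \<in> J" "z \<in> J" for y z
      using that sub g J
      by (simp add: mem_conj_subgroup_iff subgroup.m_closed subgroup.m_inv_closed
          subgroup.mem_carrier inv_mult_group m_assoc)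
    show "\<exists>z\<in>J. inv (z \<otimes> g) \<otimes> y \<in> K" if "y \<in> J <#> (g <# K)" for y
    proof -
      from that obtain j k where jk: "j \<in> J" "k \<in> K" "y = j \<otimes> (g \<otimes> k)"
        by (auto simp: set_mult_def l_coset_def)
      then have "inv (j \<otimes> g) \<otimes> y = k"
        using sub g by (simp add: inv_mult_group m_assoc inv_mult_cancel_left subset_iff)
      with jk show ?thesis by (intro bexI[of _ j]) simp_all
    qed
    show "x (h \<otimes> (y \<otimes> g)) = fun_act G g x (h \<otimes> y)" if "y \<in> J" for y
      using that sub h g by (simp add: fun_act_def m_assoc subset_iff)
  qed (use I K sub in auto)
  then show ?thesis using I gx h sub by (simp add: fun_transf_apply)
qed

text \<open>The cosets of \<open>K\<close> in \<open>H\<close> are grouped by the double coset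
  \<open>JgK\<close> that contains them, and each group makes up one summand. The sum is taken in
  any \<open>L\<close> with pointwise addition, because the levels of the ring and of a module are
  records of different types.\<close>

lemma fun_transf_double_coset:
  assumes J: "subgroup J G" and K: "subgroup K G" and H: "subgroup H G"
    and JH: "J \<subseteq> H" and KH: "K \<subseteq> H" and x: "x \<in> fun_fixed G X K" and L: "pointwise J L"
  shows "fun_transf G X K H x = (\<Oplus>\<^bsub>L\<^esub> D \<in> double_cosets G J H K.
    fun_transf G X (J \<inter> conj_subgroup G (SOME g. g \<in> D) K) J (fun_act G (SOME g. g \<in> D) x))"
    (is "_ = (\<Oplus>\<^bsub>L\<^esub> D \<in> _. ?t D)")
proof (rule fun_fixed_eqI)
  have sub: "J \<subseteq> carrier G" "K \<subseteq> carrier G" "H \<subseteq> carrier G"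
    using J K H by (simp_all add: subgroup.subset)
  interpret L: abelian_group L by (rule pointwise_abelian_group[OF sub(1) L])
  \<comment> \<open>Every element of a double coset generates it, so the \<open>SOME\<close>
    representative in the formula serves as well as the \<open>g\<close> that produced
    \<open>D\<close>.\<close>
  have D: "(SOME g. g \<in> D) \<in> carrier G \<and> D = J <#> ((SOME g. g \<in> D) <# K) \<and> D \<subseteq> H"
    if "D \<in> double_cosets G J H K" for D
  proof -
    from that obtain g where g: "g \<in> H" "D = J <#> (g <# K)" by (auto simp: double_cosets_def)
    then have "g \<in> D" using mem_double_coset_self[OF J K] sub by auto
    then have s: "(SOME g. g \<in> D) \<in> D" by (rule someI)
    moreover have "D \<subseteq> H" using g JH KH H
      by (auto simp: set_mult_def l_coset_def subgroup.m_closed subset_iff)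
    ultimately show ?thesis using double_coset_eq[OF J K, of g] g sub by auto
  qed
  have t: "?t \<in> double_cosets G J H K \<rightarrow> carrier L"
  proof
    fix D assume "D \<in> double_cosets G J H K"
    with D have g: "(SOME g. g \<in> D) \<in> carrier G" by blast
    show "?t D \<in> carrier L"
      unfolding pointwise_carrier[OF L]
      by (rule fun_transf_closed[OF subgroups_Inter_pair[OF J subgroup_conj_subgroup[OF K g]] J])
        (use fun_act_closed[OF K g x] fun_fixed_mono[OF Int_lower2] in blast)
  qed
  show "fun_transf G X K H x \<in> fun_fixed G X H" using assms by (simp add: fun_transf_closed)
  show "(\<Oplus>\<^bsub>L\<^esub> D \<in> double_cosets G J H K. ?t D) \<in> fun_fixed G X J"
    using L.finsum_closed[OF t] by (simp add: pointwise_carrier[OF L])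
  fix h assume h: "h \<in> carrier G"
  define \<psi> where "\<psi> = (\<lambda>y. x (h \<otimes> y))"
  have \<psi>: "invariant K \<psi>"
    unfolding \<psi>_def using assms sub h by (simp add: invariant_translate fun_fixed_invariant)
  have fin: "finite (double_cosets G J H K)"
    using sub finite_carrier by (auto simp: double_cosets_def intro: finite_subset)
  have "H \<subseteq> \<Union> (double_cosets G J H K)"
  proof
    fix g assume "g \<in> H"
    with sub show "g \<in> \<Union> (double_cosets G J H K)"
      using mem_double_coset_self[OF J K, of g] \<open>g \<in> H\<close> unfolding double_cosets_def by blast
  qed
  then have "H = \<Union> (double_cosets G J H K)" using D by blast
  then have "fun_transf G X K H x h = coset_sum \<psi> (\<Union> (double_cosets G J H K)) K"
    using assms h sub by (simp add: fun_transf_apply \<psi>_def)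
  also have "\<dots> = (\<Oplus>\<^bsub>X\<^esub> D \<in> double_cosets G J H K. coset_sum \<psi> D K)"
  proof (rule coset_sum_partition[OF K \<psi> fin])
    fix D assume DD: "D \<in> double_cosets G J H K"
    then obtain g where g: "g \<in> carrier G" "D = J <#> (g <# K)" using D by blast
    show "D \<subseteq> carrier G" using DD D sub by blast
    show "d \<otimes> k \<in> D" if "d \<in> D" "k \<in> K" for d k
    proof -
      from that g obtain j i where "j \<in> J" "i \<in> K" "d = j \<otimes> (g \<otimes> i)"
        by (auto simp: set_mult_def l_coset_def)
      moreover from this have "d \<otimes> k = j \<otimes> (g \<otimes> (i \<otimes> k))" "i \<otimes> k \<in> K"
        using that g sub K by (auto simp: m_assoc subset_iff subgroup.m_closed)
      ultimately show ?thesis using g by (auto simp: set_mult_def l_coset_def)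
    qed
    fix D' assume "D' \<in> double_cosets G J H K" and ne: "D \<inter> D' \<noteq> {}"
    then obtain g' where g': "g' \<in> carrier G" "D' = J <#> (g' <# K)" using D by blast
    from ne obtain y where "y \<in> D" "y \<in> D'" by blast
    then show "D = D'" using double_coset_eq[OF J K] g g' by metis
  qed
  also have "\<dots> = (\<Oplus>\<^bsub>X\<^esub> D \<in> double_cosets G J H K. ?t D h)"
  proof (rule X.finsum_cong'[OF refl])
    show "(\<lambda>D. ?t D h) \<in> double_cosets G J H K \<rightarrow> carrier X"
      using t h by (auto simp: pointwise_carrier[OF L] Pi_iff intro: fun_fixed_closed)
    show "coset_sum \<psi> D K = ?t D h" if "D \<in> double_cosets G J H K" for D
      using double_coset_summand[OF J K _ x h, of "SOME g. g \<in> D"] D[OF that] by (simp add: \<psi>_def)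
  qed
  also have "\<dots> = (\<Oplus>\<^bsub>L\<^esub> D \<in> double_cosets G J H K. ?t D) h"
    by (rule pointwise_finsum[symmetric, OF sub(1) L fin t h])
  finally show "fun_transf G X K H x h = (\<Oplus>\<^bsub>L\<^esub> D \<in> double_cosets G J H K. ?t D) h" .
qed

lemma pointwise_homI:
  assumes "H \<subseteq> carrier G" "K \<subseteq> carrier G" "pointwise H L" "pointwise K L'"
    and closed: "\<And>x. x \<in> fun_fixed G X H \<Longrightarrow> f x \<in> fun_fixed G X K"
    and add: "\<And>x y g. \<lbrakk>x \<in> fun_fixed G X H; y \<in> fun_fixed G X H; g \<in> carrier G\<rbrakk>
      \<Longrightarrow> f (x \<oplus>\<^bsub>L\<^esub> y) g = f x g \<oplus>\<^bsub>X\<^esub> f y g"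
  shows "abelian_group_hom L L' f"
proof -
  interpret L: abelian_group L by (rule pointwise_abelian_group[OF assms(1,3)])
  interpret L': abelian_group L' by (rule pointwise_abelian_group[OF assms(2,4)])
  have carr: "carrier L = fun_fixed G X H" "carrier L' = fun_fixed G X K"
    using assms by (simp_all add: pointwise_carrier)
  have "f (x \<oplus>\<^bsub>L\<^esub> y) = f x \<oplus>\<^bsub>L'\<^esub> f y" if "x \<in> carrier L" "y \<in> carrier L" for x y
  proof (rule fun_fixed_eqI)
    show "f (x \<oplus>\<^bsub>L\<^esub> y) \<in> fun_fixed G X K"
      using that closed[of "x \<oplus>\<^bsub>L\<^esub> y"] L.a_closed[OF that] by (simp add: carr)
    show "f x \<oplus>\<^bsub>L'\<^esub> f y \<in> fun_fixed G X K"
      using that closed L'.a_closed[of "f x" "f y"] by (simp add: carr)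
  qed (use that assms(4) in \<open>simp add: carr add pointwise_add\<close>)
  then show ?thesis
    using closed
    by (intro abelian_group_homI L.abelian_group_axioms L'.abelian_group_axioms group_hom.intro
        group_hom_axioms.intro L.a_group L'.a_group)
      (auto simp: hom_def carr)
qed

lemma fun_transf_add:
  assumes H: "subgroup H G" and K: "K \<subseteq> carrier G" and L: "pointwise H L"
    and xy: "x \<in> fun_fixed G X H" "y \<in> fun_fixed G X H" and g: "g \<in> carrier G"
  shows "fun_transf G X H K (x \<oplus>\<^bsub>L\<^esub> y) g = fun_transf G X H K x g \<oplus>\<^bsub>X\<^esub> fun_transf G X H K y g"
proof -
  have sub: "H \<subseteq> carrier G" using H by (simp add: subgroup.subset)
  interpret L: abelian_group L by (rule pointwise_abelian_group[OF sub L])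
  have sum: "x \<oplus>\<^bsub>L\<^esub> y \<in> fun_fixed G X H"
    using xy L.a_closed[of x y] by (simp add: pointwise_carrier[OF L])
  have *: "(\<lambda>C. z (g \<otimes> (SOME k. k \<in> C))) \<in> left_cosets_in G K H \<rightarrow> carrier X"
    if "z \<in> fun_fixed G X H" for z
    by (rule coset_summand_closed[OF H _ K])
      (use that g H sub in \<open>simp add: invariant_translate fun_fixed_invariant\<close>)
  have "fun_transf G X H K (x \<oplus>\<^bsub>L\<^esub> y) g =
      (\<Oplus>\<^bsub>X\<^esub> C \<in> left_cosets_in G K H. x (g \<otimes> (SOME k. k \<in> C)) \<oplus>\<^bsub>X\<^esub> y (g \<otimes> (SOME k. k \<in> C)))"
    unfolding fun_transf_apply[OF H K sum g] coset_sum_def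
    by (rule X.finsum_cong'[OF refl])
      (use *[OF xy(1)] *[OF xy(2)] K H g in \<open>auto simp: Pi_iff left_cosets_in_def
        some_l_coset_carrier pointwise_add[OF L] subset_iff\<close>)
  also have "\<dots> = fun_transf G X H K x g \<oplus>\<^bsub>X\<^esub> fun_transf G X H K y g"
    unfolding fun_transf_apply[OF H K xy(1) g] fun_transf_apply[OF H K xy(2) g] coset_sum_def
    by (rule X.finsum_addf) (use * xy in auto)
  finally show ?thesis .
qed

text \<open>The levels are constrained only through \<open>pointwise\<close>, so the same proof
  covers the coinduced ring and every coinduced module.\<close>

theorem mackey_functor_pointwise:
  assumes level: "\<And>H. subgroup H G \<Longrightarrow> pointwise H (level M H)"
    and ops: "restr M = (\<lambda>K H \<phi>. \<phi>)" "transf M = fun_transf G X" "conjg M = (\<lambda>g H. fun_act G g)"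
  shows "mackey_functor G M"
proof (intro mackey_functor.intro mackey_functor_axioms.intro group_axioms)
  note carr = level[THEN pointwise_carrier]
  note sub = subgroup.subset
  show "finite (carrier G)" by (rule finite_carrier)
  {
    fix H K assume HK: "subgroup H G" "subgroup K G" "H \<subseteq> K"
    show "abelian_group_hom (level M K) (level M H) (restr M K H)"
      by (rule pointwise_homI[OF _ _ level level])
        (use HK fun_fixed_mono[OF HK(3)] in \<open>auto simp: ops sub pointwise_add[OF level]\<close>)
    show "abelian_group_hom (level M H) (level M K) (transf M H K)"
      by (rule pointwise_homI[OF _ _ level level])
        (use HK in \<open>auto simp: ops sub fun_transf_closed fun_transf_add[OF _ _ level]\<close>)
  }
  {
    fix H g assume Hg: "subgroup H G" "g \<in> carrier G"
    show "abelian_group_hom (level M H) (level M (conj_subgroup G g H)) (conjg M g H)"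
    proof (rule pointwise_homI[OF _ _ level level])
      show "conjg M g H x \<in> fun_fixed G X (conj_subgroup G g H)" if "x \<in> fun_fixed G X H" for x
        using that Hg by (simp add: ops fun_act_closed)
    qed (use Hg in \<open>auto simp: ops sub subgroup_conj_subgroup fun_act_def pointwise_add[OF level]\<close>)
  }
  fix H x assume Hx: "subgroup H G" "x \<in> carrier (level M H)"
  then have x: "x \<in> fun_fixed G X H" by (simp add: carr)
  show "restr M H H x = x" "transf M H H x = x"
    using Hx x by (simp_all add: ops fun_transf_self)
  show "conjg M h H x = x" if "h \<in> H" for h
    using that x by (simp add: ops fun_fixed_def)
  show "conjg M g (conj_subgroup G g' H) (conjg M g' H x) = conjg M (g \<otimes> g') H x"
    if "g \<in> carrier G" "g' \<in> carrier G" for g g'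
    using that by (simp add: ops fun_act_act)
  show "restr M J H' (restr M H J x) = restr M H H' x" for J H'
    by (simp add: ops)
  show "conjg M g J (restr M H J x)
      = restr M (conj_subgroup G g H) (conj_subgroup G g J) (conjg M g H x)" for g J
    by (simp add: ops)
  show "transf M J K (transf M H J x) = transf M H K x"
    if "subgroup J G" "subgroup K G" "H \<subseteq> J" "J \<subseteq> K" for J K
    using that Hx x by (simp add: ops fun_transf_transf)
  show "conjg M g K (transf M H K x) =
      transf M (conj_subgroup G g H) (conj_subgroup G g K) (conjg M g H x)"
    if "subgroup K G" "H \<subseteq> K" "g \<in> carrier G" for g K
    using that Hx x by (simp add: ops fun_act_transf)
  show "restr M K J (transf M H K x) = (\<Oplus>\<^bsub>level M J\<^esub> D \<in> double_cosets G J K H.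
      let g = (SOME g. g \<in> D); L = H \<inter> conj_subgroup G (inv g) J
      in transf M (J \<inter> conj_subgroup G g H) J (conjg M g L (restr M H L x)))"
    if "subgroup J G" "subgroup K G" "J \<subseteq> K" "H \<subseteq> K" for J K
    unfolding ops Let_def using that Hx x by (intro fun_transf_double_coset level)
qed

end

section \<open>The coinduced Green functor and its modules\<close>

lemma (in module) finsum_smult_rdistr:
  assumes "finite A" "f \<in> A \<rightarrow> carrier R" "x \<in> carrier M"
  shows "(\<Oplus>i\<in>A. f i) \<odot>\<^bsub>M\<^esub> x = (\<Oplus>\<^bsub>M\<^esub> i \<in> A. f i \<odot>\<^bsub>M\<^esub> x)"
  using assms
proof (induction A)
  case (insert a A)
  then have "f a \<in> carrier R" "f \<in> A \<rightarrow> carrier R" by auto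
  with insert show ?case by (simp add: smult_l_distr Pi_iff)
qed simp

lemma (in coset_sums) some_left_coset_mem:
  assumes "subgroup H G" "subgroup K G" "H \<subseteq> K" "C \<in> left_cosets_in G K H"
  shows "(SOME k. k \<in> C) \<in> K"
proof -
  from assms obtain k where "k \<in> K" "C = k <# H" by (auto simp: left_cosets_in_def)
  moreover from this obtain h where "h \<in> H" "(SOME k. k \<in> C) = k \<otimes> h"
    using some_l_coset[of H k] assms by (auto simp: subgroup.mem_carrier)
  ultimately show ?thesis using assms by (auto simp: subgroup.m_closed)
qed

locale coinduction = group G + R: cring R
  for G :: "('g, 'a) monoid_scheme" (structure) and R :: "('r, 'b) ring_scheme" +
  assumes finite_carrier: "finite (carrier G)"
begin

sublocale R: coset_sums G R
  by unfold_locales (rule finite_carrier)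

abbreviation green :: "('g, 'g \<Rightarrow> 'r) green_data" where
  "green \<equiv> underlying_green (coind_tambara G R)"

lemma green_ops:
  "restr green = (\<lambda>K H \<phi>. \<phi>)" "transf green = fun_transf G R" "conjg green = (\<lambda>g H. fun_act G g)"
  by (simp_all add: underlying_green_def mackey.defs coind_tambara_def)

lemma green_level:
  "carrier (level green H) = fun_fixed G R H"
  "\<one>\<^bsub>level green H\<^esub> = (\<lambda>g\<in>carrier G. \<one>\<^bsub>R\<^esub>)"
  "\<phi> \<otimes>\<^bsub>level green H\<^esub> \<psi> = (\<lambda>g\<in>carrier G. \<phi> g \<otimes>\<^bsub>R\<^esub> \<psi> g)"
  "\<phi> \<oplus>\<^bsub>level green H\<^esub> \<psi> = (\<lambda>g\<in>carrier G. \<phi> g \<oplus>\<^bsub>R\<^esub> \<psi> g)"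
  by (simp_all add: underlying_green_def mackey.defs coind_tambara_def fun_ring_def)

lemma green_pointwise: "R.pointwise H (level green H)"
  by (simp add: R.pointwise_def underlying_green_def mackey.defs coind_tambara_def)

lemma mackey_functor_green: "mackey_functor G green"
  by (rule R.mackey_functor_pointwise) (simp_all add: green_pointwise green_ops)

lemma green_mult_closed:
  assumes "subgroup H G" "\<phi> \<in> fun_fixed G R H" "\<psi> \<in> fun_fixed G R H"
  shows "(\<lambda>g\<in>carrier G. \<phi> g \<otimes>\<^bsub>R\<^esub> \<psi> g) \<in> fun_fixed G R H"
  by (rule R.fun_fixed_restrictI)
    (use assms in \<open>auto simp: R.fun_fixed_iff R.invariant_def subgroup.subset\<close>)

lemma green_level_cring:
  assumes H: "subgroup H G"
  shows "cring (level green H)"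
proof -
  have sub: "H \<subseteq> carrier G" using H by (rule subgroup.subset)
  interpret L: abelian_group "level green H"
    by (rule R.pointwise_abelian_group[OF sub green_pointwise])
  have one: "(\<lambda>g\<in>carrier G. \<one>\<^bsub>R\<^esub>) \<in> fun_fixed G R H"
    by (rule R.fun_fixed_restrictI[OF sub]) (use sub in \<open>auto simp: R.invariant_def\<close>)
  have add: "(\<lambda>g\<in>carrier G. \<phi> g \<oplus>\<^bsub>R\<^esub> \<psi> g) \<in> fun_fixed G R H"
    if "\<phi> \<in> fun_fixed G R H" "\<psi> \<in> fun_fixed G R H" for \<phi> \<psi>
    using L.a_closed[of \<phi> \<psi>] that by (simp add: green_level)
  note closed = green_mult_closed[OF H] one add R.fun_fixed_closed
  show ?thesis
  proof (rule cringI)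
    show "abelian_group (level green H)" by (rule L.abelian_group_axioms)
    show "comm_monoid (level green H)"
    proof (rule comm_monoidI)
      fix \<phi> \<psi> \<chi> assume *: "\<phi> \<in> carrier (level green H)" "\<psi> \<in> carrier (level green H)"
        "\<chi> \<in> carrier (level green H)"
      then show "\<phi> \<otimes>\<^bsub>level green H\<^esub> \<psi> \<otimes>\<^bsub>level green H\<^esub> \<chi>
          = \<phi> \<otimes>\<^bsub>level green H\<^esub> (\<psi> \<otimes>\<^bsub>level green H\<^esub> \<chi>)"
        unfolding green_level by (intro restrict_ext) (simp add: R.m_assoc closed)
    next
      fix \<phi> \<psi> assume *: "\<phi> \<in> carrier (level green H)" "\<psi> \<in> carrier (level green H)"
      then show "\<phi> \<otimes>\<^bsub>level green H\<^esub> \<psi> = \<psi> \<otimes>\<^bsub>level green H\<^esub> \<phi>"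
        by (intro R.fun_fixed_eqI[of _ H _ H]) (auto simp: green_level closed R.m_comm)
      show "\<phi> \<otimes>\<^bsub>level green H\<^esub> \<psi> \<in> carrier (level green H)"
        using * by (auto simp: green_level closed)
      show "\<one>\<^bsub>level green H\<^esub> \<otimes>\<^bsub>level green H\<^esub> \<phi> = \<phi>"
        unfolding green_level
        by (rule R.fun_fixed_eqI[OF green_mult_closed[OF H one]])
          (use * in \<open>auto simp: green_level closed\<close>)
    qed (simp add: green_level closed)
    fix \<phi> \<psi> \<chi> assume "\<phi> \<in> carrier (level green H)" "\<psi> \<in> carrier (level green H)"
      "\<chi> \<in> carrier (level green H)"
    then show "(\<phi> \<oplus>\<^bsub>level green H\<^esub> \<psi>) \<otimes>\<^bsub>level green H\<^esub> \<chi>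
        = \<phi> \<otimes>\<^bsub>level green H\<^esub> \<chi> \<oplus>\<^bsub>level green H\<^esub> \<psi> \<otimes>\<^bsub>level green H\<^esub> \<chi>"
      unfolding green_level by (intro restrict_ext) (simp add: R.l_distr closed)
  qed
qed

lemma coset_sums_module: "module R X \<Longrightarrow> coset_sums G X"
  by (intro coset_sums.intro coset_sums_axioms.intro group_axioms module.axioms(2) finite_carrier)

text \<open>A \<open>K\<close>-fixed factor has the same value at all \<open>h k\<close> with
  \<open>k\<close> in \<open>K\<close>, so it can be pulled out of the coset sum that defines a
  transfer to \<open>K\<close>. Frobenius reciprocity rests on this.\<close>

lemma fun_fixed_some:
  assumes "subgroup H G" "subgroup K G" "H \<subseteq> K" "C \<in> left_cosets_in G K H"
    and "coset_sums G X" "a \<in> fun_fixed G X K" "h \<in> carrier G"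
  shows "a (h \<otimes> (SOME k. k \<in> C)) = a h"
  using R.some_left_coset_mem[OF assms(1-4)] coset_sums.fun_fixed_invariant[OF assms(5,2,6)] assms(7)
  by (simp add: coset_sums.invariant_def[OF assms(5)])

lemma fun_transf_closed_summand:
  assumes "subgroup H G" "subgroup K G" "coset_sums G X" "x \<in> fun_fixed G X H" "h \<in> carrier G"
  shows "(\<lambda>C. x (h \<otimes> (SOME k. k \<in> C))) \<in> left_cosets_in G K H \<rightarrow> carrier X"
proof -
  interpret X: coset_sums G X by fact
  show ?thesis
    by (rule X.coset_summand_closed)
      (use assms in \<open>auto simp: X.invariant_translate X.fun_fixed_invariant subgroup.subset\<close>)
qed

lemma fun_transf_sum:
  assumes "subgroup H G" "subgroup K G" "coset_sums G X" "x \<in> fun_fixed G X H" "h \<in> carrier G"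
  shows "fun_transf G X H K x h = (\<Oplus>\<^bsub>X\<^esub> C \<in> left_cosets_in G K H. x (h \<otimes> (SOME k. k \<in> C)))"
  using assms
  by (simp add: coset_sums.fun_transf_apply subgroup.subset coset_sums.coset_sum_def)

lemma left_coset_some_carrier:
  assumes "subgroup H G" "subgroup K G" "C \<in> left_cosets_in G K H"
  shows "(SOME k. k \<in> C) \<in> carrier G"
  using assms by (auto simp: left_cosets_in_def R.some_l_coset_carrier subgroup.mem_carrier)

text \<open>Apart from the Mackey axioms, everything but Frobenius reciprocity is a pointwise law of
  \<open>R\<close>. Frobenius reciprocity is distributivity in \<open>R\<close> once
  \<open>fun_fixed_some\<close> has made the second factor independent of the coset.\<close>

theorem green_functor_coind: "green_functor G green"
proof (intro green_functor.intro green_functor_axioms.intro mackey_functor_green green_level_cring)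
  fix H K assume HK: "subgroup H G" "subgroup K G" "H \<subseteq> K"
  show "restr green K H \<in> ring_hom (level green K) (level green H)"
    by (rule ring_hom_memI) (use R.fun_fixed_mono[OF HK(3)] in \<open>auto simp: green_ops green_level\<close>)
  fix x a assume "x \<in> carrier (level green H)" "a \<in> carrier (level green K)"
  then have x: "x \<in> fun_fixed G R H" and a: "a \<in> fun_fixed G R K" by (simp_all add: green_level)
  then have a': "a \<in> fun_fixed G R H" using R.fun_fixed_mono[OF HK(3)] by blast
  show "transf green H K x \<otimes>\<^bsub>level green K\<^esub> a
      = transf green H K (x \<otimes>\<^bsub>level green H\<^esub> restr green K H a)"
    unfolding green_ops green_level
  proof (rule R.fun_fixed_eqI)
    show "(\<lambda>g\<in>carrier G. fun_transf G R H K x g \<otimes>\<^bsub>R\<^esub> a g) \<in> fun_fixed G R K"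
      "fun_transf G R H K (\<lambda>g\<in>carrier G. x g \<otimes>\<^bsub>R\<^esub> a g) \<in> fun_fixed G R K"
      using HK x a a' by (simp_all add: green_mult_closed R.fun_transf_closed)
    fix h assume h: "h \<in> carrier G"
    have fin: "finite (left_cosets_in G K H)" using HK by (simp add: R.finite_left_cosets subgroup.subset)
    note f = fun_transf_closed_summand[OF HK(1,2) R.coset_sums_axioms x h]
    have "fun_transf G R H K (\<lambda>g\<in>carrier G. x g \<otimes>\<^bsub>R\<^esub> a g) h =
        (\<Oplus>\<^bsub>R\<^esub> C \<in> left_cosets_in G K H. x (h \<otimes> (SOME k. k \<in> C)) \<otimes>\<^bsub>R\<^esub> a h)"
      unfolding fun_transf_sum[OF HK(1,2) R.coset_sums_axioms green_mult_closed[OF HK(1) x a'] h]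
      by (rule R.finsum_cong'[OF refl])
        (use f h HK R.fun_fixed_closed[OF a h] fun_fixed_some[OF HK _ R.coset_sums_axioms a h]
          in \<open>auto simp: Pi_iff left_coset_some_carrier\<close>)
    also have "\<dots> = fun_transf G R H K x h \<otimes>\<^bsub>R\<^esub> a h"
      unfolding fun_transf_sum[OF HK(1,2) R.coset_sums_axioms x h]
      by (rule R.finsum_ldistr[symmetric, OF fin R.fun_fixed_closed[OF a h] f])
    finally show "(\<lambda>g\<in>carrier G. fun_transf G R H K x g \<otimes>\<^bsub>R\<^esub> a g) h
        = fun_transf G R H K (\<lambda>g\<in>carrier G. x g \<otimes>\<^bsub>R\<^esub> a g) h"
      using h by simp
  qed
next
  fix H g assume Hg: "subgroup H G" "g \<in> carrier G"
  have "fun_act G g \<phi> \<in> carrier (level green (conj_subgroup G g H))"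
    if "\<phi> \<in> carrier (level green H)" for \<phi>
    using that Hg R.fun_act_closed by (simp add: green_level)
  with Hg show "conjg green g H \<in> ring_hom (level green H) (level green (conj_subgroup G g H))"
    by (intro ring_hom_memI) (auto simp: green_ops green_level fun_act_def)
qed

section \<open>Coinduced modules over the coinduced Green functor\<close>

lemma coind_module_ops:
  "restr (coind_module G X) = (\<lambda>K H \<phi>. \<phi>)" "transf (coind_module G X) = fun_transf G X"
  "conjg (coind_module G X) = (\<lambda>g H. fun_act G g)"
  by (simp_all add: coind_module_def)

lemma coind_module_level:
  "carrier (level (coind_module G X) H) = fun_fixed G X H"
  "\<phi> \<oplus>\<^bsub>level (coind_module G X) H\<^esub> \<psi> = (\<lambda>g\<in>carrier G. \<phi> g \<oplus>\<^bsub>X\<^esub> \<psi> g)"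
  "a \<odot>\<^bsub>level (coind_module G X) H\<^esub> \<psi> = (\<lambda>g\<in>carrier G. a g \<odot>\<^bsub>X\<^esub> \<psi> g)"
  by (simp_all add: coind_module_def coind_module_level_def fun_ring_def)

lemma coind_smult_closed:
  assumes X: "module R X" and H: "subgroup H G"
    and "a \<in> fun_fixed G R H" "m \<in> fun_fixed G X H"
  shows "(\<lambda>g\<in>carrier G. a g \<odot>\<^bsub>X\<^esub> m g) \<in> fun_fixed G X H"
proof -
  interpret X: module R X by fact
  interpret X: coset_sums G X by (rule coset_sums_module[OF X])
  show ?thesis
    by (rule X.fun_fixed_restrictI)
      (use assms in \<open>auto simp: X.fun_fixed_iff X.invariant_def R.fun_fixed_iff R.invariant_def
        subgroup.subset\<close>)
qed

text \<open>The two Frobenius laws differ in which factor is \<open>K\<close>-fixed. If it is the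
  module element, the sum of scalars is distributed over it; if it is the scalar, that scalar is
  pulled out of a sum in \<open>X\<close>.\<close>

theorem green_module_coind:
  assumes X: "module R X"
  shows "green_module G green (coind_module G X)"
proof -
  interpret X: module R X by fact
  interpret X: coset_sums G X by (rule coset_sums_module[OF X])
  let ?M = "coind_module G X"
  have pw: "X.pointwise H (level ?M H)" for H
    by (simp add: X.pointwise_def coind_module_def coind_module_level_def)
  note smult = coind_smult_closed[OF X]
  show ?thesis
  proof (intro green_module.intro green_module_axioms.intro green_functor_coind
      X.mackey_functor_pointwise)
    show "X.pointwise H (level ?M H)" for H by (rule pw)
    show "restr ?M = (\<lambda>K H \<phi>. \<phi>)" "transf ?M = fun_transf G X" "conjg ?M = (\<lambda>g H. fun_act G g)"
      by (simp_all add: coind_module_ops)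
  next
    fix H assume H: "subgroup H G"
    interpret L: abelian_group "level ?M H"
      by (rule X.pointwise_abelian_group[OF _ pw]) (use H in \<open>simp add: subgroup.subset\<close>)
    interpret K: cring "level green H" by (rule green_level_cring[OF H])
    have add: "(\<lambda>g\<in>carrier G. \<phi> g \<oplus>\<^bsub>X\<^esub> \<psi> g) \<in> fun_fixed G X H"
      if "\<phi> \<in> fun_fixed G X H" "\<psi> \<in> fun_fixed G X H" for \<phi> \<psi>
      using L.a_closed[of \<phi> \<psi>] that by (simp add: coind_module_level)
    have addR: "(\<lambda>g\<in>carrier G. \<phi> g \<oplus>\<^bsub>R\<^esub> \<psi> g) \<in> fun_fixed G R H"
      if "\<phi> \<in> fun_fixed G R H" "\<psi> \<in> fun_fixed G R H" for \<phi> \<psi>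
      using K.a_closed[of \<phi> \<psi>] that by (simp add: green_level)
    have one: "(\<lambda>g\<in>carrier G. \<one>\<^bsub>R\<^esub>) \<in> fun_fixed G R H"
      using K.one_closed by (simp add: green_level)
    note closed = smult[OF H] add addR one green_mult_closed[OF H] R.fun_fixed_closed X.fun_fixed_closed
    show "module (level green H) (level ?M H)"
    proof (rule moduleI[OF K.is_cring L.abelian_group_axioms])
      fix a m assume am: "a \<in> carrier (level green H)" "m \<in> carrier (level ?M H)"
      show "a \<odot>\<^bsub>level ?M H\<^esub> m \<in> carrier (level ?M H)"
        using am by (simp add: green_level coind_module_level closed)
      fix b assume b: "b \<in> carrier (level green H)"
      show "(a \<oplus>\<^bsub>level green H\<^esub> b) \<odot>\<^bsub>level ?M H\<^esub> m =
          a \<odot>\<^bsub>level ?M H\<^esub> m \<oplus>\<^bsub>level ?M H\<^esub> b \<odot>\<^bsub>level ?M H\<^esub> m"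
        using am b unfolding green_level coind_module_level
        by (intro restrict_ext) (simp add: X.smult_l_distr closed)
      show "(a \<otimes>\<^bsub>level green H\<^esub> b) \<odot>\<^bsub>level ?M H\<^esub> m =
          a \<odot>\<^bsub>level ?M H\<^esub> (b \<odot>\<^bsub>level ?M H\<^esub> m)"
        using am b unfolding green_level coind_module_level
        by (intro restrict_ext) (simp add: X.smult_assoc1 closed)
    next
      fix m assume m: "m \<in> carrier (level ?M H)"
      show "\<one>\<^bsub>level green H\<^esub> \<odot>\<^bsub>level ?M H\<^esub> m = m"
        unfolding green_level coind_module_level
      proof (rule X.fun_fixed_eqI)
        show "(\<lambda>g\<in>carrier G. (\<lambda>g\<in>carrier G. \<one>\<^bsub>R\<^esub>) g \<odot>\<^bsub>X\<^esub> m g) \<in> fun_fixed G X H"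
          by (rule closed(1)[OF one]) (use m in \<open>simp add: coind_module_level\<close>)
      qed (use m in \<open>auto simp: coind_module_level closed\<close>)
    next
      fix a m n assume "a \<in> carrier (level green H)" "m \<in> carrier (level ?M H)"
        "n \<in> carrier (level ?M H)"
      then show "a \<odot>\<^bsub>level ?M H\<^esub> (m \<oplus>\<^bsub>level ?M H\<^esub> n) =
          a \<odot>\<^bsub>level ?M H\<^esub> m \<oplus>\<^bsub>level ?M H\<^esub> a \<odot>\<^bsub>level ?M H\<^esub> n"
        unfolding green_level coind_module_level
        by (intro restrict_ext) (simp add: X.smult_r_distr closed)
    qed
  next
    fix H g a m assume "subgroup H G" "g \<in> carrier G"
    then show "conjg ?M g H (a \<odot>\<^bsub>level ?M H\<^esub> m)
        = conjg green g H a \<odot>\<^bsub>level ?M (conj_subgroup G g H)\<^esub> conjg ?M g H m"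
      by (auto simp: green_ops coind_module_ops coind_module_level fun_act_def)
  next
    fix H K x m assume HK: "subgroup H G" "subgroup K G" "H \<subseteq> K"
      and "x \<in> carrier (level green H)" "m \<in> carrier (level ?M K)"
    then have x: "x \<in> fun_fixed G R H" and m: "m \<in> fun_fixed G X K" and m': "m \<in> fun_fixed G X H"
      using X.fun_fixed_mono[OF HK(3)] by (auto simp: green_level coind_module_level)
    show "transf green H K x \<odot>\<^bsub>level ?M K\<^esub> m = transf ?M H K (x \<odot>\<^bsub>level ?M H\<^esub> restr ?M K H m)"
      unfolding green_ops coind_module_ops coind_module_level
    proof (rule X.fun_fixed_eqI)
      show "(\<lambda>g\<in>carrier G. fun_transf G R H K x g \<odot>\<^bsub>X\<^esub> m g) \<in> fun_fixed G X K"
        "fun_transf G X H K (\<lambda>g\<in>carrier G. x g \<odot>\<^bsub>X\<^esub> m g) \<in> fun_fixed G X K"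
        using HK x m m' by (simp_all add: smult R.fun_transf_closed X.fun_transf_closed)
      fix h assume h: "h \<in> carrier G"
      have fin: "finite (left_cosets_in G K H)"
        using HK by (simp add: R.finite_left_cosets subgroup.subset)
      note f = fun_transf_closed_summand[OF HK(1,2) R.coset_sums_axioms x h]
      have "fun_transf G X H K (\<lambda>g\<in>carrier G. x g \<odot>\<^bsub>X\<^esub> m g) h =
          (\<Oplus>\<^bsub>X\<^esub> C \<in> left_cosets_in G K H. x (h \<otimes> (SOME k. k \<in> C)) \<odot>\<^bsub>X\<^esub> m h)"
        unfolding fun_transf_sum[OF HK(1,2) X.coset_sums_axioms smult[OF HK(1) x m'] h]
        by (rule X.finsum_cong'[OF refl])
          (use f h HK X.fun_fixed_closed[OF m h] fun_fixed_some[OF HK _ X.coset_sums_axioms m h]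
            in \<open>auto simp: Pi_iff left_coset_some_carrier\<close>)
      also have "\<dots> = fun_transf G R H K x h \<odot>\<^bsub>X\<^esub> m h"
        unfolding fun_transf_sum[OF HK(1,2) R.coset_sums_axioms x h]
        by (rule X.finsum_smult_rdistr[symmetric, OF fin f X.fun_fixed_closed[OF m h]])
      finally show "(\<lambda>g\<in>carrier G. fun_transf G R H K x g \<odot>\<^bsub>X\<^esub> m g) h
          = fun_transf G X H K (\<lambda>g\<in>carrier G. x g \<odot>\<^bsub>X\<^esub> m g) h"
        using h by simp
    qed
  next
    fix H K a m assume HK: "subgroup H G" "subgroup K G" "H \<subseteq> K"
      and "a \<in> carrier (level green K)" "m \<in> carrier (level ?M H)"
    then have a: "a \<in> fun_fixed G R K" and a': "a \<in> fun_fixed G R H" and m: "m \<in> fun_fixed G X H"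
      using R.fun_fixed_mono[OF HK(3)] by (auto simp: green_level coind_module_level)
    show "transf ?M H K (restr green K H a \<odot>\<^bsub>level ?M H\<^esub> m) = a \<odot>\<^bsub>level ?M K\<^esub> transf ?M H K m"
      unfolding green_ops coind_module_ops coind_module_level
    proof (rule X.fun_fixed_eqI)
      show "(\<lambda>g\<in>carrier G. a g \<odot>\<^bsub>X\<^esub> fun_transf G X H K m g) \<in> fun_fixed G X K"
        "fun_transf G X H K (\<lambda>g\<in>carrier G. a g \<odot>\<^bsub>X\<^esub> m g) \<in> fun_fixed G X K"
        using HK a a' m by (simp_all add: smult X.fun_transf_closed)
      fix h assume h: "h \<in> carrier G"
      have fin: "finite (left_cosets_in G K H)"
        using HK by (simp add: R.finite_left_cosets subgroup.subset)
      note f = fun_transf_closed_summand[OF HK(1,2) X.coset_sums_axioms m h]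
      have "fun_transf G X H K (\<lambda>g\<in>carrier G. a g \<odot>\<^bsub>X\<^esub> m g) h =
          (\<Oplus>\<^bsub>X\<^esub> C \<in> left_cosets_in G K H. a h \<odot>\<^bsub>X\<^esub> m (h \<otimes> (SOME k. k \<in> C)))"
        unfolding fun_transf_sum[OF HK(1,2) X.coset_sums_axioms smult[OF HK(1) a' m] h]
        by (rule X.finsum_cong'[OF refl])
          (use f h HK R.fun_fixed_closed[OF a h] fun_fixed_some[OF HK _ R.coset_sums_axioms a h]
            in \<open>auto simp: Pi_iff left_coset_some_carrier\<close>)
      also have "\<dots> = a h \<odot>\<^bsub>X\<^esub> fun_transf G X H K m h"
        unfolding fun_transf_sum[OF HK(1,2) X.coset_sums_axioms m h]
        by (rule X.finsum_smult_ldistr[symmetric, OF fin R.fun_fixed_closed[OF a h] f])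
      finally show "fun_transf G X H K (\<lambda>g\<in>carrier G. a g \<odot>\<^bsub>X\<^esub> m g) h
          = (\<lambda>g\<in>carrier G. a g \<odot>\<^bsub>X\<^esub> fun_transf G X H K m g) h"
        using h by simp
    qed
  qed (auto simp: green_ops coind_module_ops coind_module_level)
qed

end

section \<open>The category of modules and coinduction as a functor\<close>

lemma module_homI:
  assumes "f \<in> extensional (carrier X)"
    and "\<And>x. x \<in> carrier X \<Longrightarrow> f x \<in> carrier Y"
    and "\<And>x y. \<lbrakk>x \<in> carrier X; y \<in> carrier X\<rbrakk> \<Longrightarrow> f (x \<oplus>\<^bsub>X\<^esub> y) = f x \<oplus>\<^bsub>Y\<^esub> f y"
    and "\<And>r x. \<lbrakk>r \<in> carrier R; x \<in> carrier X\<rbrakk> \<Longrightarrow> f (r \<odot>\<^bsub>X\<^esub> x) = r \<odot>\<^bsub>Y\<^esub> f x"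
  shows "f \<in> module_hom R X Y"
  using assms by (simp add: module_hom_def PiE_def)

lemma module_homD:
  assumes "f \<in> module_hom R X Y"
  shows "f \<in> extensional (carrier X)"
    and "x \<in> carrier X \<Longrightarrow> f x \<in> carrier Y"
    and "\<lbrakk>x \<in> carrier X; y \<in> carrier X\<rbrakk> \<Longrightarrow> f (x \<oplus>\<^bsub>X\<^esub> y) = f x \<oplus>\<^bsub>Y\<^esub> f y"
    and "\<lbrakk>r \<in> carrier R; x \<in> carrier X\<rbrakk> \<Longrightarrow> f (r \<odot>\<^bsub>X\<^esub> x) = r \<odot>\<^bsub>Y\<^esub> f x"
  using assms by (auto simp: module_hom_def PiE_def)

lemma module_hom_ident:
  assumes "module R X"
  shows "(\<lambda>x\<in>carrier X. x) \<in> module_hom R X X"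
proof -
  interpret module R X by fact
  show ?thesis by (rule module_homI) auto
qed

lemma module_hom_compose:
  assumes "module R X" "f \<in> module_hom R X Y" "g \<in> module_hom R Y Z"
  shows "compose (carrier X) g f \<in> module_hom R X Z"
proof -
  interpret module R X by fact
  show ?thesis
    by (rule module_homI) (use module_homD[OF assms(2)] module_homD[OF assms(3)] in \<open>auto simp: compose_eq\<close>)
qed

lemma module_hom_abelian_group_hom:
  assumes "abelian_group X" "abelian_group Y" "f \<in> module_hom R X Y"
  shows "abelian_group_hom X Y f"
  using assms module_homD[OF assms(3)]
  by (intro abelian_group_homI group_hom.intro group_hom_axioms.intro)
    (auto simp: hom_def abelian_group.a_group)

lemma (in abelian_group_hom) hom_finsum:
  assumes "finite A" "f \<in> A \<rightarrow> carrier G"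
  shows "h (\<Oplus>\<^bsub>G\<^esub> a \<in> A. f a) = (\<Oplus>\<^bsub>H\<^esub> a \<in> A. h (f a))"
  using assms
proof (induction A)
  case (insert a A)
  then have "f a \<in> carrier G" "f \<in> A \<rightarrow> carrier G" by auto
  with insert show ?case by (simp add: Pi_iff)
qed simp

lemma compose_restrict_ident_right:
  "f \<in> extensional A \<Longrightarrow> compose A f (\<lambda>x\<in>A. x) = f"
  by (auto simp: compose_def extensional_def)

lemma compose_restrict_ident_left:
  "\<lbrakk>f \<in> extensional A; \<And>x. x \<in> A \<Longrightarrow> f x \<in> B\<rbrakk> \<Longrightarrow> compose A (\<lambda>x\<in>B. x) f = f"
  by (auto simp: compose_def extensional_def)

text \<open>The identity laws hold as equations of functions because morphisms are extensional and
  \<open>compose\<close> is again restricted to the carrier.\<close>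

lemma category_module_category: "category (module_category R U)"
proof (intro category.intro, unfold module_category_def category.simps mem_Collect_eq)
  fix W X Y Z f g h
  assume "f \<in> module_hom R W X" "g \<in> module_hom R X Y" "h \<in> module_hom R Y Z"
  then show "compose (carrier W) h (compose (carrier W) g f) =
      compose (carrier W) (compose (carrier X) h g) f"
    by (intro compose_assoc[where B = "carrier X"] funcsetI) (rule module_homD(2))
next
  fix X Y f assume "f \<in> module_hom R X Y"
  note fD = module_homD[OF this]
  show "compose (carrier X) f (\<lambda>x\<in>carrier X. x) = f"
    by (rule compose_restrict_ident_right[OF fD(1)])
  show "compose (carrier X) (\<lambda>x\<in>carrier Y. x) f = f"
    by (rule compose_restrict_ident_left[OF fD(1,2)])
qed (blast intro: module_hom_ident module_hom_compose)+

section \<open>Morphisms of modules over a Green functor\<close>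

lemma green_module_homI:
  assumes "f \<in> extensional {H. subgroup H G}"
    and "\<And>H. subgroup H G \<Longrightarrow> f H \<in> module_hom (level k H) (level M H) (level N H)"
    and "\<And>H K m. \<lbrakk>subgroup H G; subgroup K G; H \<subseteq> K; m \<in> carrier (level M K)\<rbrakk>
      \<Longrightarrow> f H (restr M K H m) = restr N K H (f K m)"
    and "\<And>H K m. \<lbrakk>subgroup H G; subgroup K G; H \<subseteq> K; m \<in> carrier (level M H)\<rbrakk>
      \<Longrightarrow> f K (transf M H K m) = transf N H K (f H m)"
    and "\<And>H g m. \<lbrakk>subgroup H G; g \<in> carrier G; m \<in> carrier (level M H)\<rbrakk>
      \<Longrightarrow> f (conj_subgroup G g H) (conjg M g H m) = conjg N g H (f H m)"
  shows "f \<in> green_module_hom G k M N"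
  using assms unfolding green_module_hom_def PiE_def by auto

lemma green_module_homD:
  assumes "f \<in> green_module_hom G k M N"
  shows "f \<in> extensional {H. subgroup H G}"
    and "subgroup H G \<Longrightarrow> f H \<in> module_hom (level k H) (level M H) (level N H)"
    and "\<lbrakk>subgroup H G; subgroup K G; H \<subseteq> K; m \<in> carrier (level M K)\<rbrakk>
      \<Longrightarrow> f H (restr M K H m) = restr N K H (f K m)"
    and "\<lbrakk>subgroup H G; subgroup K G; H \<subseteq> K; m \<in> carrier (level M H)\<rbrakk>
      \<Longrightarrow> f K (transf M H K m) = transf N H K (f H m)"
    and "\<lbrakk>subgroup H G; g \<in> carrier G; m \<in> carrier (level M H)\<rbrakk>
      \<Longrightarrow> f (conj_subgroup G g H) (conjg M g H m) = conjg N g H (f H m)"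
  using assms unfolding green_module_hom_def PiE_def by auto

context mackey_functor
begin

lemma restr_closed:
  "\<lbrakk>subgroup H G; subgroup K G; H \<subseteq> K; x \<in> carrier (level M K)\<rbrakk>
    \<Longrightarrow> restr M K H x \<in> carrier (level M H)"
  by (rule abelian_group_hom.hom_closed[OF restr_hom])

lemma transf_closed:
  "\<lbrakk>subgroup H G; subgroup K G; H \<subseteq> K; x \<in> carrier (level M H)\<rbrakk>
    \<Longrightarrow> transf M H K x \<in> carrier (level M K)"
  by (rule abelian_group_hom.hom_closed[OF transf_hom])

lemma conjg_closed:
  "\<lbrakk>subgroup H G; g \<in> carrier G; x \<in> carrier (level M H)\<rbrakk>
    \<Longrightarrow> conjg M g H x \<in> carrier (level M (conj_subgroup G g H))"
  by (rule abelian_group_hom.hom_closed[OF conjg_hom])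

lemmas conj_closed = subgroup_conj_subgroup

lemmas ops_closed = restr_closed transf_closed conjg_closed

end

lemma green_module_hom_ident:
  assumes "green_module G k M"
  shows "(\<lambda>H\<in>{H. subgroup H G}. \<lambda>m\<in>carrier (level M H). m) \<in> green_module_hom G k M M"
proof -
  interpret green_module G k M by fact
  show ?thesis
    by (rule green_module_homI)
      (auto simp: level_module module_hom_ident ops_closed conj_closed)
qed

lemma green_module_hom_compose:
  assumes "green_module G k M" "green_module G k N"
    and f: "f \<in> green_module_hom G k M N" and g: "g \<in> green_module_hom G k N P"
  shows "(\<lambda>H\<in>{H. subgroup H G}. compose (carrier (level M H)) (g H) (f H)) \<in> green_module_hom G k M P"
proof -
  interpret M: green_module G k M by fact
  have "f H m \<in> carrier (level N H)" if "subgroup H G" "m \<in> carrier (level M H)" for H m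
    using module_homD(2)[OF green_module_homD(2)[OF f]] that by blast
  then show ?thesis
    by (intro green_module_homI)
      (auto simp: M.level_module M.ops_closed M.conj_closed compose_eq
        green_module_homD(3-5)[OF f] green_module_homD(3-5)[OF g]
        intro!: module_hom_compose[of _ _ _ "level N _"] green_module_homD(2)[OF f] green_module_homD(2)[OF g])
qed

lemma category_green_module_category: "category (green_module_category G k V)"
proof
  fix W X Y Z f g h
  assume fgh: "f \<in> Mor (green_module_category G k V) W X" "g \<in> Mor (green_module_category G k V) X Y"
    "h \<in> Mor (green_module_category G k V) Y Z"
  have "compose (carrier (level W H)) (h H) (compose (carrier (level W H)) (g H) (f H)) =
      compose (carrier (level W H)) (compose (carrier (level X H)) (h H) (g H)) (f H)"
    if "subgroup H G" for H
    using that fgh module_homD(2)[OF green_module_homD(2)]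
    by (intro compose_assoc[where B = "carrier (level X H)"]) (auto simp: green_module_category_def)
  then show "Comp (green_module_category G k V) W Y Z h (Comp (green_module_category G k V) W X Y g f) =
      Comp (green_module_category G k V) W X Z (Comp (green_module_category G k V) X Y Z h g) f"
    by (auto simp: green_module_category_def intro!: restrict_ext)
next
  fix X Y f assume f: "f \<in> Mor (green_module_category G k V) X Y"
  then have f': "f \<in> green_module_hom G k X Y" by (simp add: green_module_category_def)
  note homD = module_homD[OF green_module_homD(2)[OF f']]
  show "Comp (green_module_category G k V) X X Y f (Ident (green_module_category G k V) X) = f"
    by (rule extensionalityI[OF _ green_module_homD(1)[OF f']])
      (auto simp: green_module_category_def compose_restrict_ident_right homD)
  show "Comp (green_module_category G k V) X Y Y (Ident (green_module_category G k V) Y) f = f"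
    by (rule extensionalityI[OF _ green_module_homD(1)[OF f']])
      (auto simp: green_module_category_def compose_restrict_ident_left homD)
qed (auto simp: green_module_category_def green_module_hom_ident green_module_hom_compose)

text \<open>To see that the levelwise inverse \<open>g\<close> sends \<open>n\<close> to
  \<open>m\<close> it suffices that \<open>f\<close> sends \<open>m\<close> to \<open>n\<close>.
  This is \<open>g_eqI\<close>, and it turns each compatibility required of \<open>g\<close> into
  the one already known for \<open>f\<close>.\<close>

lemma green_module_hom_bij_is_iso:
  assumes M: "M \<in> Ob (green_module_category G k V)" and N: "N \<in> Ob (green_module_category G k V)"
    and f: "f \<in> green_module_hom G k M N"
    and bij: "\<And>H. subgroup H G \<Longrightarrow> bij_betw (f H) (carrier (level M H)) (carrier (level N H))"
  shows "is_iso (green_module_category G k V) M N f"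
proof -
  interpret M: green_module G k M using M by (simp add: green_module_category_def)
  interpret N: green_module G k N using N by (simp add: green_module_category_def)
  define g where "g = (\<lambda>H\<in>{H. subgroup H G}. \<lambda>n\<in>carrier (level N H).
    inv_into (carrier (level M H)) (f H) n)"
  have g_closed: "g H n \<in> carrier (level M H)" and fg: "f H (g H n) = n"
    if "subgroup H G" "n \<in> carrier (level N H)" for H n
    using bij_betw_imp_surj_on[OF bij[OF that(1)]] that
    by (auto simp: g_def intro: inv_into_into f_inv_into_f)
  have gf: "g H (f H m) = m" if "subgroup H G" "m \<in> carrier (level M H)" for H m
    using bij[OF that(1)] that by (auto simp: g_def bij_betw_def)
  have g_eqI: "g H n = m" if "subgroup H G" "m \<in> carrier (level M H)" "n = f H m" for H n m
    using that gf by simp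
  note fD = green_module_homD[OF f]
  have "g \<in> green_module_hom G k N M"
  proof (rule green_module_homI)
    show "g \<in> extensional {H. subgroup H G}" by (simp add: g_def)
    fix H assume H: "subgroup H G"
    interpret MH: module "level k H" "level M H" by (rule M.level_module[OF H])
    note homD = module_homD[OF fD(2)[OF H]]
    show "g H \<in> module_hom (level k H) (level N H) (level M H)"
    proof (rule module_homI)
      show "g H \<in> extensional (carrier (level N H))" using H by (simp add: g_def)
    qed (use H in \<open>auto intro!: g_eqI simp: g_closed fg homD\<close>)
    show "g (conj_subgroup G a H) (conjg N a H n) = conjg M a H (g H n)"
      if "a \<in> carrier G" "n \<in> carrier (level N H)" for a n
      using that H by (auto intro!: g_eqI simp: g_closed fg fD M.ops_closed M.conj_closed)
  qed (auto intro!: g_eqI simp: g_closed fg fD M.ops_closed)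
  moreover have "(\<lambda>H\<in>{H. subgroup H G}. compose (carrier (level M H)) (g H) (f H)) =
      (\<lambda>H\<in>{H. subgroup H G}. \<lambda>m\<in>carrier (level M H). m)"
    by (auto intro!: restrict_ext simp: compose_def gf)
  moreover have "(\<lambda>H\<in>{H. subgroup H G}. compose (carrier (level N H)) (f H) (g H)) =
      (\<lambda>H\<in>{H. subgroup H G}. \<lambda>n\<in>carrier (level N H). n)"
    by (auto intro!: restrict_ext simp: compose_def fg)
  ultimately show ?thesis
    using f unfolding is_iso_def by (auto simp: green_module_category_def)
qed

section \<open>Coinduction on morphisms and its full faithfulness\<close>

context coinduction
begin

lemma coind_hom_apply:
  "\<lbrakk>subgroup H G; \<phi> \<in> fun_fixed G X H\<rbrakk> \<Longrightarrow> coind_hom G X f H \<phi> = compose (carrier G) f \<phi>"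
  by (simp add: coind_hom_def)

lemma compose_fun_fixed:
  assumes X: "module R X" and Y: "module R Y" and f: "f \<in> module_hom R X Y"
    and H: "subgroup H G" and \<phi>: "\<phi> \<in> fun_fixed G X H"
  shows "compose (carrier G) f \<phi> \<in> fun_fixed G Y H"
proof -
  interpret X: coset_sums G X by (rule coset_sums_module[OF X])
  interpret Y: coset_sums G Y by (rule coset_sums_module[OF Y])
  have sub: "H \<subseteq> carrier G" using H by (rule subgroup.subset)
  show ?thesis
    unfolding compose_def
    by (rule Y.fun_fixed_restrictI[OF sub])
      (use \<phi> sub module_homD(2)[OF f] in \<open>auto simp: X.fun_fixed_iff X.invariant_def Y.invariant_def\<close>)
qed

lemma compose_fun_transf:
  assumes X: "module R X" and Y: "module R Y" and f: "f \<in> module_hom R X Y"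
    and H: "subgroup H G" and K: "subgroup K G" and \<phi>: "\<phi> \<in> fun_fixed G X H"
  shows "compose (carrier G) f (fun_transf G X H K \<phi>) = fun_transf G Y H K (compose (carrier G) f \<phi>)"
proof -
  interpret X: coset_sums G X by (rule coset_sums_module[OF X])
  interpret Y: coset_sums G Y by (rule coset_sums_module[OF Y])
  interpret f: abelian_group_hom X Y f
    by (rule module_hom_abelian_group_hom[OF X.X.abelian_group_axioms Y.X.abelian_group_axioms f])
  note f\<phi> = compose_fun_fixed[OF X Y f H \<phi>]
  show ?thesis
  proof (rule Y.fun_fixed_eqI)
    show "compose (carrier G) f (fun_transf G X H K \<phi>) \<in> fun_fixed G Y K"
      "fun_transf G Y H K (compose (carrier G) f \<phi>) \<in> fun_fixed G Y K"
      using X Y f H K \<phi> f\<phi> by (simp_all add: compose_fun_fixed X.fun_transf_closed Y.fun_transf_closed)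
    fix h assume h: "h \<in> carrier G"
    have fin: "finite (left_cosets_in G K H)"
      using K by (simp add: R.finite_left_cosets subgroup.subset)
    have "f (fun_transf G X H K \<phi> h) =
        (\<Oplus>\<^bsub>Y\<^esub> C \<in> left_cosets_in G K H. f (\<phi> (h \<otimes> (SOME k. k \<in> C))))"
      unfolding fun_transf_sum[OF H K X.coset_sums_axioms \<phi> h]
      by (rule f.hom_finsum[OF fin fun_transf_closed_summand[OF H K X.coset_sums_axioms \<phi> h]])
    also have "\<dots> = fun_transf G Y H K (compose (carrier G) f \<phi>) h"
      unfolding fun_transf_sum[OF H K Y.coset_sums_axioms f\<phi> h]
      by (rule Y.X.finsum_cong'[OF refl fun_transf_closed_summand[OF H K Y.coset_sums_axioms f\<phi> h]])
        (simp add: compose_def h left_coset_some_carrier[OF H K])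
    finally show "compose (carrier G) f (fun_transf G X H K \<phi>) h =
        fun_transf G Y H K (compose (carrier G) f \<phi>) h"
      using h by (simp add: compose_eq)
  qed
qed

lemma coind_hom_closed:
  assumes X: "module R X" and Y: "module R Y" and f: "f \<in> module_hom R X Y"
  shows "coind_hom G X f \<in> green_module_hom G green (coind_module G X) (coind_module G Y)"
proof (rule green_module_homI)
  interpret X: module R X by fact
  interpret X: coset_sums G X by (rule coset_sums_module[OF X])
  interpret MX: green_module G green "coind_module G X" by (rule green_module_coind[OF X])
  note fD = module_homD[OF f]
  have val: "\<phi> g \<in> carrier X" if "\<phi> \<in> fun_fixed G X H" "g \<in> carrier G" for \<phi> g H
    using that by (rule X.fun_fixed_closed)
  show "coind_hom G X f \<in> extensional {H. subgroup H G}" by (simp add: coind_hom_def)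
  {
    fix H assume H: "subgroup H G"
    interpret L: module "level green H" "level (coind_module G X) H" by (rule MX.level_module[OF H])
    have add: "(\<lambda>g\<in>carrier G. \<phi> g \<oplus>\<^bsub>X\<^esub> \<psi> g) \<in> fun_fixed G X H"
      if "\<phi> \<in> fun_fixed G X H" "\<psi> \<in> fun_fixed G X H" for \<phi> \<psi>
      using L.a_closed[of \<phi> \<psi>] that by (simp add: coind_module_level)
    have smult: "(\<lambda>g\<in>carrier G. a g \<odot>\<^bsub>X\<^esub> \<phi> g) \<in> fun_fixed G X H"
      if "a \<in> fun_fixed G R H" "\<phi> \<in> fun_fixed G X H" for a \<phi>
      using that by (rule coind_smult_closed[OF X H])
    show "coind_hom G X f H
        \<in> module_hom (level green H) (level (coind_module G X) H) (level (coind_module G Y) H)"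
    proof (rule module_homI, unfold coind_module_level green_level)
      show "coind_hom G X f H \<in> extensional (fun_fixed G X H)" using H by (simp add: coind_hom_def)
      show "coind_hom G X f H \<phi> \<in> fun_fixed G Y H" if "\<phi> \<in> fun_fixed G X H" for \<phi>
        using that H by (simp add: coind_hom_apply compose_fun_fixed[OF X Y f])
      show "coind_hom G X f H (\<lambda>g\<in>carrier G. \<phi> g \<oplus>\<^bsub>X\<^esub> \<psi> g) =
          (\<lambda>g\<in>carrier G. coind_hom G X f H \<phi> g \<oplus>\<^bsub>Y\<^esub> coind_hom G X f H \<psi> g)"
        if "\<phi> \<in> fun_fixed G X H" "\<psi> \<in> fun_fixed G X H" for \<phi> \<psi>
        using that H by (auto simp: coind_hom_apply add compose_def fD(3) val intro!: restrict_ext)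
      show "coind_hom G X f H (\<lambda>g\<in>carrier G. a g \<odot>\<^bsub>X\<^esub> \<phi> g) =
          (\<lambda>g\<in>carrier G. a g \<odot>\<^bsub>Y\<^esub> coind_hom G X f H \<phi> g)"
        if "a \<in> fun_fixed G R H" "\<phi> \<in> fun_fixed G X H" for a \<phi>
        using that H R.fun_fixed_closed[of a H]
        by (auto simp: coind_hom_apply smult compose_def fD(4) val intro!: restrict_ext)
    qed
  }
  fix H K \<phi> assume HK: "subgroup H G" "subgroup K G" "H \<subseteq> K"
  show "coind_hom G X f H (restr (coind_module G X) K H \<phi>) =
      restr (coind_module G Y) K H (coind_hom G X f K \<phi>)"
    if "\<phi> \<in> carrier (level (coind_module G X) K)"
    using that HK X.fun_fixed_mono[OF HK(3)]
    by (simp add: coind_module_ops coind_module_level coind_hom_apply subset_iff)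
  show "coind_hom G X f K (transf (coind_module G X) H K \<phi>) =
      transf (coind_module G Y) H K (coind_hom G X f H \<phi>)"
    if "\<phi> \<in> carrier (level (coind_module G X) H)"
    using that HK
    by (simp add: coind_module_ops coind_module_level coind_hom_apply X.fun_transf_closed
        compose_fun_transf[OF X Y f])
next
  interpret X: coset_sums G X by (rule coset_sums_module[OF X])
  fix H g \<phi> assume Hg: "subgroup H G" "g \<in> carrier G" "\<phi> \<in> carrier (level (coind_module G X) H)"
  then have "fun_act G g \<phi> \<in> fun_fixed G X (conj_subgroup G g H)"
    by (simp add: coind_module_level X.fun_act_closed)
  with Hg show "coind_hom G X f (conj_subgroup G g H) (conjg (coind_module G X) g H \<phi>) =
      conjg (coind_module G Y) g H (coind_hom G X f H \<phi>)"
    by (auto simp: coind_module_ops coind_module_level coind_hom_apply subgroup_conj_subgroup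
        compose_def fun_act_def intro!: restrict_ext)
qed

text \<open>The levels of a module coinduced from one living in \<open>U\<close> consist of
  extensional functions from \<open>G\<close> to \<open>U\<close>, which dictates the universe on
  the Green side.\<close>

lemma category_functor_coind:
  "category_functor (module_category R U)
    (green_module_category G green (carrier G \<rightarrow>\<^sub>E U)) (coind_functor G)"
proof (intro category_functor.intro category_functor_axioms.intro category_module_category
    category_green_module_category)
  fix X assume "X \<in> Ob (module_category R U)"
  then have X: "module R X" "carrier X \<subseteq> U" by (simp_all add: module_category_def)
  interpret X: coset_sums G X by (rule coset_sums_module[OF X(1)])
  show "FOb (coind_functor G) X \<in> Ob (green_module_category G green (carrier G \<rightarrow>\<^sub>E U))"
    using X green_module_coind[OF X(1)]
    by (auto simp: coind_functor_def green_module_category_def coind_module_level fun_fixed_def)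
  have "compose (carrier G) (\<lambda>x\<in>carrier X. x) \<phi> = \<phi>" if "\<phi> \<in> fun_fixed G X H" for \<phi> H
    using that by (intro compose_restrict_ident_left) (auto simp: fun_fixed_def PiE_def)
  then show "FMor (coind_functor G) X X (Ident (module_category R U) X) =
      Ident (green_module_category G green (carrier G \<rightarrow>\<^sub>E U)) (FOb (coind_functor G) X)"
    by (auto simp: coind_functor_def green_module_category_def module_category_def coind_hom_def
        coind_module_level intro!: restrict_ext)
next
  fix X Y f assume "X \<in> Ob (module_category R U)" "Y \<in> Ob (module_category R U)"
    "f \<in> Mor (module_category R U) X Y"
  then show "FMor (coind_functor G) X Y f \<in> Mor (green_module_category G green (carrier G \<rightarrow>\<^sub>E U))
      (FOb (coind_functor G) X) (FOb (coind_functor G) Y)"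
    by (simp add: coind_functor_def green_module_category_def module_category_def coind_hom_closed)
next
  fix X Y Z f g assume "X \<in> Ob (module_category R U)" "Y \<in> Ob (module_category R U)"
    "Z \<in> Ob (module_category R U)"
    "f \<in> Mor (module_category R U) X Y" "g \<in> Mor (module_category R U) Y Z"
  then have X: "module R X" and Y: "module R Y" and f: "f \<in> module_hom R X Y"
    by (simp_all add: module_category_def)
  have "coind_hom G X (compose (carrier X) g f) H \<phi> = coind_hom G Y g H (coind_hom G X f H \<phi>)"
    if "subgroup H G" "\<phi> \<in> fun_fixed G X H" for H \<phi>
    using that compose_fun_fixed[OF X Y f that]
    by (auto simp: coind_hom_apply compose_def fun_fixed_def intro!: restrict_ext)
  then show "FMor (coind_functor G) X Z (Comp (module_category R U) X Y Z g f) =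
      Comp (green_module_category G green (carrier G \<rightarrow>\<^sub>E U))
        (FOb (coind_functor G) X) (FOb (coind_functor G) Y) (FOb (coind_functor G) Z)
        (FMor (coind_functor G) Y Z g) (FMor (coind_functor G) X Y f)"
    by (auto simp: coind_functor_def green_module_category_def module_category_def coind_hom_def
        coind_module_level compose_def[of "fun_fixed _ _ _"] intro!: restrict_ext
        cong: restrict_cong)
qed

text \<open>This is the unit of the factor at \<open>1\<close> of \<open>Fun(G, R)\<close>, seen as
  a product of copies of \<open>R\<close>. Its translate \<open>fun_act G (inv g) delta\<close> is
  the unit of the factor at \<open>g\<close>.\<close>

definition delta :: "'g \<Rightarrow> 'r" where
  "delta = (\<lambda>g\<in>carrier G. if g = \<one> then \<one>\<^bsub>R\<^esub> else \<zero>\<^bsub>R\<^esub>)"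

lemma fun_fixed_trivial:
  assumes "coset_sums G X"
  shows "fun_fixed G X {\<one>} = carrier G \<rightarrow>\<^sub>E carrier X"
proof -
  interpret X: coset_sums G X by fact
  show ?thesis by (auto simp: X.fun_fixed_iff X.invariant_def PiE_def)
qed

lemma delta_closed: "delta \<in> fun_fixed G R {\<one>}"
  by (simp add: fun_fixed_trivial R.coset_sums_axioms delta_def)

theorem coind_hom_bij:
  assumes X: "module R X" and Y: "module R Y"
  shows "bij_betw (coind_hom G X) (module_hom R X Y)
    (green_module_hom G green (coind_module G X) (coind_module G Y))"
proof -
  interpret X: module R X by fact
  interpret X: coset_sums G X by (rule coset_sums_module[OF X])
  interpret Y: module R Y by fact
  interpret Y: coset_sums G Y by (rule coset_sums_module[OF Y])
  note triv_fixed = fun_fixed_trivial[OF X.coset_sums_axioms] fun_fixed_trivial[OF Y.coset_sums_axioms]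
    fun_fixed_trivial[OF R.coset_sums_axioms]
  have triv: "subgroup {\<one>} G" by (rule triv_subgroup)
  have const: "(\<lambda>g\<in>carrier G. x) \<in> fun_fixed G X {\<one>}" if "x \<in> carrier X" for x
    using that by (simp add: triv_fixed)
  have "inj_on (coind_hom G X) (module_hom R X Y)"
  proof (rule inj_onI)
    fix f f' assume f: "f \<in> module_hom R X Y" "f' \<in> module_hom R X Y"
      and eq: "coind_hom G X f = coind_hom G X f'"
    have "f x = f' x" if "x \<in> carrier X" for x
    proof -
      \<comment> \<open>A constant function at the trivial subgroup, evaluated at \<open>1\<close>,
        recovers the value of the underlying linear map.\<close>
      have "compose (carrier G) f (\<lambda>g\<in>carrier G. x) \<one> = compose (carrier G) f' (\<lambda>g\<in>carrier G. x) \<one>"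
        using coind_hom_apply[OF triv const[OF that]] eq by metis
      then show ?thesis by (simp add: compose_def)
    qed
    then show "f = f'" using f[THEN module_homD(1)] by (intro extensionalityI)
  qed
  moreover have "F \<in> coind_hom G X ` module_hom R X Y"
    if F: "F \<in> green_module_hom G green (coind_module G X) (coind_module G Y)" for F
  proof
    note FD = green_module_homD[OF F, unfolded coind_module_ops coind_module_level]
    note FlinD = module_homD[OF FD(2), unfolded coind_module_level green_level]
    \<comment> \<open>By \<open>eval_one\<close>, any function with value \<open>x\<close> at
      \<open>1\<close> would give the same \<open>f\<close>. Constant functions are convenient
      because addition and multiplication by constant scalars keep them constant.\<close>
    define f where "f = (\<lambda>x\<in>carrier X. F {\<one>} (\<lambda>g\<in>carrier G. x) \<one>)"
    have eval_one: "F {\<one>} \<phi> \<one> = f (\<phi> \<one>)" if \<phi>: "\<phi> \<in> fun_fixed G X {\<one>}" for \<phi>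
    proof -
      have \<phi>1: "\<phi> \<one> \<in> carrier X" using \<phi> by (auto simp: triv_fixed)
      have delta: "F {\<one>} (\<lambda>g\<in>carrier G. delta g \<odot>\<^bsub>X\<^esub> \<psi> g) \<one> = F {\<one>} \<psi> \<one>"
        if \<psi>: "\<psi> \<in> fun_fixed G X {\<one>}" for \<psi>
      proof -
        have "F {\<one>} \<psi> \<one> \<in> carrier Y" using FlinD(2)[OF triv \<psi>] by (auto simp: triv_fixed)
        then show ?thesis using FlinD(4)[OF triv delta_closed \<psi>] by (simp add: delta_def)
      qed
      \<comment> \<open>Multiplication by \<open>delta\<close> erases every value except the one at
        \<open>1\<close>, so \<open>\<phi>\<close> may be replaced by the constant function with
        value \<open>\<phi> \<one>\<close>.\<close>
      have "(\<lambda>g\<in>carrier G. delta g \<odot>\<^bsub>X\<^esub> \<phi> g) =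
          (\<lambda>g\<in>carrier G. delta g \<odot>\<^bsub>X\<^esub> (\<lambda>g\<in>carrier G. \<phi> \<one>) g)"
        using \<phi> \<phi>1 by (intro restrict_ext) (auto simp: delta_def X.fun_fixed_closed)
      then show ?thesis using delta[OF \<phi>] delta[OF const[OF \<phi>1]] \<phi>1 by (simp add: f_def)
    qed
    have apply_F: "F H \<phi> = compose (carrier G) f \<phi>" if H: "subgroup H G" and \<phi>: "\<phi> \<in> fun_fixed G X H" for H \<phi>
    proof (rule extensionalityI)
      show "F H \<phi> \<in> extensional (carrier G)"
        using FlinD(2)[OF H \<phi>] by (auto simp: fun_fixed_def PiE_def)
      fix g assume g: "g \<in> carrier G"
      let ?gH = "conj_subgroup G g H"
      have gH: "subgroup ?gH G" using H g by (rule subgroup_conj_subgroup)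
      have g\<phi>: "fun_act G g \<phi> \<in> fun_fixed G X ?gH" using H g \<phi> by (rule X.fun_act_closed)
      have sub: "{\<one>} \<subseteq> ?gH" using gH by (simp add: subgroup.one_closed)
      \<comment> \<open>Conjugation by \<open>g\<close> turns the value at \<open>g\<close> into a
        value at \<open>1\<close>. Restriction then leads to the trivial subgroup, where
        \<open>eval_one\<close> applies.\<close>
      have "F H \<phi> g = F ?gH (fun_act G g \<phi>) \<one>"
        using FD(5)[OF H g \<phi>] g by (simp add: fun_act_def)
      also have "\<dots> = F {\<one>} (fun_act G g \<phi>) \<one>" using FD(3)[OF triv gH sub g\<phi>] by simp
      also have "\<dots> = f (\<phi> g)"
        using eval_one X.fun_fixed_mono[OF sub] g\<phi> g by (auto simp: fun_act_def)
      finally show "F H \<phi> g = compose (carrier G) f \<phi> g" using g by (simp add: compose_eq)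
    qed simp
    show "F = coind_hom G X f"
    proof (rule extensionalityI[OF FD(1)])
      show "coind_hom G X f \<in> extensional {H. subgroup H G}" by (simp add: coind_hom_def)
      fix H assume "H \<in> {H. subgroup H G}"
      then have H: "subgroup H G" by simp
      show "F H = coind_hom G X f H"
        by (rule extensionalityI[OF FlinD(1)[OF H]])
          (use H in \<open>simp_all add: coind_hom_def apply_F\<close>)
    qed
    show "f \<in> module_hom R X Y"
    proof (rule module_homI)
      show "f \<in> extensional (carrier X)" by (simp add: f_def)
    next
      fix x assume x: "x \<in> carrier X"
      show "f x \<in> carrier Y"
        using FlinD(2)[OF triv const[OF x]] x by (auto simp: f_def triv_fixed)
      fix y assume y: "y \<in> carrier X"
      show "f (x \<oplus>\<^bsub>X\<^esub> y) = f x \<oplus>\<^bsub>Y\<^esub> f y"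
        using FlinD(3)[OF triv const[OF x] const[OF y]] x y by (simp add: f_def cong: restrict_cong)
    next
      fix r x assume rx: "r \<in> carrier R" "x \<in> carrier X"
      then have r: "(\<lambda>g\<in>carrier G. r) \<in> fun_fixed G R {\<one>}" by (simp add: triv_fixed)
      show "f (r \<odot>\<^bsub>X\<^esub> x) = r \<odot>\<^bsub>Y\<^esub> f x"
        using FlinD(4)[OF triv r const[OF rx(2)]] rx by (simp add: f_def cong: restrict_cong)
    qed
  qed
  ultimately show ?thesis
    using coind_hom_closed[OF X Y] by (auto simp: bij_betw_def)
qed

end

section \<open>Every module over the coinduced Green functor is coinduced\<close>

text \<open>When one of the two subgroups in the double coset formula is trivial, the double cosets
  are left cosets and every intersection of subgroups is trivial. The inner transfers are then
  identities, and a sum of translates remains.\<close>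

lemma (in mackey_functor) restr_transf_trivial:
  assumes H: "subgroup H G" and K: "subgroup K G" and HK: "H \<subseteq> K" and m: "m \<in> carrier (level M H)"
  shows "restr M K {\<one>} (transf M H K m) = (\<Oplus>\<^bsub>level M {\<one>}\<^esub> C \<in> left_cosets_in G K H.
    conjg M (SOME k. k \<in> C) {\<one>} (restr M H {\<one>} m))"
proof -
  have triv: "subgroup {\<one>} G" by (rule triv_subgroup)
  have sub: "{\<one>} \<subseteq> K" "{\<one>} \<subseteq> H" using H K by (simp_all add: subgroup.one_closed)
  interpret E: abelian_group "level M {\<one>}"
    using abelian_group_hom.axioms(1)[OF restr_hom[OF triv triv]] by simp
  have "{\<one>} <#> (g <# H) = g <# H" if "g \<in> K" for g
    using that H K by (auto simp: set_mult_def l_coset_def subgroup.mem_carrier)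
  then have cosets: "double_cosets G {\<one>} K H = left_cosets_in G K H"
    by (simp add: double_cosets_def left_cosets_in_def)
  have some: "(SOME k. k \<in> C) \<in> carrier G" if "C \<in> left_cosets_in G K H" for C
  proof -
    from that obtain k where k: "k \<in> K" "C = k <# H" by (auto simp: left_cosets_in_def)
    then have "k \<in> C" using mem_l_coset_self[OF H] K by (auto simp: subgroup.mem_carrier)
    then have "(SOME k. k \<in> C) \<in> C" by (rule someI)
    then show ?thesis using k H K by (auto intro: l_coset_carrier simp: subgroup.mem_carrier)
  qed
  have in_E: "conjg M g {\<one>} (restr M H {\<one>} m) \<in> carrier (level M {\<one>})" if "g \<in> carrier G" for g
    using conjg_closed[OF triv that restr_closed[OF triv H sub(2) m]] that
    by (simp add: conj_subgroup_trivial)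
  have summand: "transf M ({\<one>} \<inter> conj_subgroup G g H) {\<one>}
      (conjg M g (H \<inter> conj_subgroup G (inv g) {\<one>}) (restr M H (H \<inter> conj_subgroup G (inv g) {\<one>}) m))
      = conjg M g {\<one>} (restr M H {\<one>} m)" if "g \<in> carrier G" for g
  proof -
    have "{\<one>} \<inter> conj_subgroup G g H = {\<one>}" "H \<inter> conj_subgroup G (inv g) {\<one>} = {\<one>}"
      using that subgroup_conj_subgroup[OF H that] H
      by (auto simp: conj_subgroup_trivial subgroup.one_closed)
    then show ?thesis using in_E[OF that] by (simp add: transf_self[OF triv])
  qed
  show ?thesis
    unfolding double_coset_formula[OF triv H K sub(1) HK m] cosets Let_def
    by (rule E.finsum_cong'[OF refl]) (use summand some in_E in auto)
qed

lemma (in group) mult_inv_eq_one_iff: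
  "\<lbrakk>h \<in> carrier G; g \<in> carrier G\<rbrakk> \<Longrightarrow> h \<otimes> inv g = \<one> \<longleftrightarrow> h = g"
  by (metis inv_equality inv_inv r_inv inv_closed)

text \<open>Each coset \<open>hH\<close> contains exactly one point of the transversal, so summing
  its indicator over \<open>hH\<close> gives \<open>1\<close>. Hence the unit is a transfer although
  the order of \<open>H\<close> need not be invertible in \<open>R\<close>.\<close>

lemma (in coinduction) fun_transf_transversal:
  assumes H: "subgroup H G"
  obtains x where "x \<in> fun_fixed G R {\<one>}" "fun_transf G R {\<one>} H x = (\<lambda>g\<in>carrier G. \<one>\<^bsub>R\<^esub>)"
proof
  \<comment> \<open>The transversal consists of the elements that are the \<open>SOME\<close>
    representative of their own coset.\<close>
  define x where "x = (\<lambda>g\<in>carrier G. if g = (SOME y. y \<in> g <# H) then \<one>\<^bsub>R\<^esub> else \<zero>\<^bsub>R\<^esub>)"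
  show x: "x \<in> fun_fixed G R {\<one>}"
    by (simp add: fun_fixed_trivial R.coset_sums_axioms x_def)
  have triv: "subgroup {\<one>} G" by (rule triv_subgroup)
  have sub: "H \<subseteq> carrier G" using H by (rule subgroup.subset)
  show "fun_transf G R {\<one>} H x = (\<lambda>g\<in>carrier G. \<one>\<^bsub>R\<^esub>)"
  proof (rule extensionalityI)
    show "fun_transf G R {\<one>} H x \<in> extensional (carrier G)"
      using R.fun_transf_closed[OF triv H x] by (auto simp: fun_fixed_def PiE_def)
    fix h assume h: "h \<in> carrier G"
    \<comment> \<open>\<open>k\<close> carries \<open>h\<close> to the representative of
      \<open>hH\<close>, so among the terms \<open>x (h \<otimes> i)\<close> with \<open>i\<close>
      in \<open>H\<close> only \<open>i = k\<close> contributes.\<close>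
    obtain k where k: "k \<in> H" "(SOME y. y \<in> h <# H) = h \<otimes> k" using R.some_l_coset[OF H h] by blast
    have x_val: "x (h \<otimes> i) = (if k = i then \<one>\<^bsub>R\<^esub> else \<zero>\<^bsub>R\<^esub>)" if "i \<in> H" for i
    proof -
      have "h \<otimes> i <# H = h <# H"
        using that h H sub by (simp add: lcos_m_assoc[symmetric] coset_join3 subset_iff)
      moreover have "h \<otimes> i = h \<otimes> k \<longleftrightarrow> k = i"
        using that h k sub by (auto simp: subset_iff)
      ultimately show ?thesis using that h k sub by (auto simp: x_def)
    qed
    have cosets: "left_cosets_in G H {\<one>} = (\<lambda>k. {k}) ` H"
      unfolding left_cosets_in_def by (rule image_cong) (use sub in \<open>auto simp: l_coset_def\<close>)
    have "fun_transf G R {\<one>} H x h = (\<Oplus>\<^bsub>R\<^esub> C \<in> (\<lambda>k. {k}) ` H. x (h \<otimes> (SOME k. k \<in> C)))"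
      using fun_transf_sum[OF triv H R.coset_sums_axioms x h] by (simp add: cosets)
    also have "\<dots> = (\<Oplus>\<^bsub>R\<^esub> i \<in> H. x (h \<otimes> (SOME k. k \<in> {i})))"
      by (rule R.finsum_reindex) (use x_val in \<open>auto simp: inj_on_def\<close>)
    also have "\<dots> = (\<Oplus>\<^bsub>R\<^esub> i \<in> H. if k = i then \<one>\<^bsub>R\<^esub> else \<zero>\<^bsub>R\<^esub>)"
      by (rule R.finsum_cong'[OF refl]) (use x_val in auto)
    also have "\<dots> = \<one>\<^bsub>R\<^esub>"
      by (rule R.finsum_singleton) (use k sub finite_carrier in \<open>auto intro: finite_subset\<close>)
    finally show "fun_transf G R {\<one>} H x h = (\<lambda>g\<in>carrier G. \<one>\<^bsub>R\<^esub>) h" using h by simp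
  qed simp
qed

section \<open>The value at the trivial subgroup and its splitting\<close>

locale coind_green_module = coinduction G R + M: green_module G "underlying_green (coind_tambara G R)" M
  for G :: "('g, 'a) monoid_scheme" (structure) and R :: "('r, 'b) ring_scheme"
    and M :: "('g, 'g \<Rightarrow> 'r, 'm) green_module_data"
begin

abbreviation E where "E \<equiv> level M {\<one>}"

abbreviation K where "K \<equiv> level green {\<one>}"

abbreviation c where "c g \<equiv> conjg M g {\<one>}"

text \<open>This is the structure map of \<open>Fun(G, R)\<close> as an \<open>R\<close>-algebra,
  through which \<open>R\<close> acts on \<open>E\<close>.\<close>

definition const :: "'r \<Rightarrow> 'g \<Rightarrow> 'r" where
  "const r = (\<lambda>g\<in>carrier G. r)"

sublocale E: module K E
  by (rule M.level_module) (rule triv_subgroup)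

lemma triv: "subgroup {\<one>} G"
  by (rule triv_subgroup)

lemma triv_subset: "subgroup H G \<Longrightarrow> {\<one>} \<subseteq> H"
  by (simp add: subgroup.one_closed)

lemma carrier_K: "carrier K = carrier G \<rightarrow>\<^sub>E carrier R"
  by (simp add: green_level fun_fixed_trivial R.coset_sums_axioms)

lemma const_closed: "r \<in> carrier R \<Longrightarrow> const r \<in> carrier K"
  by (simp add: carrier_K const_def)

lemma delta_in_K: "delta \<in> carrier K"
  using delta_closed by (simp add: green_level)

lemma delta_delta: "delta \<otimes>\<^bsub>K\<^esub> delta = delta"
  by (auto simp: green_level delta_def intro!: restrict_ext)

text \<open>After multiplication by \<open>delta\<close> only the value \<open>a \<one>\<close>
  matters. On the summand cut out by \<open>delta\<close>, the action of \<open>K\<close> is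
  therefore an action of \<open>R\<close>.\<close>

lemma delta_mult: "a \<in> carrier K \<Longrightarrow> delta \<otimes>\<^bsub>K\<^esub> a = const (a \<one>) \<otimes>\<^bsub>K\<^esub> delta"
  using R.r_null R.l_null PiE_mem[of a "carrier G" "\<lambda>_. carrier R"]
  by (auto simp: green_level(3) delta_def const_def carrier_K intro!: restrict_ext)

lemma fun_act_closed_K: "\<lbrakk>g \<in> carrier G; a \<in> carrier K\<rbrakk> \<Longrightarrow> fun_act G g a \<in> carrier K"
  by (auto simp: carrier_K fun_act_def)

lemma conj_hom: "g \<in> carrier G \<Longrightarrow> abelian_group_hom E E (c g)"
  using M.conjg_hom[OF triv] by (simp add: conj_subgroup_trivial)

lemma conj_closed: "\<lbrakk>g \<in> carrier G; m \<in> carrier E\<rbrakk> \<Longrightarrow> c g m \<in> carrier E"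
  by (rule abelian_group_hom.hom_closed[OF conj_hom])

lemma conj_add:
  "\<lbrakk>g \<in> carrier G; m \<in> carrier E; n \<in> carrier E\<rbrakk> \<Longrightarrow> c g (m \<oplus>\<^bsub>E\<^esub> n) = c g m \<oplus>\<^bsub>E\<^esub> c g n"
  by (rule abelian_group_hom.hom_add[OF conj_hom])

text \<open>This semilinearity lets conjugation carry the summand cut out by \<open>delta\<close> to
  those cut out by its translates.\<close>

lemma conj_smult:
  "\<lbrakk>g \<in> carrier G; a \<in> carrier K; m \<in> carrier E\<rbrakk>
    \<Longrightarrow> c g (a \<odot>\<^bsub>E\<^esub> m) = fun_act G g a \<odot>\<^bsub>E\<^esub> c g m"
  using M.conjg_smult[OF triv] by (simp add: conj_subgroup_trivial green_ops)

lemma conj_one: "m \<in> carrier E \<Longrightarrow> c \<one> m = m"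
  using M.conjg_self[OF triv] by simp

lemma conj_conj:
  "\<lbrakk>g \<in> carrier G; h \<in> carrier G; m \<in> carrier E\<rbrakk> \<Longrightarrow> c g (c h m) = c (g \<otimes> h) m"
  using M.conjg_conjg[OF triv, of g h m] by (simp add: conj_subgroup_trivial)

text \<open>The \<open>R\<close>-module inverse to coinduction is the summand of \<open>M(G/e)\<close> cut out by the idempotent
  \<^const>\<open>delta\<close>.\<close>

definition summand :: "('r, 'm) module" where
  "summand = \<lparr>carrier = {m \<in> carrier E. delta \<odot>\<^bsub>E\<^esub> m = m}, mult = undefined, one = undefined,
    zero = \<zero>\<^bsub>E\<^esub>, add = add E, smult = (\<lambda>r m. const r \<odot>\<^bsub>E\<^esub> m)\<rparr>"

lemma summand_simps:
  "m \<in> carrier summand \<longleftrightarrow> m \<in> carrier E \<and> delta \<odot>\<^bsub>E\<^esub> m = m"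
  "\<zero>\<^bsub>summand\<^esub> = \<zero>\<^bsub>E\<^esub>" "m \<oplus>\<^bsub>summand\<^esub> n = m \<oplus>\<^bsub>E\<^esub> n" "r \<odot>\<^bsub>summand\<^esub> m = const r \<odot>\<^bsub>E\<^esub> m"
  by (simp_all add: summand_def)

lemma delta_smult_const:
  assumes "r \<in> carrier R" "m \<in> carrier E"
  shows "delta \<odot>\<^bsub>E\<^esub> (const r \<odot>\<^bsub>E\<^esub> m) = const r \<odot>\<^bsub>E\<^esub> (delta \<odot>\<^bsub>E\<^esub> m)"
  using assms delta_in_K const_closed E.m_comm[of delta "const r"]
  by (simp add: E.smult_assoc1[symmetric])

lemma module_summand: "module R summand"
proof (rule moduleI)
  show "cring R" by (rule R.is_cring)
  show "abelian_group summand"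
  proof (rule abelian_groupI)
    fix m assume "m \<in> carrier summand"
    then show "\<exists>n\<in>carrier summand. n \<oplus>\<^bsub>summand\<^esub> m = \<zero>\<^bsub>summand\<^esub>"
      using delta_in_K by (intro bexI[of _ "\<ominus>\<^bsub>E\<^esub> m"])
        (simp_all add: summand_simps E.M.l_neg E.smult_r_minus)
  qed (use delta_in_K in \<open>auto simp: summand_simps E.M.a_ac E.smult_r_distr\<close>)
  have "\<one>\<^bsub>K\<^esub> = const \<one>\<^bsub>R\<^esub>" by (simp add: green_level const_def)
  then show "\<one>\<^bsub>R\<^esub> \<odot>\<^bsub>summand\<^esub> m = m" if "m \<in> carrier summand" for m
    using that E.smult_one[of m] by (simp add: summand_simps)
  fix r s m assume "r \<in> carrier R" "s \<in> carrier R" "m \<in> carrier summand"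
  moreover have "const (r \<oplus>\<^bsub>R\<^esub> s) = const r \<oplus>\<^bsub>K\<^esub> const s" "const (r \<otimes>\<^bsub>R\<^esub> s) = const r \<otimes>\<^bsub>K\<^esub> const s"
    by (auto simp: const_def green_level intro!: restrict_ext)
  ultimately show "(r \<oplus>\<^bsub>R\<^esub> s) \<odot>\<^bsub>summand\<^esub> m = r \<odot>\<^bsub>summand\<^esub> m \<oplus>\<^bsub>summand\<^esub> s \<odot>\<^bsub>summand\<^esub> m"
    "(r \<otimes>\<^bsub>R\<^esub> s) \<odot>\<^bsub>summand\<^esub> m = r \<odot>\<^bsub>summand\<^esub> (s \<odot>\<^bsub>summand\<^esub> m)"
    by (simp_all add: summand_simps const_closed E.smult_l_distr E.smult_assoc1)
qed (auto simp: summand_simps const_closed E.smult_r_distr delta_smult_const)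

sublocale S: module R summand
  by (rule module_summand)

sublocale S: coset_sums G summand
  by (rule coset_sums_module[OF module_summand])

text \<open>In the model case \<open>E = Fun(G, X)\<close>, with \<open>X\<close> identified with
  the functions supported at \<open>1\<close>, this is evaluation at \<open>g\<close>.\<close>

definition proj :: "'g \<Rightarrow> 'm \<Rightarrow> 'm" where
  "proj g m = delta \<odot>\<^bsub>E\<^esub> c g m"

lemma proj_closed: "\<lbrakk>g \<in> carrier G; m \<in> carrier E\<rbrakk> \<Longrightarrow> proj g m \<in> carrier summand"
  using delta_in_K by (simp add: proj_def summand_simps conj_closed E.smult_assoc1[symmetric] delta_delta)

lemma proj_add:
  "\<lbrakk>g \<in> carrier G; m \<in> carrier E; n \<in> carrier E\<rbrakk> \<Longrightarrow> proj g (m \<oplus>\<^bsub>E\<^esub> n) = proj g m \<oplus>\<^bsub>summand\<^esub> proj g n"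
  using delta_in_K by (simp add: proj_def summand_simps conj_add conj_closed E.smult_r_distr)

lemma proj_hom: "g \<in> carrier G \<Longrightarrow> abelian_group_hom E summand (proj g)"
  by (intro abelian_group_homI group_hom.intro group_hom_axioms.intro E.M.abelian_group_axioms
      S.M.abelian_group_axioms E.M.a_group S.M.a_group)
    (auto simp: hom_def proj_closed proj_add)

text \<open>The translate \<open>fun_act G g a\<close> has value \<open>a g\<close> at
  \<open>1\<close>, and by \<open>delta_mult\<close> this is the only value that survives the
  projection.\<close>

lemma proj_smult:
  assumes "g \<in> carrier G" "a \<in> carrier K" "m \<in> carrier E"
  shows "proj g (a \<odot>\<^bsub>E\<^esub> m) = a g \<odot>\<^bsub>summand\<^esub> proj g m"
proof -
  have "fun_act G g a \<one> = a g" "a g \<in> carrier R"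
    using assms by (auto simp: fun_act_def carrier_K)
  moreover have "proj g (a \<odot>\<^bsub>E\<^esub> m) = (delta \<otimes>\<^bsub>K\<^esub> fun_act G g a) \<odot>\<^bsub>E\<^esub> c g m"
    using assms by (simp add: proj_def conj_smult E.smult_assoc1 delta_in_K fun_act_closed_K conj_closed)
  ultimately show ?thesis
    using assms by (simp add: delta_mult fun_act_closed_K summand_simps proj_def E.smult_assoc1
        const_closed delta_in_K conj_closed)
qed

text \<open>The counterpart of \<open>(h \<phi>)(g) = \<phi>(gh)\<close>: the coordinates of an
  element of \<open>E\<close> respond to conjugation as the values of a coinduced function
  do.\<close>

lemma proj_conj:
  "\<lbrakk>g \<in> carrier G; h \<in> carrier G; m \<in> carrier E\<rbrakk> \<Longrightarrow> proj g (c h m) = proj (g \<otimes> h) m"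
  by (simp add: proj_def conj_conj)

text \<open>The translates of \<^const>\<open>delta\<close> are orthogonal idempotents with sum \<open>1\<close>, so an element of
  \<open>M(G/e)\<close> is recovered from its projections to the translates of the summand.\<close>

definition assemble :: "('g \<Rightarrow> 'm) \<Rightarrow> 'm" where
  "assemble \<phi> = (\<Oplus>\<^bsub>E\<^esub> g \<in> carrier G. c (inv g) (\<phi> g))"

lemma assemble_summand_closed:
  "\<phi> \<in> carrier G \<rightarrow> carrier summand \<Longrightarrow> (\<lambda>g. c (inv g) (\<phi> g)) \<in> carrier G \<rightarrow> carrier E"
  by (auto simp: Pi_iff summand_simps conj_closed)

lemma assemble_closed: "\<phi> \<in> carrier G \<rightarrow> carrier summand \<Longrightarrow> assemble \<phi> \<in> carrier E"
  unfolding assemble_def by (rule E.M.finsum_closed) (rule assemble_summand_closed)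

text \<open>Conjugating \<open>proj g m\<close> back by \<open>inv g\<close> gives \<open>m\<close>
  multiplied by the translate of \<open>delta\<close> by \<open>inv g\<close>. That translate is the
  indicator of \<open>g\<close>, and the indicators of all \<open>g\<close> add up to the unit of
  \<open>K\<close>.\<close>

lemma assemble_proj:
  assumes m: "m \<in> carrier E"
  shows "assemble (\<lambda>g. proj g m) = m"
proof -
  have d: "(\<lambda>g. fun_act G (inv g) delta) \<in> carrier G \<rightarrow> carrier K"
    by (simp add: fun_act_closed_K delta_in_K)
  have "c (inv g) (proj g m) = fun_act G (inv g) delta \<odot>\<^bsub>E\<^esub> m" if "g \<in> carrier G" for g
    using that m by (simp add: proj_def conj_smult delta_in_K conj_closed conj_conj conj_one)
  then have "assemble (\<lambda>g. proj g m) = (\<Oplus>\<^bsub>E\<^esub> g \<in> carrier G. fun_act G (inv g) delta \<odot>\<^bsub>E\<^esub> m)"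
    unfolding assemble_def using m d by (intro E.M.finsum_cong'[OF refl]) auto
  also have "\<dots> = (\<Oplus>\<^bsub>K\<^esub> g \<in> carrier G. fun_act G (inv g) delta) \<odot>\<^bsub>E\<^esub> m"
    by (rule E.finsum_smult_rdistr[symmetric, OF finite_carrier d m])
  also have "(\<Oplus>\<^bsub>K\<^esub> g \<in> carrier G. fun_act G (inv g) delta) = \<one>\<^bsub>K\<^esub>"
  proof (rule R.fun_fixed_eqI)
    show "(\<Oplus>\<^bsub>K\<^esub> g \<in> carrier G. fun_act G (inv g) delta) \<in> fun_fixed G R {\<one>}"
      "\<one>\<^bsub>K\<^esub> \<in> fun_fixed G R {\<one>}"
      using E.R.finsum_closed[OF d] E.R.one_closed by (simp_all add: green_level(1))
    fix h assume h: "h \<in> carrier G"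
    have "(\<Oplus>\<^bsub>K\<^esub> g \<in> carrier G. fun_act G (inv g) delta) h =
        (\<Oplus>\<^bsub>R\<^esub> g \<in> carrier G. fun_act G (inv g) delta h)"
      by (rule R.pointwise_finsum[OF subgroup.subset[OF triv] green_pointwise finite_carrier d h])
    also have "\<dots> = (\<Oplus>\<^bsub>R\<^esub> g \<in> carrier G. if h = g then \<one>\<^bsub>R\<^esub> else \<zero>\<^bsub>R\<^esub>)"
      by (rule R.finsum_cong'[OF refl]) (use h mult_inv_eq_one_iff in \<open>auto simp: fun_act_def delta_def\<close>)
    also have "\<dots> = \<one>\<^bsub>R\<^esub>" by (rule R.finsum_singleton) (use h finite_carrier in auto)
    finally show "(\<Oplus>\<^bsub>K\<^esub> g \<in> carrier G. fun_act G (inv g) delta) h = \<one>\<^bsub>K\<^esub> h"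
      using h by (simp add: green_level(2))
  qed
  finally show ?thesis using m by simp
qed

text \<open>Orthogonality of the translates: for \<open>k\<close> different from \<open>1\<close>,
  \<open>proj k\<close> kills the summand because \<open>delta\<close> vanishes at \<open>k\<close>.
  Only the term with \<open>h \<otimes> inv g = \<one>\<close> survives, that is
  \<open>g = h\<close>.\<close>

lemma proj_assemble:
  assumes \<phi>: "\<phi> \<in> carrier G \<rightarrow> carrier summand" and h: "h \<in> carrier G"
  shows "proj h (assemble \<phi>) = \<phi> h"
proof -
  interpret p: abelian_group_hom E summand "proj h" by (rule proj_hom[OF h])
  have \<phi>_E: "\<phi> g \<in> carrier E" "delta \<odot>\<^bsub>E\<^esub> \<phi> g = \<phi> g" if "g \<in> carrier G" for g
    using \<phi> that by (auto simp: Pi_iff summand_simps)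
  have vanish: "proj k (\<phi> g) = (if k = \<one> then \<phi> g else \<zero>\<^bsub>summand\<^esub>)"
    if k: "k \<in> carrier G" and g: "g \<in> carrier G" for k g
  proof (cases "k = \<one>")
    case False
    have "proj k (\<phi> g) = proj k (delta \<odot>\<^bsub>E\<^esub> \<phi> g)" by (simp add: \<phi>_E g)
    also have "\<dots> = delta k \<odot>\<^bsub>summand\<^esub> proj k (\<phi> g)"
      by (rule proj_smult[OF k delta_in_K \<phi>_E(1)[OF g]])
    also have "\<dots> = \<zero>\<^bsub>summand\<^esub>" using k g \<phi>_E False by (simp add: delta_def proj_closed)
    finally show ?thesis using False by simp
  qed (use g \<phi>_E in \<open>simp add: proj_def conj_one\<close>)
  have "proj h (assemble \<phi>) = (\<Oplus>\<^bsub>summand\<^esub> g \<in> carrier G. proj h (c (inv g) (\<phi> g)))"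
    unfolding assemble_def by (rule p.hom_finsum[OF finite_carrier assemble_summand_closed[OF \<phi>]])
  also have "\<dots> = (\<Oplus>\<^bsub>summand\<^esub> g \<in> carrier G. if h = g then \<phi> g else \<zero>\<^bsub>summand\<^esub>)"
  proof (rule S.M.finsum_cong'[OF refl])
    show "(\<lambda>g. if h = g then \<phi> g else \<zero>\<^bsub>summand\<^esub>) \<in> carrier G \<rightarrow> carrier summand"
      using \<phi> by auto
    fix g assume g: "g \<in> carrier G"
    then show "proj h (c (inv g) (\<phi> g)) = (if h = g then \<phi> g else \<zero>\<^bsub>summand\<^esub>)"
      using h \<phi>_E by (simp add: proj_conj vanish mult_inv_eq_one_iff)
  qed
  also have "\<dots> = \<phi> h" by (rule S.M.finsum_singleton[OF h finite_carrier \<phi>])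
  finally show ?thesis .
qed

lemma proj_inj:
  assumes "m \<in> carrier E" "n \<in> carrier E" "\<And>g. g \<in> carrier G \<Longrightarrow> proj g m = proj g n"
  shows "m = n"
proof -
  have "assemble (\<lambda>g. proj g m) = assemble (\<lambda>g. proj g n)"
    unfolding assemble_def using assms proj_closed
    by (intro E.M.finsum_cong'[OF refl] assemble_summand_closed) auto
  then show ?thesis using assms by (simp add: assemble_proj)
qed

section \<open>Comparison of a Green module with the coinduction of its summand\<close>

definition unit :: "'g set \<Rightarrow> 'm \<Rightarrow> 'g \<Rightarrow> 'm" where
  "unit = (\<lambda>H\<in>{H. subgroup H G}. \<lambda>m\<in>carrier (level M H). \<lambda>g\<in>carrier G. proj g (restr M H {\<one>} m))"

lemma res_closed:
  "\<lbrakk>subgroup H G; m \<in> carrier (level M H)\<rbrakk> \<Longrightarrow> restr M H {\<one>} m \<in> carrier E"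
  by (rule M.restr_closed[OF triv _ triv_subset])

lemma unit_apply:
  "\<lbrakk>subgroup H G; m \<in> carrier (level M H)\<rbrakk>
    \<Longrightarrow> unit H m = (\<lambda>g\<in>carrier G. proj g (restr M H {\<one>} m))"
  by (simp add: unit_def)

text \<open>An element \<open>h\<close> of \<open>H\<close> normalizes \<open>H\<close> and acts
  trivially on M(G/H), while restriction commutes with conjugation.\<close>

lemma res_fixed:
  assumes "subgroup H G" "m \<in> carrier (level M H)" "h \<in> H"
  shows "c h (restr M H {\<one>} m) = restr M H {\<one>} m"
proof -
  have h: "h \<in> carrier G" using assms by (simp add: subgroup.mem_carrier)
  have "c h (restr M H {\<one>} m) = restr M (conj_subgroup G h H) {\<one>} (conjg M h H m)"
    using M.conjg_restr[OF triv assms(1) triv_subset[OF assms(1)] h assms(2)] h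
    by (simp add: conj_subgroup_trivial)
  moreover have "conj_subgroup G h H = H"
  proof -
    have "x \<in> conj_subgroup G h H \<longleftrightarrow> x \<in> H" if x: "x \<in> carrier G" for x
    proof -
      have "x \<in> H" if "inv h \<otimes> x \<otimes> h \<in> H"
      proof -
        have "h \<otimes> (inv h \<otimes> x \<otimes> h) \<otimes> inv h \<in> H"
          using that assms by (simp add: subgroup.m_closed subgroup.m_inv_closed)
        then show ?thesis using h x by (simp add: m_assoc mult_inv_cancel_left)
      qed
      then show ?thesis
        using assms h x
        by (auto simp: mem_conj_subgroup_iff subgroup.subset subgroup.m_closed subgroup.m_inv_closed)
    qed
    then show ?thesis
      using subgroup.subset[OF assms(1)] subgroup.subset[OF subgroup_conj_subgroup[OF assms(1) h]]
      by blast
  qed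
  ultimately show ?thesis using assms M.conjg_self[OF assms(1,3,2)] by simp
qed

lemma unit_closed:
  assumes "subgroup H G" "m \<in> carrier (level M H)"
  shows "unit H m \<in> fun_fixed G summand H"
  unfolding unit_apply[OF assms]
proof (rule S.fun_fixed_restrictI)
  show sub: "H \<subseteq> carrier G" using assms by (simp add: subgroup.subset)
  show "S.invariant H (\<lambda>g. proj g (restr M H {\<one>} m))"
    using assms sub by (auto simp: S.invariant_def proj_closed res_closed proj_conj[symmetric] res_fixed subset_iff)
qed

lemma unit_hom: "unit \<in> green_module_hom G green M (coind_module G summand)"
proof (rule green_module_homI, unfold coind_module_ops)
  show "unit \<in> extensional {H. subgroup H G}" by (simp add: unit_def)
next
  fix H assume H: "subgroup H G"
  interpret MH: module "level green H" "level M H" by (rule M.level_module[OF H])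
  interpret res: abelian_group_hom "level M H" E "restr M H {\<one>}"
    by (rule M.restr_hom[OF triv H triv_subset[OF H]])
  show "unit H \<in> module_hom (level green H) (level M H) (level (coind_module G summand) H)"
  proof (rule module_homI, unfold coind_module_level)
    show "unit H \<in> extensional (carrier (level M H))" using H by (simp add: unit_def)
    fix m assume m: "m \<in> carrier (level M H)"
    then show "unit H m \<in> fun_fixed G summand H" using H by (simp add: unit_closed)
    show "unit H (m \<oplus>\<^bsub>level M H\<^esub> n) = (\<lambda>g\<in>carrier G. unit H m g \<oplus>\<^bsub>summand\<^esub> unit H n g)"
      if "n \<in> carrier (level M H)" for n
      using that m H by (auto simp: unit_apply proj_add intro!: restrict_ext)
  next
    fix a m assume am: "a \<in> carrier (level green H)" "m \<in> carrier (level M H)"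
    then have "a \<in> carrier K"
      using R.fun_fixed_mono[OF triv_subset[OF H]] by (auto simp: green_level)
    then show "unit H (a \<odot>\<^bsub>level M H\<^esub> m) = (\<lambda>g\<in>carrier G. a g \<odot>\<^bsub>summand\<^esub> unit H m g)"
      using am H M.restr_smult[OF triv H triv_subset[OF H] am]
      by (auto simp: unit_apply proj_smult green_ops res_closed intro!: restrict_ext)
  qed
next
  fix H L m assume HL: "subgroup H G" "subgroup L G" "H \<subseteq> L"
  show "unit H (restr M L H m) = unit L m" if "m \<in> carrier (level M L)"
    using that HL M.restr_restr[OF triv HL(1,2) triv_subset[OF HL(1)]]
    by (simp add: unit_apply M.restr_closed)
  show "unit L (transf M H L m) = fun_transf G summand H L (unit H m)"
    if m: "m \<in> carrier (level M H)"
  proof (rule S.fun_fixed_eqI)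
    have tr: "transf M H L m \<in> carrier (level M L)" using HL m by (rule M.transf_closed)
    note um = unit_closed[OF HL(1) m]
    show "unit L (transf M H L m) \<in> fun_fixed G summand L"
      "fun_transf G summand H L (unit H m) \<in> fun_fixed G summand L"
      using HL tr um by (simp_all add: unit_closed S.fun_transf_closed)
    fix h assume h: "h \<in> carrier G"
    interpret p: abelian_group_hom E summand "proj h" by (rule proj_hom[OF h])
    have fin: "finite (left_cosets_in G L H)"
      using HL by (simp add: R.finite_left_cosets subgroup.subset)
    note some = left_coset_some_carrier[OF HL(1,2)]
    have "unit L (transf M H L m) h = proj h
        (\<Oplus>\<^bsub>E\<^esub> C \<in> left_cosets_in G L H. c (SOME k. k \<in> C) (restr M H {\<one>} m))"
      using HL tr h by (simp add: unit_apply M.restr_transf_trivial[OF HL m])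
    also have "\<dots> = (\<Oplus>\<^bsub>summand\<^esub> C \<in> left_cosets_in G L H.
        proj h (c (SOME k. k \<in> C) (restr M H {\<one>} m)))"
      by (rule p.hom_finsum[OF fin]) (use some HL m in \<open>auto simp: conj_closed res_closed\<close>)
    \<comment> \<open>\<open>proj_conj\<close> turns the translate by a representative
      \<open>k\<close> into the value of \<open>unit H m\<close> at \<open>h k\<close>. Both sides
      now run over the same cosets with the same \<open>SOME\<close> representatives.\<close>
    also have "\<dots> = fun_transf G summand H L (unit H m) h"
      unfolding fun_transf_sum[OF HL(1,2) S.coset_sums_axioms um h]
      by (rule S.M.finsum_cong'[OF refl
            fun_transf_closed_summand[OF HL(1,2) S.coset_sums_axioms um h]])
        (use some HL m h in \<open>simp add: unit_apply proj_conj res_closed\<close>)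
    finally show "unit L (transf M H L m) h = fun_transf G summand H L (unit H m) h" .
  qed
next
  fix H g m assume Hg: "subgroup H G" "g \<in> carrier G" and m: "m \<in> carrier (level M H)"
  have gH: "subgroup (conj_subgroup G g H) G" using Hg by (rule subgroup_conj_subgroup)
  have "restr M (conj_subgroup G g H) {\<one>} (conjg M g H m) = c g (restr M H {\<one>} m)"
    using M.conjg_restr[OF triv Hg(1) triv_subset[OF Hg(1)] Hg(2) m] Hg
    by (simp add: conj_subgroup_trivial)
  then show "unit (conj_subgroup G g H) (conjg M g H m) = fun_act G g (unit H m)"
    using Hg m gH
    by (auto simp: unit_apply M.conjg_closed fun_act_def proj_conj res_closed intro!: restrict_ext)
qed

text \<open>Since \<open>1\<close> is a transfer from \<open>k(G/e)\<close> to \<open>k(G/H)\<close>, Frobenius reciprocity makes restriction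
  to the trivial subgroup injective and lets every invariant element of \<open>M(G/e)\<close> be lifted.\<close>

lemma unit_bij:
  assumes H: "subgroup H G"
  shows "bij_betw (unit H) (carrier (level M H)) (fun_fixed G summand H)"
proof (rule bij_betw_imageI)
  interpret MH: module "level green H" "level M H" by (rule M.level_module[OF H])
  obtain x where x: "x \<in> fun_fixed G R {\<one>}" and tr_x: "fun_transf G R {\<one>} H x = (\<lambda>g\<in>carrier G. \<one>\<^bsub>R\<^esub>)"
    using fun_transf_transversal[OF H] by blast
  have xK: "x \<in> carrier K" using x by (simp add: green_level)
  have tr_x_one: "transf green {\<one>} H x = \<one>\<^bsub>level green H\<^esub>"
    by (simp add: green_ops green_level tr_x)
  have recover: "m = transf M {\<one>} H (x \<odot>\<^bsub>E\<^esub> restr M H {\<one>} m)" if "m \<in> carrier (level M H)" for m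
    using M.frobenius_transf_ring[OF triv H triv_subset[OF H] xK that] that by (simp add: tr_x_one)
  show "inj_on (unit H) (carrier (level M H))"
  proof (rule inj_onI)
    fix m n assume mn: "m \<in> carrier (level M H)" "n \<in> carrier (level M H)" and eq: "unit H m = unit H n"
    have "restr M H {\<one>} m = restr M H {\<one>} n"
    proof (rule proj_inj)
      show "proj g (restr M H {\<one>} m) = proj g (restr M H {\<one>} n)" if "g \<in> carrier G" for g
        using fun_cong[OF eq, of g] that mn H by (simp add: unit_apply)
    qed (use mn H in \<open>simp_all add: res_closed\<close>)
    then show "m = n" using recover mn by metis
  qed
  have "\<phi> \<in> unit H ` carrier (level M H)" if \<phi>: "\<phi> \<in> fun_fixed G summand H" for \<phi>
  proof
    have \<phi>_fun: "\<phi> \<in> carrier G \<rightarrow> carrier summand" using \<phi> by (auto simp: fun_fixed_def)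
    define y where "y = assemble \<phi>"
    have y: "y \<in> carrier E" using \<phi>_fun by (simp add: y_def assemble_closed)
    have proj_y: "proj g y = \<phi> g" if "g \<in> carrier G" for g
      using that \<phi>_fun by (simp add: y_def proj_assemble)
    \<comment> \<open>All coordinates agree: \<open>proj g\<close> of the conjugate is
      \<open>proj (g \<otimes> h) y\<close>, that is \<open>\<phi> (g \<otimes> h)\<close>, and this
      equals \<open>\<phi> g\<close> by invariance.\<close>
    have fixed: "c h y = y" if "h \<in> H" for h
    proof (rule proj_inj)
      have h: "h \<in> carrier G" using that H by (simp add: subgroup.mem_carrier)
      show "c h y \<in> carrier E" "y \<in> carrier E" using h y by (simp_all add: conj_closed)
      show "proj g (c h y) = proj g y" if "g \<in> carrier G" for g
        using S.fun_fixed_invariant[OF H \<phi>] that \<open>h \<in> H\<close> h y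
        by (simp add: proj_conj proj_y S.invariant_def)
    qed
    have xy: "x \<odot>\<^bsub>E\<^esub> y \<in> carrier E" using xK y by simp
    let ?m = "transf M {\<one>} H (x \<odot>\<^bsub>E\<^esub> y)"
    show m: "?m \<in> carrier (level M H)" by (rule M.transf_closed[OF triv H triv_subset[OF H] xy])
    note some = R.some_left_coset_mem[OF triv H triv_subset[OF H]]
    have someG: "(SOME k. k \<in> C) \<in> carrier G" if "C \<in> left_cosets_in G H {\<one>}" for C
      using some[OF that] H by (simp add: subgroup.mem_carrier)
    have fin: "finite (left_cosets_in G H {\<one>})"
      using H by (simp add: R.finite_left_cosets subgroup.subset)
    \<comment> \<open>At the trivial subgroup the level is the full function ring as a record, so a
      sum in \<open>K\<close> is the very sum by which \<open>fun_transf\<close> is defined.\<close>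
    have K_eq: "K = fun_ring G R"
      by (simp add: underlying_green_def mackey.defs coind_tambara_def fun_fixed_trivial
          R.coset_sums_axioms fun_ring_def)
    have "restr M H {\<one>} ?m = (\<Oplus>\<^bsub>E\<^esub> C \<in> left_cosets_in G H {\<one>}. c (SOME k. k \<in> C) (x \<odot>\<^bsub>E\<^esub> y))"
      using M.restr_transf_trivial[OF triv H triv_subset[OF H] xy] M.restr_self[OF triv xy] by simp
    \<comment> \<open>The representatives lie in \<open>H\<close> and so fix \<open>y\<close>; only
      the factor \<open>x\<close> is translated.\<close>
    also have "\<dots> = (\<Oplus>\<^bsub>E\<^esub> C \<in> left_cosets_in G H {\<one>}. fun_act G (SOME k. k \<in> C) x \<odot>\<^bsub>E\<^esub> y)"
      by (rule E.M.finsum_cong'[OF refl])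
        (use some someG xK y in \<open>auto simp: conj_smult fixed fun_act_closed_K\<close>)
    also have "\<dots> = (\<Oplus>\<^bsub>K\<^esub> C \<in> left_cosets_in G H {\<one>}. fun_act G (SOME k. k \<in> C) x) \<odot>\<^bsub>E\<^esub> y"
      by (rule E.finsum_smult_rdistr[symmetric, OF fin _ y])
        (use someG xK in \<open>auto simp: fun_act_closed_K\<close>)
    also have "(\<Oplus>\<^bsub>K\<^esub> C \<in> left_cosets_in G H {\<one>}. fun_act G (SOME k. k \<in> C) x) = \<one>\<^bsub>K\<^esub>"
      using tr_x by (simp add: fun_transf_def K_eq[symmetric] green_level(2))
    finally have "restr M H {\<one>} ?m = y" using y by simp
    then show "\<phi> = unit H ?m"
      unfolding unit_apply[OF H m] using \<phi> proj_y
      by (intro extensionalityI[of _ "carrier G"]) (auto simp: fun_fixed_def PiE_def)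
  qed
  then show "unit H ` carrier (level M H) = fun_fixed G summand H"
    using unit_closed[OF H] by blast
qed

end

section \<open>Coinduction is an adjoint equivalence\<close>

text \<open>A bijection between \<open>U \<times> U\<close> and \<open>U\<close> absorbs one
  coordinate at a time, by induction on the finite index set.\<close>

lemma inj_PiE_into_infinite:
  assumes U: "infinite U" and I: "finite I"
  obtains j where "inj_on j (I \<rightarrow>\<^sub>E U)" "j ` (I \<rightarrow>\<^sub>E U) \<subseteq> U"
proof -
  obtain p where p: "bij_betw p (U \<times> U) U"
    using card_of_Times_same_infinite[OF U] card_of_ordIso by blast
  have "\<exists>j. inj_on j (I \<rightarrow>\<^sub>E U) \<and> j ` (I \<rightarrow>\<^sub>E U) \<subseteq> U"
    using I
  proof (induction I)
    case empty
    obtain u where "u \<in> U" using U by fastforce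
    then show ?case by (intro exI[of _ "\<lambda>_. u"]) (auto simp: PiE_def)
  next
    case (insert i I)
    then obtain j where j: "inj_on j (I \<rightarrow>\<^sub>E U)" "j ` (I \<rightarrow>\<^sub>E U) \<subseteq> U" by blast
    have restr: "restrict \<phi> I \<in> I \<rightarrow>\<^sub>E U" "\<phi> i \<in> U" if "\<phi> \<in> insert i I \<rightarrow>\<^sub>E U" for \<phi>
      using that by auto
    have "inj_on (\<lambda>\<phi>. p (\<phi> i, j (restrict \<phi> I))) (insert i I \<rightarrow>\<^sub>E U)"
    proof (rule inj_onI)
      fix \<phi> \<psi> assume \<phi>: "\<phi> \<in> insert i I \<rightarrow>\<^sub>E U" and \<psi>: "\<psi> \<in> insert i I \<rightarrow>\<^sub>E U"
        and eq: "p (\<phi> i, j (restrict \<phi> I)) = p (\<psi> i, j (restrict \<psi> I))"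
      have "(\<phi> i, j (restrict \<phi> I)) = (\<psi> i, j (restrict \<psi> I))"
        by (rule inj_onD[OF bij_betw_imp_inj_on[OF p] eq]) (use restr[OF \<phi>] restr[OF \<psi>] j in auto)
      then have "\<phi> i = \<psi> i" "restrict \<phi> I = restrict \<psi> I"
        using inj_onD[OF j(1)] restr[OF \<phi>] restr[OF \<psi>] by auto
      then show "\<phi> = \<psi>"
        by (intro PiE_ext[OF \<phi> \<psi>]) (metis insertE restrict_apply')
    qed
    moreover have "p (\<phi> i, j (restrict \<phi> I)) \<in> U" if "\<phi> \<in> insert i I \<rightarrow>\<^sub>E U" for \<phi>
      using restr[OF that] j by (intro bij_betw_apply[OF p]) auto
    ultimately show ?case by blast
  qed
  then show ?thesis using that by blast
qed

text \<open>Needed because the elements of the summand of M(G/e) are functions from \<open>G\<close>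
  to \<open>U\<close>, whereas an object of the module category has its elements in \<open>U\<close>
  itself.\<close>

lemma module_transport:
  fixes X :: "('r, 'x) module" and j :: "'x \<Rightarrow> 'y"
  assumes X: "module R X" and j: "inj_on j (carrier X)"
  obtains Y :: "('r, 'y) module" where "module R Y" "carrier Y = j ` carrier X"
    "restrict j (carrier X) \<in> module_hom R X Y"
proof
  interpret X: module R X by fact
  define i where "i = inv_into (carrier X) j"
  have ij: "i (j x) = x" if "x \<in> carrier X" for x using j that by (simp add: i_def)
  define Y :: "('r, 'y) module" where "Y = \<lparr>carrier = j ` carrier X, mult = undefined, one = undefined,
    zero = j \<zero>\<^bsub>X\<^esub>, add = (\<lambda>x y. j (i x \<oplus>\<^bsub>X\<^esub> i y)), smult = (\<lambda>r x. j (r \<odot>\<^bsub>X\<^esub> i x))\<rparr>"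
  show "carrier Y = j ` carrier X" by (simp add: Y_def)
  show "module R Y"
  proof (rule moduleI)
    show "cring R" by (rule X.R.is_cring)
    show "abelian_group Y"
    proof (rule abelian_groupI)
      fix x assume "x \<in> carrier Y"
      then obtain x' where "x' \<in> carrier X" "x = j x'" by (auto simp: Y_def)
      then show "\<exists>y\<in>carrier Y. y \<oplus>\<^bsub>Y\<^esub> x = \<zero>\<^bsub>Y\<^esub>"
        by (intro bexI[of _ "j (\<ominus>\<^bsub>X\<^esub> x')"]) (auto simp: Y_def ij X.M.l_neg)
    qed (auto simp: Y_def ij X.M.a_ac)
  qed (auto simp: Y_def ij X.smult_l_distr X.smult_r_distr X.smult_assoc1)
  show "restrict j (carrier X) \<in> module_hom R X Y"
    by (rule module_homI) (auto simp: Y_def ij)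
qed

text \<open>The inverse is composition with the inverse of \<open>f\<close>, which preserves
  invariance because it acts on values only.\<close>

lemma (in coinduction) coind_hom_level_bij:
  assumes X: "module R X" and Y: "module R Y" and f: "f \<in> module_hom R X Y"
    and bij: "bij_betw f (carrier X) (carrier Y)" and H: "subgroup H G"
  shows "bij_betw (coind_hom G X f H) (fun_fixed G X H) (fun_fixed G Y H)"
proof (rule bij_betw_imageI)
  interpret X: coset_sums G X by (rule coset_sums_module[OF X])
  interpret Y: coset_sums G Y by (rule coset_sums_module[OF Y])
  have sub: "H \<subseteq> carrier G" using H by (rule subgroup.subset)
  show "inj_on (coind_hom G X f H) (fun_fixed G X H)"
  proof (rule inj_onI)
    fix \<phi> \<psi> assume *: "\<phi> \<in> fun_fixed G X H" "\<psi> \<in> fun_fixed G X H"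
      and "coind_hom G X f H \<phi> = coind_hom G X f H \<psi>"
    then have "compose (carrier G) f \<phi> = compose (carrier G) f \<psi>"
      using H by (simp add: coind_hom_apply)
    then have "f (\<phi> g) = f (\<psi> g)" if "g \<in> carrier G" for g
      using that by (metis compose_eq)
    then show "\<phi> = \<psi>"
      using * by (intro X.fun_fixed_eqI[of _ H _ H] inj_onD[OF bij_betw_imp_inj_on[OF bij]])
        (auto intro: X.fun_fixed_closed)
  qed
  show "coind_hom G X f H ` fun_fixed G X H = fun_fixed G Y H"
  proof
    show "coind_hom G X f H ` fun_fixed G X H \<subseteq> fun_fixed G Y H"
      using H by (auto simp: coind_hom_apply compose_fun_fixed[OF X Y f])
    show "fun_fixed G Y H \<subseteq> coind_hom G X f H ` fun_fixed G X H"
    proof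
      fix \<psi> assume \<psi>: "\<psi> \<in> fun_fixed G Y H"
      define \<phi> where "\<phi> = (\<lambda>g\<in>carrier G. inv_into (carrier X) f (\<psi> g))"
      have img: "f ` carrier X = carrier Y" using bij by (rule bij_betw_imp_surj_on)
      have \<phi>: "\<phi> \<in> fun_fixed G X H"
        unfolding \<phi>_def
        by (rule X.fun_fixed_restrictI[OF sub])
          (use Y.fun_fixed_invariant[OF H \<psi>] img in \<open>auto simp: X.invariant_def Y.invariant_def
            intro!: inv_into_into\<close>)
      have "coind_hom G X f H \<phi> = \<psi>"
        unfolding coind_hom_apply[OF H \<phi>]
        by (rule Y.fun_fixed_eqI[OF compose_fun_fixed[OF X Y f H \<phi>] \<psi>])
          (use Y.fun_fixed_closed[OF \<psi>] img in \<open>simp add: compose_eq \<phi>_def f_inv_into_f\<close>)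
      with \<phi> show "\<psi> \<in> coind_hom G X f H ` fun_fixed G X H" by blast
    qed
  qed
qed

lemma (in coinduction) coind_ess_surj:
  fixes U :: "'x set"
  assumes U: "infinite U" and M: "M \<in> Ob (green_module_category G green (carrier G \<rightarrow>\<^sub>E U))"
  shows "\<exists>X \<in> Ob (module_category R U). \<exists>f.
    is_iso (green_module_category G green (carrier G \<rightarrow>\<^sub>E U)) M (FOb (coind_functor G) X) f"
proof -
  have M_mod: "green_module G green M" and M_sub: "carrier (level M {\<one>}) \<subseteq> carrier G \<rightarrow>\<^sub>E U"
    using M triv_subgroup by (auto simp: green_module_category_def)
  interpret coind_green_module G R M
    by (intro coind_green_module.intro coinduction_axioms M_mod)
  obtain j where j: "inj_on j (carrier G \<rightarrow>\<^sub>E U)" "j ` (carrier G \<rightarrow>\<^sub>E U) \<subseteq> U"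
    using inj_PiE_into_infinite[OF U finite_carrier] by blast
  have S_sub: "carrier summand \<subseteq> carrier G \<rightarrow>\<^sub>E U" using M_sub by (auto simp: summand_simps)
  have inj: "inj_on j (carrier summand)" by (rule inj_on_subset[OF j(1) S_sub])
  obtain X :: "('r, 'x) module" where X: "module R X" "carrier X = j ` carrier summand"
    "restrict j (carrier summand) \<in> module_hom R summand X"
    using module_transport[OF module_summand inj] by blast
  have X_ob: "X \<in> Ob (module_category R U)"
  proof -
    have "carrier X \<subseteq> U" using X(2) S_sub j(2) by blast
    then show ?thesis using X(1) by (simp add: module_category_def)
  qed
  let ?j = "restrict j (carrier summand)"
  \<comment> \<open>\<open>unit\<close> compares \<open>M\<close> with the coinduction of
    \<open>summand\<close>; the second factor coinduces the transport of \<open>summand\<close> into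
    \<open>U\<close>.\<close>
  let ?f = "\<lambda>H\<in>{H. subgroup H G}. compose (carrier (level M H)) (coind_hom G summand ?j H) (unit H)"
  have "?f \<in> green_module_hom G green M (coind_module G X)"
    by (rule green_module_hom_compose[OF M_mod green_module_coind[OF module_summand] unit_hom
          coind_hom_closed[OF module_summand X(1,3)]])
  moreover have "coind_module G X \<in> Ob (green_module_category G green (carrier G \<rightarrow>\<^sub>E U))"
    using category_functor.fob[OF category_functor_coind X_ob] by (simp add: coind_functor_def)
  moreover have "bij_betw (?f H) (carrier (level M H)) (carrier (level (coind_module G X) H))"
    if H: "subgroup H G" for H
  proof -
    have "bij_betw ?j (carrier summand) (carrier X)"
      using inj X(2) by (simp add: bij_betw_def)
    then have "bij_betw (coind_hom G summand ?j H \<circ> unit H) (carrier (level M H)) (fun_fixed G X H)"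
      by (rule bij_betw_trans[OF unit_bij[OF H] coind_hom_level_bij[OF module_summand X(1,3) _ H]])
    then show ?thesis
      using H bij_betw_cong[of "carrier (level M H)" "?f H" "coind_hom G summand ?j H \<circ> unit H"]
      by (simp add: compose_def coind_module_level)
  qed
  ultimately have "is_iso (green_module_category G green (carrier G \<rightarrow>\<^sub>E U)) M (coind_module G X) ?f"
    by (intro green_module_hom_bij_is_iso[OF M])
  with X_ob show ?thesis by (auto simp: coind_functor_def)
qed

theorem proposition5p8:
  fixes G :: "('g, 'a) monoid_scheme" and R :: "('r, 'b) ring_scheme" and U :: "'x set"
  assumes "group G" and "finite (carrier G)" and "cring R"
    and "infinite U"
  shows "\<exists>L \<eta> \<epsilon>. adjoint_equivalence
    (green_module_category G (underlying_green (coind_tambara G R)) (carrier G \<rightarrow>\<^sub>E U))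
    (module_category R U)
    L (coind_functor G) \<eta> \<epsilon>"
proof -
  interpret coinduction G R
    by (intro coinduction.intro coinduction_axioms.intro assms)
  show ?thesis
  proof (rule fully_faithful_ess_surj_adjoint_equivalence[OF category_functor_coind])
    show "bij_betw (FMor (coind_functor G) X Y) (Mor (module_category R U) X Y)
        (Mor (green_module_category G green (carrier G \<rightarrow>\<^sub>E U))
          (FOb (coind_functor G) X) (FOb (coind_functor G) Y))"
      if "X \<in> Ob (module_category R U)" "Y \<in> Ob (module_category R U)" for X Y
      using that by (simp add: coind_hom_bij coind_functor_def module_category_def green_module_category_def)
  qed (rule coind_ess_surj[OF assms(4)])
qed

end
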